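(* Let $\lambda>0$, let $N$ be a non-negative integer, and let $p(x)$ be a trigonometric polynomial of degree at most $N$ on $\mathbb{R}/\mathbb{Z}$. Then $$\int_{-1/2}^{1/2}\theta_1\bigl(u,i\lambda^{-1}(2N+2)^2\bigr)\,du\ \le\ \int_{\mathbb{R}/\mathbb{Z}}\bigl|\theta_3\bigl(x,i\lambda^{-1}\bigr)-p(x)\bigr|\,dx,$$ and there is equality if and only if $p(x)=k_{\lambda,N}(x)$.
   Context: With $e(z)=e^{2\pi i z}$, $\Im\tau>0$ and $q=e^{\pi i\tau}$ (and $q^s=e^{\pi i\tau s}$), $\theta_1(v,\tau)=\sum_{n\in\mathbb{Z}}q^{(n+\frac12)^2}e((n+\frac12)v)$ and $\theta_3(v,\tau)=\sum_{n\in\mathbb{Z}}q^{n^2}e(nv)$. A trigonometric polynomial of degree at most $N$ is $\sum_{n=-N}^N c_n e(nx)$ with $c_n\in\mathbb{C}$. For $\mu>0$, $G_\mu(z)=e^{-\pi\mu z^2}$ and $$K_\mu(z)=\frac{\cos\pi z}{\pi}\sum_{n\in\mathbb{Z}}(-1)^{n+1}\frac{G_\mu(n+\frac12)}{z-n-\frac12}$$ (an entire function, removable singularities filled in), with $\widehat{K}_\mu(t)=\int_{-\infty}^\infty K_\mu(x)e(-xt)\,dx$. Define $$k_{\lambda,N}(x)=\lambda^{1/2}\sum_{n\in\mathbb{Z}}K_{(2N+2)^{-2}\lambda}\bigl((2N+2)(x+n)\bigr)=\lambda^{1/2}(2N+2)^{-1}\sum_{n=-N}^{N}\widehat{K}_{(2N+2)^{-2}\lambda}\Bigl(\frac{n}{2N+2}\Bigr)e(nx).$$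 The two expressions agree by Poisson summation, and $k_{\lambda,N}$ is a trigonometric polynomial of degree at most $N$. *)

theory Defs
  imports "HOL-Complex_Analysis.Complex_Analysis" "HOL-Library.Complex_Order"
begin

definition e_char :: "complex \<Rightarrow> complex" where
  "e_char z = exp (2 * of_real pi * \<i> * z)"

text \<open>\<open>q\<^sup>s\<close> for the nome \<open>q = exp (pi i \<tau>)\<close>, with the branch fixed by \<open>\<tau>\<close>.\<close>

definition nome_pow :: "complex \<Rightarrow> complex \<Rightarrow> complex" where
  "nome_pow \<tau> s = exp (of_real pi * \<i> * \<tau> * s)"

definition theta1 :: "complex \<Rightarrow> complex \<Rightarrow> complex" where
  "theta1 v \<tau> = (\<Sum>\<^sub>\<infinity>n::int. nome_pow \<tau> ((of_int n + 1/2)\<^sup>2) * e_char ((of_int n + 1/2) * v))"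

definition theta3 :: "complex \<Rightarrow> complex \<Rightarrow> complex" where
  "theta3 v \<tau> = (\<Sum>\<^sub>\<infinity>n::int. nome_pow \<tau> ((of_int n)\<^sup>2) * e_char (of_int n * v))"

definition trig_poly :: "nat \<Rightarrow> (real \<Rightarrow> complex) \<Rightarrow> bool" where
  "trig_poly N p \<longleftrightarrow>
     (\<exists>c :: int \<Rightarrow> complex. \<forall>x. p x = (\<Sum>n = - int N..int N. c n * e_char (of_int n * of_real x)))"

definition gauss :: "real \<Rightarrow> complex \<Rightarrow> complex" where
  "gauss \<mu> z = exp (- of_real (pi * \<mu>) * z\<^sup>2)"

text \<open>The series only makes sense away from the half-integers; \<^const>\<open>remove_sings\<close> fills in
  the removable singularities there by the limit and so ignores the junk values of the
  inner expression at these points.\<close>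

definition K_interp :: "real \<Rightarrow> complex \<Rightarrow> complex" where
  "K_interp \<mu> = remove_sings (\<lambda>z. cos (of_real pi * z) / of_real pi *
     (\<Sum>\<^sub>\<infinity>n::int. (-1) powi (n + 1) * gauss \<mu> (of_int n + 1/2) / (z - of_int n - 1/2)))"

definition k_poly :: "real \<Rightarrow> nat \<Rightarrow> real \<Rightarrow> complex" where
  "k_poly l N x = of_real (sqrt l) *
     (\<Sum>\<^sub>\<infinity>n::int. K_interp (l / (2 * real N + 2)\<^sup>2) ((2 * of_nat N + 2) * (of_real x + of_int n)))"

end

theory Submission
  imports Defs "HOL-Probability.Probability"
begin

text \<open>
  The proof is by duality. Put \<open>h = N + 1\<close>. The function \<open>sgn cos (2 \<pi> h x)\<close> changes sign under
  translation by \<open>1 / (2 h)\<close>, so the frequencies in its Fourier series are the odd multiples of \<open>h\<close>,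
  and it is orthogonal to all trigonometric polynomials \<open>p\<close> of degree at most \<open>N\<close>. Integrating
  \<open>\<theta>\<^sub>3 - p\<close> against it therefore gives a number independent of \<open>p\<close>, and this number is the integral
  of \<open>\<theta>\<^sub>1\<close> in the theorem (\<open>alt_integral_theta3\<close>). The inequality is the triangle inequality.
  Equality holds if and only if \<open>\<theta>\<^sub>3 - p\<close> is real and has everywhere the sign of the cosine. Then
  \<open>p\<close> agrees with \<open>\<theta>\<^sub>3\<close> at the \<open>2 h\<close> zeros of the cosine, which determines \<open>p\<close>
  (\<open>alt_integral_extremal_zero\<close>, \<open>coefficients_zero_if_zero_at_nodes\<close>). It remains to show two things.

  First, the polynomial interpolating \<open>\<theta>\<^sub>3\<close> at these zeros does have an error of the right sign. In
  \<open>theta3_minus_interp_poly\<close> the error is \<open>2 cos (2 \<pi> h x)\<close> times an explicit Fourier series. That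
  series is the convolution of \<open>\<theta>\<^sub>3\<close>, which is positive by Poisson summation, with
  \<open>\<Sum>\<^sub>s (- 1) ^ s \<alpha>\<^sub>s P\<^sub>s\<close>, where \<open>P\<^sub>s\<close> is the Poisson kernel at height \<open>(2 s + 1) h / l\<close> and
  \<open>\<alpha>\<^sub>s\<close> is the coefficient of index \<open>s\<close> of \<open>\<theta>\<^sub>1(u, 4 \<i> h\<^sup>2 / l)\<close>. A Poisson kernel is a periodised Cauchy
  kernel, and the Cauchy kernels \<open>(2 s + 1) / (\<xi>\<^sup>2 + (2 s + 1)\<^sup>2)\<close> with alternating signs are the
  integrals of \<open>cos ((2 s + 1) \<pi> u)\<close> against a hyperbolic cosine over \<open>\<bar>u\<bar> \<le> 1/2\<close>, up to a common
  positive factor. So the alternating sum is an integral of \<open>\<theta>\<^sub>1\<close> against a positive weight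
  (\<open>alternating_cauchy_nonneg\<close>), and everything rests on \<open>\<theta>\<^sub>1(u, \<i> b) \<ge> 0\<close> for \<open>\<bar>u\<bar> \<le> 1/2\<close>
  (\<open>theta1_nonneg\<close>). For \<open>b \<ge> 1\<close> the first term of the Fourier series dominates the others, for
  \<open>b \<le> 1\<close> the first term of the series given by Poisson summation.

  Second, \<open>k_poly l N\<close> is this interpolating polynomial (\<open>k_poly_eq_interp_poly\<close>). Summing the
  interpolation series over the translates by integers turns its simple fractions into cotangents,
  hence, after multiplication by the cosine, into Dirichlet kernels centred at the nodes. Their terms
  of degree \<open>h\<close> cancel, and Poisson summation identifies the remaining coefficients.
\<close>

section \<open>Unconditional sums\<close>

lemma has_sum_int_split:
  fixes f :: "int \<Rightarrow> 'a :: {topological_comm_monoid_add}"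
  assumes "((\<lambda>n::nat. f (int n)) has_sum S) UNIV" "((\<lambda>n::nat. f (- 1 - int n)) has_sum T) UNIV"
  shows "(f has_sum (S + T)) UNIV"
proof -
  have "(f has_sum S) {0..}"
    using assms(1) has_sum_reindex_bij_witness[of "{0..}" int nat UNIV "\<lambda>n. f (int n)" f S S] by auto
  moreover have "(f has_sum T) {..<0}"
    using assms(2) has_sum_reindex_bij_witness[of "{..<0}" "\<lambda>n. - 1 - int n" "\<lambda>m. nat (- 1 - m)"
        UNIV "\<lambda>n. f (- 1 - int n)" f T T] by auto
  ultimately have "(f has_sum (S + T)) ({0..} \<union> {..<0})"
    by (intro has_sum_Un_disjoint) auto
  moreover have "{0..} \<union> {..<0} = (UNIV :: int set)" by auto
  ultimately show ?thesis by simp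
qed

lemma summable_on_int_split:
  fixes f :: "int \<Rightarrow> 'a :: {topological_comm_monoid_add}"
  assumes "(\<lambda>n::nat. f (int n)) summable_on UNIV" "(\<lambda>n::nat. f (- 1 - int n)) summable_on UNIV"
  shows "f summable_on UNIV"
  using assms has_sum_int_split unfolding summable_on_def by blast

text \<open>An unconditional sum over the integers may be taken over the pairs \<open>k\<close>, \<open>- 1 - k\<close>. This
  pairing is the reflection \<open>x \<mapsto> - x\<close> of the half-integers \<open>k + 1/2\<close>, so it exploits every
  evenness or oddness below.\<close>

lemma has_sum_int_fold:
  fixes f :: "int \<Rightarrow> 'a :: banach"
  assumes "f summable_on UNIV"
  shows "((\<lambda>k::nat. f (int k) + f (- 1 - int k)) has_sum infsum f UNIV) UNIV"
proof -
  have inj: "inj int" "inj (\<lambda>n::nat. - 1 - int n)" by (auto intro: injI)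
  have "(\<lambda>n::nat. f (int n)) summable_on UNIV"
    using summable_on_subset_banach[OF assms(1), of "range int"]
    by (simp add: summable_on_reindex[OF inj(1)] o_def)
  then obtain A where A: "((\<lambda>n::nat. f (int n)) has_sum A) UNIV" by (auto simp: summable_on_def)
  have "(\<lambda>n::nat. f (- 1 - int n)) summable_on UNIV"
    using summable_on_subset_banach[OF assms(1), of "range (\<lambda>n::nat. - 1 - int n)"]
    by (simp add: summable_on_reindex[OF inj(2)] o_def)
  then obtain B where B: "((\<lambda>n::nat. f (- 1 - int n)) has_sum B) UNIV" by (auto simp: summable_on_def)
  show ?thesis
    using has_sum_add[OF A B] infsumI[OF has_sum_int_split[OF A B]] by simp
qed

text \<open>Identifies an unconditional sum from a sum over pairs that converges only conditionally
  before absolute convergence is known, such as the partial fractions of the cotangent.\<close>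

lemma has_sum_int_pair:
  fixes f :: "int \<Rightarrow> 'a :: banach"
  assumes "f summable_on UNIV" "(\<lambda>k::nat. f (int k) + f (- 1 - int k)) sums S"
  shows "(f has_sum S) UNIV"
  using has_sum_imp_sums[OF has_sum_int_fold[OF assms(1)]] assms sums_unique2 has_sum_infsum by blast

lemma has_sum_int_shift:
  fixes f :: "int \<Rightarrow> 'a :: {topological_comm_monoid_add}"
  shows "((\<lambda>n. f (n + k)) has_sum S) UNIV \<longleftrightarrow> (f has_sum S) UNIV"
  by (rule has_sum_reindex_bij_witness[where j = "\<lambda>n. n + k" and i = "\<lambda>n. n - k"]) auto

lemma has_sum_int_reflect:
  fixes f :: "int \<Rightarrow> 'a :: {topological_comm_monoid_add}"
  shows "((\<lambda>n. f (k - n)) has_sum S) UNIV \<longleftrightarrow> (f has_sum S) UNIV"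
  by (rule has_sum_reindex_bij_witness[where j = "\<lambda>n. k - n" and i = "\<lambda>n. k - n"]) auto

lemma summable_on_dominated:
  fixes f :: "'i \<Rightarrow> 'a :: banach"
  assumes "g summable_on A" "\<And>n. n \<in> A \<Longrightarrow> norm (f n) \<le> g n"
  shows "f summable_on A"
proof -
  have "(\<lambda>n. norm (g n)) summable_on A"
    using assms(1) summable_on_iff_abs_summable_on_real by blast
  then have "(\<lambda>n. norm (f n)) summable_on A"
    by (rule Infinite_Sum.abs_summable_on_comparison_test) (use assms(2) in force)
  then show ?thesis by (rule abs_summable_summable)
qed

lemma summable_on_int_inverse_square:
  "(\<lambda>n::int. 1 / (1 + \<bar>real_of_int n\<bar>)\<^sup>2) summable_on UNIV"
proof (rule summable_on_int_split)
  have *: "(\<lambda>n::nat. 1 / (1 + real n)\<^sup>2) summable_on UNIV"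
  proof (rule summable_nonneg_imp_summable_on)
    have "summable (\<lambda>n. inverse (real (Suc n) ^ 2))"
      using inverse_power_summable[of 2, where 'a = real] by (subst summable_Suc_iff) auto
    then show "summable (\<lambda>n. 1 / (1 + real n)\<^sup>2)" by (simp add: inverse_eq_divide)
  qed simp
  then show "(\<lambda>n::nat. 1 / (1 + \<bar>real_of_int (int n)\<bar>)\<^sup>2) summable_on UNIV" by simp
  have "(\<lambda>n::nat. 1 / (1 + \<bar>real_of_int (- 1 - int n)\<bar>)\<^sup>2) summable_on UNIV"
  proof (rule summable_on_dominated[OF *])
    fix n :: nat
    show "norm (1 / (1 + \<bar>real_of_int (- 1 - int n)\<bar>)\<^sup>2) \<le> 1 / (1 + real n)\<^sup>2"
      by (auto intro!: divide_left_mono power_mono)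
  qed
  then show "(\<lambda>n::nat. 1 / (1 + \<bar>real_of_int (- 1 - int n)\<bar>)\<^sup>2) summable_on UNIV" .
qed

lemma summable_on_int_gauss:
  assumes "c > 0"
  shows "(\<lambda>n::int. (1 + \<bar>real_of_int n\<bar>) ^ k * exp (- c * (real_of_int n)\<^sup>2)) summable_on UNIV"
proof -
  have "((\<lambda>x::real. (1 + x) ^ (k + 2) * exp (- c * x\<^sup>2)) \<longlongrightarrow> 0) at_top"
    using assms by real_asymp
  then have "eventually (\<lambda>x::real. (1 + x) ^ (k + 2) * exp (- c * x\<^sup>2) < 1) at_top"
    by (rule order_tendstoD) simp
  then obtain R where R: "\<And>x. x \<ge> R \<Longrightarrow> (1 + x) ^ (k + 2) * exp (- c * x\<^sup>2) < 1"
    by (auto simp: eventually_at_top_linorder)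
  define C where "C = max 1 ((1 + \<bar>R\<bar>) ^ (k + 2))"
  have bound: "(1 + x) ^ (k + 2) * exp (- c * x\<^sup>2) \<le> C" if "x \<ge> 0" for x
  proof (cases "x \<ge> R")
    case True then show ?thesis using R[of x] by (simp add: C_def)
  next
    case False
    then have "(1 + x) ^ (k + 2) * exp (- c * x\<^sup>2) \<le> (1 + \<bar>R\<bar>) ^ (k + 2) * 1"
      using that assms by (intro mult_mono power_mono) auto
    then show ?thesis unfolding C_def by linarith
  qed
  show ?thesis
  proof (rule summable_on_dominated[OF summable_on_cmult_right[OF summable_on_int_inverse_square, of C]])
    fix n :: int
    have "(1 + \<bar>real_of_int n\<bar>)\<^sup>2 * ((1 + \<bar>real_of_int n\<bar>) ^ k * exp (- c * (real_of_int n)\<^sup>2)) \<le> C"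
      using bound[of "\<bar>real_of_int n\<bar>"] by (simp add: power_add power2_eq_square mult_ac)
    then show "norm ((1 + \<bar>real_of_int n\<bar>) ^ k * exp (- c * (real_of_int n)\<^sup>2))
        \<le> C * (1 / (1 + \<bar>real_of_int n\<bar>)\<^sup>2)"
      by (simp add: pos_le_divide_eq mult_ac abs_mult power2_eq_square)
  qed
qed

lemma summable_on_int_exp_abs:
  assumes "c > 0"
  shows "(\<lambda>j::int. exp (- c * \<bar>real_of_int j\<bar>)) summable_on UNIV"
proof (rule summable_on_int_split)
  have *: "(\<lambda>n::nat. exp (- c) ^ n) summable_on UNIV"
    using assms by (intro summable_nonneg_imp_summable_on summable_geometric) auto
  have eq: "exp (- c * real n) = exp (- c) ^ n" for n by (simp flip: exp_of_nat_mult add: mult.commute)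
  show "(\<lambda>n::nat. exp (- c * \<bar>real_of_int (int n)\<bar>)) summable_on UNIV" using * by (simp add: eq[simplified])
  show "(\<lambda>n::nat. exp (- c * \<bar>real_of_int (- 1 - int n)\<bar>)) summable_on UNIV"
  proof (rule summable_on_dominated[OF *])
    fix n :: nat
    have "exp (- c * \<bar>real_of_int (- 1 - int n)\<bar>) \<le> exp (- c * real n)"
      using assms by (simp add: mult_left_mono)
    then show "norm (exp (- c * \<bar>real_of_int (- 1 - int n)\<bar>)) \<le> exp (- c) ^ n"
      unfolding eq[symmetric] by (simp only: real_norm_def abs_exp_cancel)
  qed
qed

lemma summable_on_nat_gauss:
  assumes "c > 0"
  shows "(\<lambda>n::nat. (1 + real n) ^ k * exp (- c * (real n)\<^sup>2)) summable_on UNIV"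
proof -
  have "inj int" by simp
  from summable_on_reindex[OF this, of "\<lambda>n. (1 + \<bar>real_of_int n\<bar>) ^ k * exp (- c * (real_of_int n)\<^sup>2)"]
    summable_on_subset_banach[OF summable_on_int_gauss[OF assms], of "range int"]
  show ?thesis by (simp add: o_def)
qed

text \<open>From \<open>(x + n)\<^sup>2 \<ge> n\<^sup>2/2 - x\<^sup>2\<close>: one summable majorant serves all \<open>x\<close> in a bounded set.\<close>

lemma gauss_shift_bound:
  fixes c x n :: real
  assumes "c > 0" "\<bar>x\<bar> \<le> R"
  shows "exp (- c * (x + n)\<^sup>2) \<le> exp (c * R\<^sup>2) * exp (- (c / 2) * n\<^sup>2)"
proof -
  have "0 \<le> (n + 2 * x)\<^sup>2" by simp
  then have "n\<^sup>2 / 2 - x\<^sup>2 \<le> (x + n)\<^sup>2" by (simp add: power2_eq_square algebra_simps)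
  moreover have "x\<^sup>2 \<le> R\<^sup>2" using assms by (metis abs_ge_zero power2_abs power_mono)
  ultimately have "n\<^sup>2 / 2 - R\<^sup>2 \<le> (x + n)\<^sup>2" by linarith
  from mult_left_mono[OF this, of c] assms show ?thesis
    by (simp add: exp_add[symmetric] algebra_simps)
qed

lemma summable_on_int_gauss_shift:
  assumes "c > 0"
  shows "(\<lambda>n::int. exp (- c * (x + real_of_int n)\<^sup>2)) summable_on UNIV"
proof (rule summable_on_dominated)
  show "(\<lambda>n::int. exp (c * \<bar>x\<bar>\<^sup>2) * exp (- (c / 2) * (real_of_int n)\<^sup>2)) summable_on UNIV"
    using summable_on_cmult_right[OF summable_on_int_gauss[of "c / 2" 0], of "exp (c * \<bar>x\<bar>\<^sup>2)"] assms
    by simp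
qed (use gauss_shift_bound[OF assms, of x "\<bar>x\<bar>"] in auto)

lemma has_sum_nat_Suc:
  fixes f :: "nat \<Rightarrow> 'a :: banach"
  assumes "((\<lambda>n. f (Suc n)) has_sum S) UNIV"
  shows "(f has_sum (f 0 + S)) UNIV"
proof -
  have "(f has_sum S) (range Suc)"
    using assms by (subst has_sum_reindex) (auto simp: o_def)
  then have "(f has_sum (f 0 + S)) (insert 0 (range Suc))" by (intro has_sum_insert) auto
  moreover have "insert 0 (range Suc) = (UNIV :: nat set)" using not0_implies_Suc by blast
  ultimately show ?thesis by simp
qed

lemma infsum_of_real:
  fixes f :: "'i \<Rightarrow> real"
  shows "(\<Sum>\<^sub>\<infinity>i. complex_of_real (f i)) = of_real (\<Sum>\<^sub>\<infinity>i. f i)"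
proof (cases "f summable_on UNIV")
  case True
  show ?thesis by (rule infsumI[OF has_sum_of_real[OF has_sum_infsum[OF True]]])
next
  case False
  then have "\<not> (\<lambda>i. complex_of_real (f i)) summable_on UNIV"
    using summable_on_Re[of "\<lambda>i. complex_of_real (f i)"] by auto
  with False show ?thesis by (simp add: infsum_not_exists)
qed

lemma has_sum_diff:
  fixes f g :: "'i \<Rightarrow> 'a :: banach"
  assumes "(f has_sum S) A" "(g has_sum T) A"
  shows "((\<lambda>i. f i - g i) has_sum (S - T)) A"
proof -
  have "((\<lambda>i. - g i) has_sum (- T)) A" using assms(2) by (simp add: has_sum_uminus)
  from has_sum_add[OF assms(1) this] show ?thesis by simp
qed

lemma has_sum_sum:
  fixes f :: "'j \<Rightarrow> 'i \<Rightarrow> 'a :: topological_comm_monoid_add"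
  assumes "finite J" "\<And>j. j \<in> J \<Longrightarrow> (f j has_sum S j) A"
  shows "((\<lambda>i. \<Sum>j\<in>J. f j i) has_sum (\<Sum>j\<in>J. S j)) A"
  using assms by (induction J rule: finite_induct) (auto intro!: has_sum_add)

lemma summable_on_prod_bound:
  fixes f :: "'i \<Rightarrow> 'j \<Rightarrow> 'a :: banach"
  assumes "A summable_on UNIV" "B summable_on UNIV" "\<And>i j. norm (f i j) \<le> A i * B j"
    "\<And>i. 0 \<le> A i" "\<And>j. (0::real) \<le> B j"
  shows "(\<lambda>(i, j). f i j) summable_on UNIV \<times> UNIV"
proof (rule summable_on_dominated)
  have nn: "\<bar>A i * B j\<bar> = A i * B j" for i j using assms(4,5) by simp
  have "0 \<le> infsum B UNIV" using assms(5) by (intro infsum_nonneg) auto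
  then have eq: "norm (\<Sum>\<^sub>\<infinity>j. norm (A i * B j)) = A i * infsum B UNIV" for i
    using assms(4)[of i] by (simp only: real_norm_def nn infsum_cmult_right' abs_of_nonneg mult_nonneg_nonneg)
  have "(\<lambda>p. norm (case p of (i, j) \<Rightarrow> A i * B j)) summable_on UNIV \<times> UNIV"
  proof (subst Infinite_Sum.abs_summable_on_Sigma_iff, intro conjI ballI)
    fix i
    show "(\<lambda>j. norm (case (i, j) of (i, j) \<Rightarrow> A i * B j)) summable_on UNIV"
      unfolding prod.case real_norm_def nn by (rule summable_on_cmult_right[OF assms(2)])
    show "(\<lambda>i. norm (\<Sum>\<^sub>\<infinity>j. norm (case (i, j) of (i, j) \<Rightarrow> A i * B j))) summable_on UNIV"
      unfolding prod.case eq by (rule summable_on_cmult_left[OF assms(1)])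
  qed
  then show "(\<lambda>p. A (fst p) * B (snd p)) summable_on UNIV \<times> UNIV"
    by (simp add: case_prod_unfold nn)
  show "norm (case p of (i, j) \<Rightarrow> f i j) \<le> A (fst p) * B (snd p)" for p
    using assms(3) by (simp add: case_prod_unfold)
qed

lemma infsum_swap_bound:
  fixes f :: "'i \<Rightarrow> 'j \<Rightarrow> 'a :: banach"
  assumes "A summable_on UNIV" "B summable_on UNIV" "\<And>i j. norm (f i j) \<le> A i * B j"
    "\<And>i. 0 \<le> A i" "\<And>j. (0::real) \<le> B j"
  shows "(\<Sum>\<^sub>\<infinity>i. \<Sum>\<^sub>\<infinity>j. f i j) = (\<Sum>\<^sub>\<infinity>j. \<Sum>\<^sub>\<infinity>i. f i j)"
  by (rule infsum_swap_banach[OF summable_on_prod_bound[OF assms]])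

section \<open>Uniformly convergent series of functions\<close>

lemma continuous_on_infsum:
  fixes f :: "'i \<Rightarrow> 'b :: topological_space \<Rightarrow> 'c :: banach"
  assumes "\<And>n. n \<in> A \<Longrightarrow> continuous_on X (f n)" "\<And>n x. n \<in> A \<Longrightarrow> x \<in> X \<Longrightarrow> norm (f n x) \<le> B n"
    "B summable_on A"
  shows "continuous_on X (\<lambda>x. \<Sum>\<^sub>\<infinity>n\<in>A. f n x)"
proof (rule uniform_limit_theorem)
  show "uniform_limit X (\<lambda>Y x. \<Sum>n\<in>Y. f n x) (\<lambda>x. \<Sum>\<^sub>\<infinity>n\<in>A. f n x) (finite_subsets_at_top A)"
    by (rule Weierstrass_m_test_general[OF assms(2,3)])
  show "\<forall>\<^sub>F Y in finite_subsets_at_top A. continuous_on X (\<lambda>x. \<Sum>n\<in>Y. f n x)"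
    by (rule eventually_finite_subsets_at_top_weakI) (intro continuous_on_sum assms(1), auto)
qed simp

lemma has_sum_integral:
  fixes f :: "'i \<Rightarrow> real \<Rightarrow> 'c :: banach"
  assumes "\<And>n. continuous_on {a..b} (f n)" "\<And>n x. x \<in> {a..b} \<Longrightarrow> norm (f n x) \<le> B n"
    "B summable_on UNIV"
  shows "((\<lambda>n. integral {a..b} (f n)) has_sum integral {a..b} (\<lambda>x. \<Sum>\<^sub>\<infinity>n. f n x)) UNIV"
proof -
  let ?F = "finite_subsets_at_top (UNIV :: 'i set)"
  have "uniform_limit {a..b} (\<lambda>Y x. \<Sum>n\<in>Y. f n x) (\<lambda>x. \<Sum>\<^sub>\<infinity>n. f n x) ?F"
    by (rule Weierstrass_m_test_general[OF assms(2,3)]) auto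
  then obtain I J where IJ: "\<And>Y. ((\<lambda>x. \<Sum>n\<in>Y. f n x) has_integral I Y) {a..b}"
    "((\<lambda>x. \<Sum>\<^sub>\<infinity>n. f n x) has_integral J) {a..b}" "(I \<longlongrightarrow> J) ?F"
    by (rule uniform_limit_integral) (auto intro!: continuous_on_sum assms(1))
  have "I Y = (\<Sum>n\<in>Y. integral {a..b} (f n))" if "finite Y" for Y
    using integral_unique[OF IJ(1)[of Y]] integral_sum[OF that, of f "{a..b}"]
      integrable_continuous_real[OF assms(1)] by simp
  then have "\<forall>\<^sub>F Y in ?F. I Y = (\<Sum>n\<in>Y. integral {a..b} (f n))"
    by (intro eventually_finite_subsets_at_top_weakI) auto
  then have "((\<lambda>Y. \<Sum>n\<in>Y. integral {a..b} (f n)) \<longlongrightarrow> J) ?F"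
    using IJ(3) by (rule Lim_transform_eventually[rotated])
  then show ?thesis using IJ(2) by (simp add: has_sum_def integral_unique)
qed

lemma integral_nonneg_complex:
  fixes f :: "real \<Rightarrow> complex"
  assumes "continuous_on {a..b} f" "\<And>x. x \<in> {a..b} \<Longrightarrow> 0 \<le> f x"
  shows "0 \<le> integral {a..b} f"
proof -
  have int: "f integrable_on {a..b}" by (rule integrable_continuous_real[OF assms(1)])
  have "Re (integral {a..b} f) = integral {a..b} (\<lambda>x. Re (f x))"
    using integral_linear[OF int bounded_linear_Re] by (simp add: o_def)
  moreover have "0 \<le> integral {a..b} (\<lambda>x. Re (f x))"
    using assms(2) integrable_linear[OF int bounded_linear_Re]
    by (intro integral_nonneg) (auto simp: less_eq_complex_def o_def)
  moreover have "Im (integral {a..b} f) = integral {a..b} (\<lambda>x. Im (f x))"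
    using integral_linear[OF int bounded_linear_Im] by (simp add: o_def)
  moreover have "integral {a..b} (\<lambda>x. Im (f x)) = integral {a..b} (\<lambda>x. 0)"
    using assms(2) by (intro integral_cong) (auto simp: less_eq_complex_def)
  ultimately show ?thesis by (simp add: less_eq_complex_def)
qed

section \<open>Periodic functions and Fourier coefficients\<close>

definition ee :: "real \<Rightarrow> complex" where "ee x = cis (2 * pi * x)"

lemma e_char_of_real: "e_char (of_real x) = ee x"
  by (simp add: e_char_def ee_def cis_conv_exp mult_ac)

lemma norm_ee [simp]: "norm (ee x) = 1" by (simp add: ee_def)
lemma ee_0 [simp]: "ee 0 = 1" by (simp add: ee_def)
lemma ee_nonzero [simp]: "ee x \<noteq> 0" using norm_ee[of x] by force
lemma ee_add: "ee (x + y) = ee x * ee y" by (simp add: ee_def cis_mult distrib_left)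
lemma ee_minus: "ee (- x) = inverse (ee x)" by (simp add: ee_def)
lemma cnj_ee: "cnj (ee x) = ee (- x)" by (simp add: ee_def cis_cnj)
lemma ee_diff: "ee (x - y) = ee x * ee (- y)" using ee_add[of x "- y"] by simp
lemma ee_of_int [simp]: "ee (of_int n) = 1" by (simp add: ee_def)
lemma ee_half [simp]: "ee (1/2) = - 1" by (simp add: ee_def)
lemma ee_plus_minus: "ee x + ee (- x) = of_real (2 * cos (2 * pi * x))"
  by (simp add: ee_def complex_eq_iff)
lemma continuous_on_ee [continuous_intros]: "continuous_on S f \<Longrightarrow> continuous_on S (\<lambda>x. ee (f x))"
  unfolding ee_def by (intro continuous_intros)
lemma ee_power: "ee x ^ n = ee (of_nat n * x)"
  by (induction n) (auto simp: ee_add distrib_right)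
lemma ee_eq_1_iff: "ee x = 1 \<longleftrightarrow> x \<in> \<int>"
proof
  assume "ee x = 1"
  then have "cos (2 * pi * x) = 1" by (metis ee_def cis.sel(1) one_complex.sel(1))
  then obtain k :: int where "2 * pi * x = of_int k * 2 * pi" by (auto simp: cos_one_2pi_int)
  then have "x = of_int k" by simp
  then show "x \<in> \<int>" by simp
qed (auto elim!: Ints_cases)

lemma ee_mult_int_shift: "ee (of_int n * (x + 1)) = ee (of_int n * x)"
  by (simp add: distrib_left ee_add)

lemma cos_pi_nonneg: "0 \<le> cos (pi * x)" if "\<bar>x\<bar> \<le> 1/2"
proof -
  have "\<bar>pi * x\<bar> \<le> pi / 2" using mult_left_mono[OF that, of pi] by (simp add: abs_mult)
  then show ?thesis by (intro cos_ge_zero) linarith+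
qed

lemma periodic_int:
  fixes f :: "real \<Rightarrow> 'a"
  assumes "\<And>x. f (x + 1) = f x"
  shows "f (x + of_int n) = f x"
proof (induction n rule: int_induct[where k = 0])
  case (step2 i)
  then show ?case using assms[of "x + of_int (i - 1)"] by (simp add: algebra_simps)
qed (use assms in \<open>auto simp: add.assoc[symmetric]\<close>)

text \<open>Every interval of length one is a union of two pieces that translations by integers carry onto
  \<open>[0, t]\<close> and \<open>[t, 1]\<close>.\<close>

lemma integral_periodic:
  fixes f :: "real \<Rightarrow> 'a :: banach"
  assumes cont: "continuous_on UNIV f" and per: "\<And>x. f (x + 1) = f x"
  shows "integral {a..a + 1} f = integral {0..1} f"
proof -
  define n where "n = \<lfloor>a\<rfloor>"
  define t where "t = a - of_int n"
  have t: "0 \<le> t" "t < 1" unfolding t_def n_def by linarith+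
  have a: "a = t + of_int n" by (simp add: t_def)
  have c: "continuous_on S f" for S using cont continuous_on_subset by blast
  have int: "f integrable_on {x..y}" for x y by (rule integrable_continuous_real[OF c])
  have sh: "integral {x..y} f = integral {x + of_int k..y + of_int k} f" for x y k
    using integral_shift_Icc_real[of x y f "of_int k"]
    by (simp add: o_def periodic_int[of f, OF per] add.commute[of "real_of_int k"])
  have "integral {a..a + 1} f = integral {a..of_int n + 1} f + integral {of_int n + 1..a + 1} f"
    by (rule Henstock_Kurzweil_Integration.integral_combine[symmetric, OF _ _ int]) (use t a in auto)
  also have "integral {a..of_int n + 1} f = integral {t..1} f"
    using sh[of t 1 n] by (simp add: a add.commute)
  also have "integral {of_int n + 1..a + 1} f = integral {0..t} f"
    using sh[of 0 t "n + 1"] by (simp add: a add.commute add.left_commute)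
  also have "integral {t..1} f + integral {0..t} f = integral {0..1} f"
    using Henstock_Kurzweil_Integration.integral_combine[OF _ _ int, of 0 t 1] t by (simp add: add.commute)
  finally show ?thesis .
qed

lemma has_integral_ee:
  assumes "c \<noteq> 0" "a \<le> b"
  shows "((\<lambda>x. ee (c * x)) has_integral (ee (c * b) - ee (c * a)) / (2 * pi * c * \<i>)) {a..b}"
proof -
  define F where "F = (\<lambda>x. ee (c * x) / (2 * pi * c * \<i>))"
  have "(F has_vector_derivative ee (c * x)) (at x within {a..b})" for x
  proof -
    have "((\<lambda>z. exp (2 * pi * c * \<i> * z)) has_field_derivative
        2 * pi * c * \<i> * exp (2 * pi * c * \<i> * of_real x)) (at (of_real x))"
      by (rule derivative_eq_intros refl | simp)+
    from has_vector_derivative_real_field[OF this, of "{a..b}"]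
    have "((\<lambda>x. ee (c * x)) has_vector_derivative 2 * pi * c * \<i> * ee (c * x)) (at x within {a..b})"
      by (simp add: ee_def cis_conv_exp mult_ac)
    from has_vector_derivative_divide[OF this, of "2 * pi * c * \<i>"] assms(1) show ?thesis
      by (simp add: F_def)
  qed
  then have "((\<lambda>x. ee (c * x)) has_integral (F b - F a)) {a..b}"
    by (intro fundamental_theorem_of_calculus assms(2)) auto
  then show ?thesis by (simp add: F_def diff_divide_distrib)
qed

lemma integral_ee:
  "integral {0..1} (\<lambda>x. ee (of_int n * x)) = (if n = 0 then 1 else 0)"
proof (cases "n = 0")
  case False
  then have "((\<lambda>x. ee (of_int n * x)) has_integral 0) {0..1}"
    using has_integral_ee[of "of_int n" 0 1] by simp
  with False show ?thesis by (simp add: integral_unique)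
qed simp

text \<open>A function orthogonal to all characters is orthogonal to \<open>cos (\<pi> x) ^ (2 n)\<close> for all \<open>n\<close>, a
  trigonometric polynomial concentrating at \<open>0\<close> modulo one. If \<open>D 0 \<noteq> 0\<close>, then in the
  integral of \<open>D / D 0\<close> against these weights the part near \<open>0\<close> outgrows the rest geometrically.\<close>

lemma fourier_coefficients_zero_imp_zero_at_0:
  fixes D :: "real \<Rightarrow> complex"
  assumes cont: "continuous_on UNIV D" and per: "\<And>x. D (x + 1) = D x"
    and zero: "\<And>k::int. integral {0..1} (\<lambda>x. D x * ee (of_int k * x)) = 0"
  shows "D 0 = 0"
proof (rule ccontr)
  assume "D 0 \<noteq> 0"
  define f where "f = (\<lambda>x. Re (D x / D 0))"
  define w where "w = (\<lambda>x::real. (cos (pi * x))\<^sup>2)"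
  have contf: "continuous_on S f" for S
    unfolding f_def using \<open>D 0 \<noteq> 0\<close>
    by (intro continuous_intros continuous_on_subset[OF cont]) auto
  have w_cont: "continuous_on S w" for S unfolding w_def by (intro continuous_intros)
  have w_eq: "complex_of_real (w x) = 1/2 + (ee x + ee (- x)) / 4" for x
  proof -
    have "2 * w x = 1 + cos (2 * pi * x)"
      using cos_double_cos[of "pi * x"] by (simp add: w_def mult_ac)
    then have "w x = 1/2 + (2 * cos (2 * pi * x)) / 4" by simp
    then show ?thesis unfolding ee_plus_minus by (metis of_real_add of_real_divide of_real_1 of_real_numeral)
  qed
  have moment: "integral {0..1} (\<lambda>x. D x * of_real (w x) ^ n * ee (of_int k * x)) = 0" for n and k :: int
  proof (induction n arbitrary: k)
    case 0
    then show ?case using zero by simp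
  next
    case (Suc n)
    let ?g = "\<lambda>k x. D x * of_real (w x) ^ n * ee (of_int k * x)"
    have int: "?g k integrable_on {0..1}" for k
      by (intro integrable_continuous_real continuous_intros continuous_on_subset[OF cont] w_cont) auto
    have "(\<lambda>x. D x * of_real (w x) ^ Suc n * ee (of_int k * x))
        = (\<lambda>x. ?g k x * (1/2) + (?g (k + 1) x * (1/4) + ?g (k - 1) x * (1/4)))"
    proof
      fix x
      have "ee (of_int (k + 1) * x) = ee (of_int k * x) * ee x" "ee (of_int (k - 1) * x) = ee (of_int k * x) * ee (- x)"
        by (simp_all add: distrib_right ee_add left_diff_distrib ee_diff)
      then show "D x * of_real (w x) ^ Suc n * ee (of_int k * x)
        = ?g k x * (1/2) + (?g (k + 1) x * (1/4) + ?g (k - 1) x * (1/4))"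
        by (simp add: w_eq algebra_simps add_divide_distrib)
    qed
    moreover have h: "(?g k has_integral 0) {0..1}" for k
      using integrable_integral[OF int[of k]] Suc[of k] by simp
    ultimately show ?case
      using has_integral_add[OF has_integral_mult_left[OF h[of k], of "1/2"] has_integral_add[OF
            has_integral_mult_left[OF h[of "k + 1"], of "1/4"] has_integral_mult_left[OF h[of "k - 1"], of "1/4"]]]
      by (intro integral_unique) simp
  qed
  have f_moment: "integral {- 1/2..1/2} (\<lambda>x. f x * w x ^ n) = 0" for n
  proof -
    let ?G = "\<lambda>x. D x * of_real (w x) ^ n"
    have Re_of_real_mult: "Re (complex_of_real a * z) = a * Re z" for a z by simp
    have Gc: "continuous_on S ?G" for S
      by (intro continuous_intros continuous_on_subset[OF cont] w_cont) auto
    have "w (x + 1) = w x" for x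
      by (simp add: w_def distrib_left)
    then have "integral {- 1/2..- 1/2 + 1} ?G = integral {0..1} ?G"
      by (intro integral_periodic Gc) (simp add: per)
    then have G0: "integral {- 1/2..1/2} ?G = 0" using moment[of n 0] by simp
    have "integral {- 1/2..1/2} (\<lambda>x. Re (?G x * (1 / D 0))) = Re (integral {- 1/2..1/2} (\<lambda>x. ?G x * (1 / D 0)))"
      by (rule integral_linear[OF _ bounded_linear_Re, unfolded o_def])
         (intro integrable_on_mult_left integrable_continuous_real Gc)
    also have "integral {- 1/2..1/2} (\<lambda>x. ?G x * (1 / D 0)) = 0"
      using G0 by (subst integral_mult_left) simp
    also have "(\<lambda>x. Re (?G x * (1 / D 0))) = (\<lambda>x. f x * w x ^ n)"
    proof
      fix x
      have "?G x * (1 / D 0) = of_real (w x ^ n) * (D x / D 0)" by simp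
      then show "Re (?G x * (1 / D 0)) = f x * w x ^ n" 
        unfolding f_def using Re_of_real_mult[of "w x ^ n" "D x / D 0"] by (simp only: mult.commute)
    qed
    finally show ?thesis by simp
  qed
  have "f 0 = 1" using \<open>D 0 \<noteq> 0\<close> by (simp add: f_def)
  then obtain d' where d': "d' > 0" "\<And>x. \<bar>x\<bar> < d' \<Longrightarrow> \<bar>f x - 1\<bar> < 1/2"
    using contf[of UNIV] unfolding continuous_on_iff dist_real_def by (metis UNIV_I diff_zero half_gt_zero_iff zero_less_one)
  define d where "d = min (d' / 2) (1/4)"
  have d: "0 < d" "d \<le> 1/4" "d < d'" using d' by (auto simp: d_def)
  have f_half: "f x \<ge> 1/2" if "\<bar>x\<bar> \<le> d" for x using d'(2)[of x] that d by linarith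
  obtain B where B: "B > 0" "\<And>x. x \<in> {- 1/2..1/2} \<Longrightarrow> \<bar>f x\<bar> \<le> B"
  proof -
    have "bounded (f ` {- 1/2..1/2})"
      by (intro compact_imp_bounded compact_continuous_image contf) auto
    then obtain B where "\<forall>x\<in>{- 1/2..1/2}. norm (f x) \<le> B" by (auto simp: bounded_iff)
    then show ?thesis by (intro that[of "max B 1"]) (auto simp: le_max_iff_disj)
  qed
  (* Beyond d the kernel is at most \<rho> ^ n, within d / 2 at least \<sigma> ^ n, and \<rho> < \<sigma>. *)
  define \<rho> where "\<rho> = w d"
  define \<sigma> where "\<sigma> = w (d / 2)"
  have cos_mono: "cos (pi * y) \<le> cos (pi * x)" if "0 \<le> x" "x \<le> y" "y \<le> 1/2" for x y
    using that by (intro cos_monotone_0_pi_le) auto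
  note cos_pos = cos_pi_nonneg
  have w_mono: "w y \<le> w x" if "\<bar>x\<bar> \<le> \<bar>y\<bar>" "\<bar>y\<bar> \<le> 1/2" for x y
  proof -
    have w_abs: "w z = (cos (pi * \<bar>z\<bar>))\<^sup>2" for z by (simp add: w_def abs_if)
    show ?thesis unfolding w_abs[of x] w_abs[of y]
      using that by (intro power_mono cos_mono cos_pos) auto
  qed
  have "cos (pi * d) < cos (pi * (d / 2))" using d by (intro cos_monotone_0_pi) auto
  moreover have "0 < cos (pi * d)" using d mult_left_mono[of d "1/4" pi] pi_gt_zero
    by (intro cos_gt_zero mult_pos_pos) linarith+
  ultimately have \<rho>\<sigma>: "0 < \<rho>" "\<rho> < \<sigma>"
    unfolding \<rho>_def \<sigma>_def w_def by (auto intro: power_strict_mono)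
  have w0: "0 \<le> w x" for x by (simp add: w_def)
  have key: "\<sigma> ^ n * (d / 2) \<le> B * \<rho> ^ n" for n
  proof -
    let ?F = "\<lambda>x. f x * w x ^ n"
    have Fc: "continuous_on S ?F" for S by (intro continuous_intros contf w_cont)
    have int: "?F integrable_on {x..y}" for x y by (rule integrable_continuous_real[OF Fc])
    have outer: "?F x \<ge> - B * \<rho> ^ n" if "\<bar>x\<bar> \<le> 1/2" for x
    proof (cases "\<bar>x\<bar> \<le> d")
      case True
      then have "0 \<le> ?F x" using f_half[of x] w0[of x] by simp
      moreover have "0 \<le> B * \<rho> ^ n" using B \<rho>\<sigma> by simp
      ultimately show ?thesis by linarith
    next
      case False
      then have "w x \<le> \<rho>" unfolding \<rho>_def using that d by (intro w_mono) auto
      then have "w x ^ n \<le> \<rho> ^ n" using w0 by (intro power_mono) auto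
      moreover have "\<bar>f x\<bar> \<le> B" using that by (intro B(2)) (auto simp: abs_le_iff)
      ultimately have "\<bar>f x\<bar> * w x ^ n \<le> B * \<rho> ^ n" using B(1) w0 by (intro mult_mono) auto
      moreover have "\<bar>?F x\<bar> = \<bar>f x\<bar> * w x ^ n" using w0 by (simp add: abs_mult)
      ultimately show ?thesis by linarith
    qed
    have inner: "?F x \<ge> \<sigma> ^ n / 2" if "\<bar>x\<bar> \<le> d / 2" for x
    proof -
      have "\<sigma> \<le> w x" unfolding \<sigma>_def using that d by (intro w_mono) auto
      then have "\<sigma> ^ n \<le> w x ^ n" using \<rho>\<sigma> by (intro power_mono) auto
      then have "(1/2) * \<sigma> ^ n \<le> f x * w x ^ n"
        using f_half[of x] that d \<rho>\<sigma> by (intro mult_mono) auto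
      then show ?thesis by simp
    qed
    have lb: "c * (y - x) \<le> integral {x..y} ?F" if "x \<le> y" "\<And>t. t \<in> {x..y} \<Longrightarrow> c \<le> ?F t" for c x y
      using integral_le[OF integrable_const_ivl int that(2), of x y] that(1) by (simp add: mult.commute)
    have "0 = integral {- 1/2..1/2} ?F" using f_moment[of n] by simp
    also have "\<dots> = integral {- 1/2..- d/2} ?F + (integral {- d/2..d/2} ?F + integral {d/2..1/2} ?F)"
      using Henstock_Kurzweil_Integration.integral_combine[OF _ _ int, of "- 1/2" "- d/2" "1/2"]
        Henstock_Kurzweil_Integration.integral_combine[OF _ _ int, of "- d/2" "d/2" "1/2"] d by simp
    finally have "integral {- 1/2..- d/2} ?F + (integral {- d/2..d/2} ?F + integral {d/2..1/2} ?F) = 0" by simp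
    moreover have "- B * \<rho> ^ n * (- d/2 - (- 1/2)) \<le> integral {- 1/2..- d/2} ?F"
      using d by (intro lb outer) auto
    moreover have "\<sigma> ^ n / 2 * (d/2 - (- d/2)) \<le> integral {- d/2..d/2} ?F"
      using d by (intro lb inner) auto
    moreover have "- B * \<rho> ^ n * (1/2 - d/2) \<le> integral {d/2..1/2} ?F"
      using d by (intro lb outer) auto
    ultimately have "\<sigma> ^ n * (d / 2) \<le> B * \<rho> ^ n * (1 - d)" by (simp add: field_simps)
    also have "\<dots> \<le> B * \<rho> ^ n * 1" using B \<rho>\<sigma> d by (intro mult_left_mono) auto
    finally show ?thesis by simp
  qed
  have "1 < \<sigma> / \<rho>" using \<rho>\<sigma> by simp
  then obtain n where n: "2 * B / d < (\<sigma> / \<rho>) ^ n" using real_arch_pow by blast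
  have "2 * B / d * \<rho> ^ n < \<sigma> ^ n" using n \<rho>\<sigma> by (simp add: power_divide pos_less_divide_eq)
  with key[of n] d \<rho>\<sigma> show False by (simp add: field_simps)
qed

text \<open>Apply the previous lemma to all translates of the difference.\<close>

lemma fourier_coefficients_determine:
  fixes f g :: "real \<Rightarrow> complex"
  assumes "continuous_on UNIV f" "continuous_on UNIV g" "\<And>x. f (x + 1) = f x" "\<And>x. g (x + 1) = g x"
    and eq: "\<And>k::int. integral {0..1} (\<lambda>x. f x * ee (of_int k * x)) = integral {0..1} (\<lambda>x. g x * ee (of_int k * x))"
  shows "f = g"
proof
  fix a
  define D where "D = (\<lambda>x. f x - g x)"
  have Dc: "continuous_on S D" for S unfolding D_def
    by (intro continuous_intros continuous_on_subset[OF assms(1)] continuous_on_subset[OF assms(2)]) auto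
  have Dper: "D (x + 1) = D x" for x by (simp add: D_def assms)
  have D0: "integral {0..1} (\<lambda>x. D x * ee (of_int k * x)) = 0" for k :: int
  proof -
    have "(\<lambda>x. D x * ee (of_int k * x)) = (\<lambda>x. f x * ee (of_int k * x) - g x * ee (of_int k * x))"
      by (simp add: D_def left_diff_distrib)
    moreover have "(\<lambda>x. f x * ee (of_int k * x)) integrable_on {0..1}" "(\<lambda>x. g x * ee (of_int k * x)) integrable_on {0..1}"
      by (intro integrable_continuous_real continuous_intros continuous_on_subset[OF assms(1)]
          continuous_on_subset[OF assms(2)]; simp)+
    ultimately show ?thesis by (simp add: integral_diff eq)
  qed
  have "(\<lambda>x. D (a + x)) 0 = 0"
  proof (rule fourier_coefficients_zero_imp_zero_at_0)
    show "continuous_on UNIV (\<lambda>x. D (a + x))"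
      by (intro continuous_on_compose2[OF Dc[of UNIV]] continuous_intros) auto
    show "D (a + (x + 1)) = D (a + x)" for x using Dper[of "a + x"] by (simp add: add.assoc)
    fix k :: int
    let ?h = "\<lambda>x. D x * ee (of_int k * x)"
    have hc: "continuous_on UNIV ?h" by (intro continuous_intros Dc)
    have "(\<lambda>x. D (a + x) * ee (of_int k * x)) = (\<lambda>x. (?h \<circ> (+) a) x * ee (- (of_int k * a)))"
      by (simp add: fun_eq_iff distrib_left ee_add ee_minus)
    then have "integral {0..1} (\<lambda>x. D (a + x) * ee (of_int k * x)) = integral {0..1} (?h \<circ> (+) a) * ee (- (of_int k * a))"
      by (simp add: integral_mult_left o_def)
    also have "integral {0..1} (?h \<circ> (+) a) = integral {a..a + 1} ?h"
      using integral_shift_Icc_real[of 0 1 ?h a] by (simp add: add.commute)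
    also have "\<dots> = integral {0..1} ?h"
      by (rule integral_periodic[OF hc]) (simp only: Dper ee_mult_int_shift)
    finally show "integral {0..1} (\<lambda>x. D (a + x) * ee (of_int k * x)) = 0" by (simp add: D0)
  qed
  then show "f a = g a" by (simp add: D_def)
qed

section \<open>Poisson summation for the Gaussian\<close>

text \<open>A rescaling of the characteristic function of the standard normal distribution.\<close>

lemma gaussian_fourier_transform:
  assumes "a > 0"
  shows "has_bochner_integral lborel (\<lambda>t. of_real (exp (- pi * a * t\<^sup>2)) * ee (- t * w))
           (of_real (exp (- pi * w\<^sup>2 / a) / sqrt a))"
proof -
  define c where "c = sqrt (2 * pi * a)"
  have c: "c > 0" "c\<^sup>2 = 2 * pi * a" using assms by (auto simp: c_def)
  define s where "s = - (2 * pi * w) / c"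
  let ?g = "\<lambda>x. std_normal_density x *\<^sub>R iexp (s * x)"
  have meas: "(\<lambda>x. iexp (s * x)) \<in> borel_measurable lborel" by measurable
  have "integrable std_normal_distribution (\<lambda>x. iexp (s * x))"
    by (rule finite_measure.integrable_const_bound[where B = 1])
       (auto simp: prob_space_normal_density prob_space.finite_measure)
  then have int: "integrable lborel ?g"
    by (subst (asm) integrable_density) auto
  have "(\<integral>x. ?g x \<partial>lborel) = char std_normal_distribution s"
    unfolding char_def by (subst integral_density) auto
  also have "\<dots> = of_real (exp (- s\<^sup>2 / 2))" by (simp add: char_std_normal_distribution)
  finally have "has_bochner_integral lborel ?g (of_real (exp (- s\<^sup>2 / 2)))"
    using int by (simp add: has_bochner_integral_iff)
  then have "has_bochner_integral lborel (\<lambda>t. ?g (0 + c * t)) (of_real (exp (- s\<^sup>2 / 2)) /\<^sub>R \<bar>c\<bar>)"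
    using c by (subst (asm) lborel_has_bochner_integral_real_affine_iff[where c = c and t = 0]) auto
  then have "has_bochner_integral lborel (\<lambda>t. sqrt (2 * pi) *\<^sub>R ?g (0 + c * t))
      (sqrt (2 * pi) *\<^sub>R (of_real (exp (- s\<^sup>2 / 2)) /\<^sub>R \<bar>c\<bar>))"
    by (rule has_bochner_integral_scaleR_right)
  moreover have "sqrt (2 * pi) *\<^sub>R ?g (0 + c * t) = of_real (exp (- pi * a * t\<^sup>2)) * ee (- t * w)" for t
  proof -
    have "(c * t)\<^sup>2 / 2 = pi * a * t\<^sup>2" using c by (simp add: power_mult_distrib)
    moreover have "s * (c * t) = 2 * pi * (- t * w)" using c by (simp add: s_def)
    ultimately show ?thesis
      by (simp add: std_normal_density_def ee_def cis_conv_exp scaleR_conv_of_real mult_ac)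
  qed
  moreover have "sqrt (2 * pi) *\<^sub>R (complex_of_real (exp (- s\<^sup>2 / 2)) /\<^sub>R \<bar>c\<bar>) = of_real (exp (- pi * w\<^sup>2 / a) / sqrt a)"
  proof -
    have "s\<^sup>2 / 2 = pi * w\<^sup>2 / a" using assms
      by (simp add: s_def power_divide c power_mult_distrib) (simp add: field_simps power2_eq_square)
    moreover have "sqrt (2 * pi) / \<bar>c\<bar> = 1 / sqrt a" using assms by (simp add: c_def real_sqrt_mult)
    moreover have "sqrt (2 * pi) *\<^sub>R (complex_of_real (exp (- s\<^sup>2 / 2)) /\<^sub>R \<bar>c\<bar>)
        = of_real (exp (- (s\<^sup>2 / 2)) * (sqrt (2 * pi) / \<bar>c\<bar>))"
      by (simp add: scaleR_conv_of_real field_simps)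
    ultimately show ?thesis by simp
  qed
  ultimately show ?thesis by simp
qed

text \<open>Both sides are continuous and periodic in \<open>x\<close>, and their Fourier coefficients agree because the
  periods of the left-hand side tile the line and leave a Gaussian integral. The twist \<open>y\<close> unites
  three uses: \<open>y = 0\<close> transforms \<open>\<theta>\<^sub>3\<close>, \<open>y = 1/2\<close> transforms \<open>\<theta>\<^sub>1\<close>, and \<open>y = 1/2\<close> at the points
  \<open>x = j / (2 h)\<close> evaluates the coefficients of the interpolating polynomial.\<close>

lemma poisson_gauss:
  assumes a: "a > 0"
  shows "(\<Sum>\<^sub>\<infinity>r::int. of_real (exp (- pi * a * (x + of_int r)\<^sup>2)) * ee (- (x + of_int r) * y))
       = (\<Sum>\<^sub>\<infinity>m::int. of_real (exp (- pi * (of_int m + y)\<^sup>2 / a) / sqrt a) * ee (of_int m * x))"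
proof -
  define f where "f = (\<lambda>t. complex_of_real (exp (- pi * a * t\<^sup>2)) * ee (- t * y))"
  define c where "c = (\<lambda>m::int. complex_of_real (exp (- pi * (of_int m + y)\<^sup>2 / a) / sqrt a))"
  define \<phi> where "\<phi> = (\<lambda>x. \<Sum>\<^sub>\<infinity>r::int. f (x + of_int r))"
  define \<psi> where "\<psi> = (\<lambda>x. \<Sum>\<^sub>\<infinity>m::int. c m * ee (of_int m * x))"
  have pa: "pi * a > 0" using a by simp
  have f_cont: "continuous_on S (\<lambda>x. f (x + r))" for S r unfolding f_def by (intro continuous_intros)
  define B where "B = (\<lambda>R r::int. exp (pi * a * R\<^sup>2) * exp (- (pi * a / 2) * (of_int r)\<^sup>2))"
  have B_sum: "B R summable_on UNIV" for R
    unfolding B_def using summable_on_int_gauss[of "pi * a / 2" 0] pa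
    by (intro summable_on_cmult_right) auto
  have fB: "norm (f (x + of_int r)) \<le> B R r" if "\<bar>x\<bar> \<le> R" for x r R
    using gauss_shift_bound[OF pa that, of "of_int r"] by (simp add: f_def B_def norm_mult)
  have c_sum: "(\<lambda>m. norm (c m)) summable_on UNIV"
  proof -
    have "(\<lambda>m::int. exp (- (pi / a) * (y + of_int m)\<^sup>2) * (1 / sqrt a)) summable_on UNIV"
      using a by (intro summable_on_cmult_left summable_on_int_gauss_shift) auto
    moreover have "norm (c m) = exp (- (pi / a) * (y + of_int m)\<^sup>2) * (1 / sqrt a)" for m
      using a by (simp add: c_def norm_divide add.commute)
    ultimately show ?thesis by simp
  qed
  have \<psi>_cont: "continuous_on UNIV \<psi>"
    unfolding \<psi>_def by (rule continuous_on_infsum[OF _ _ c_sum]) (auto intro!: continuous_intros simp: norm_mult)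
  have \<phi>_cont: "continuous_on UNIV \<phi>"
  proof (rule continuous_at_imp_continuous_on, safe)
    fix x0
    have "continuous_on (ball 0 (\<bar>x0\<bar> + 1)) \<phi>"
      unfolding \<phi>_def by (rule continuous_on_infsum[OF f_cont _ B_sum[of "\<bar>x0\<bar> + 1"]]) (rule fB, auto simp: dist_norm)
    then show "isCont \<phi> x0" by (rule continuous_on_interior) auto
  qed
  have \<phi>_per: "\<phi> (x + 1) = \<phi> x" for x
  proof -
    have "(\<Sum>\<^sub>\<infinity>r::int. f (x + of_int r)) = (\<Sum>\<^sub>\<infinity>r::int. f (x + of_int (r + 1)))"
      by (rule infsum_reindex_bij_witness[where j = "\<lambda>n. n - 1" and i = "\<lambda>n. n + 1"]) auto
    then show ?thesis by (simp add: \<phi>_def add.assoc add.commute[of 1])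
  qed
  have \<psi>_per: "\<psi> (x + 1) = \<psi> x" for x unfolding \<psi>_def ee_mult_int_shift ..
  have "\<phi> = \<psi>"
  proof (rule fourier_coefficients_determine[OF \<phi>_cont \<psi>_cont \<phi>_per \<psi>_per])
    fix k :: int
    have "((\<lambda>m. integral {0..1} (\<lambda>x. c m * ee (of_int (m + k) * x))) has_sum
        integral {0..1} (\<lambda>x. \<Sum>\<^sub>\<infinity>m. c m * ee (of_int (m + k) * x))) UNIV"
      by (rule has_sum_integral[OF _ _ c_sum]) (auto intro!: continuous_intros simp: norm_mult)
    also have "(\<lambda>m. integral {0..1} (\<lambda>x. c m * ee (of_int (m + k) * x))) = (\<lambda>m. if m = - k then c m else 0)"
      by (auto simp: fun_eq_iff integral_mult_right integral_ee add_eq_0_iff2 simp del: of_int_add)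
    also have "(\<lambda>x. \<Sum>\<^sub>\<infinity>m. c m * ee (of_int (m + k) * x)) = (\<lambda>x. \<psi> x * ee (of_int k * x))"
      unfolding \<psi>_def by (subst infsum_cmult_left'[symmetric]) (simp add: distrib_right ee_add mult.assoc)
    finally have "((\<lambda>m. if m = - k then c m else 0) has_sum integral {0..1} (\<lambda>x. \<psi> x * ee (of_int k * x))) UNIV" .
    moreover have "((\<lambda>m. if m = - k then c m else 0) has_sum c (- k)) UNIV"
      by (rule has_sum_finite_neutralI[of "{- k}"]) auto
    ultimately have 1: "integral {0..1} (\<lambda>x. \<psi> x * ee (of_int k * x)) = c (- k)"
      using has_sum_unique by blast
    define g where "g = (\<lambda>t. complex_of_real (exp (- pi * a * t\<^sup>2)) * ee (- t * (of_int (- k) + y)))"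
    have g_eq: "f (x + of_int r) * ee (of_int k * x) = g (x + of_int r)" for x and r :: int
    proof -
      have "- (x + of_int r) * (of_int (- k) + y) = - (x + of_int r) * y + (of_int k * x + of_int (k * r))"
        by (simp add: algebra_simps)
      then show ?thesis unfolding f_def g_def by (simp only: ee_add ee_of_int) simp
    qed
    have g_int: "integrable lborel g" and g_val: "integral\<^sup>L lborel g = c (- k)"
      using gaussian_fourier_transform[OF a, of "of_int (- k) + y"]
      by (auto simp: has_bochner_integral_iff g_def c_def)
    have g_cont: "continuous_on S g" for S unfolding g_def by (intro continuous_intros)
    have "((\<lambda>r. integral {0..1} (\<lambda>x. f (x + of_int r) * ee (of_int k * x))) has_sum
        integral {0..1} (\<lambda>x. \<Sum>\<^sub>\<infinity>r. f (x + of_int r) * ee (of_int k * x))) UNIV"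
    proof (rule has_sum_integral[OF _ _ B_sum[of 1]])
      fix r :: int and x :: real assume "x \<in> {0..1}"
      then show "norm (f (x + of_int r) * ee (of_int k * x)) \<le> B 1 r"
        using fB[of x 1 r] by (simp add: norm_mult)
    qed (intro continuous_intros f_cont)
    also have "(\<lambda>r::int. integral {0..1} (\<lambda>x. f (x + of_int r) * ee (of_int k * x))) = (\<lambda>r. integral {of_int r..of_int r + 1} g)"
      unfolding g_eq
    proof
      fix r :: int
      show "integral {0..1} (\<lambda>x. g (x + of_int r)) = integral {of_int r..of_int r + 1} g"
        using integral_shift_Icc_real[of 0 1 g "of_int r"] by (simp add: o_def add.commute)
    qed
    also have "(\<lambda>x. \<Sum>\<^sub>\<infinity>r. f (x + of_int r) * ee (of_int k * x)) = (\<lambda>x. \<phi> x * ee (of_int k * x))"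
      unfolding \<phi>_def by (subst infsum_cmult_left'[symmetric]) simp
    finally have hs: "((\<lambda>r::int. integral {of_int r..of_int r + 1} g) has_sum integral {0..1} (\<lambda>x. \<phi> x * ee (of_int k * x))) UNIV" .
    (* The periods r = - n, ..., n - 1 tile [- n, n]; as n grows the integral over it tends to that over the line. *)
    have "filterlim (\<lambda>n::nat. {- int n..<int n}) (finite_subsets_at_top UNIV) sequentially"
    proof (rule filterlim_finite_subsets_at_top[THEN iffD2], safe)
      fix X :: "int set" assume "finite X"
      then obtain b where b: "\<And>x. x \<in> X \<Longrightarrow> \<bar>x\<bar> \<le> b"
        by (metis finite_imageI Max_ge image_eqI)
      show "\<forall>\<^sub>F n in sequentially. finite {- int n..<int n} \<and> X \<subseteq> {- int n..<int n} \<and> {- int n..<int n} \<subseteq> UNIV"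
        using eventually_gt_at_top[of "nat b"]
      proof eventually_elim
        case (elim n)
        have "x \<in> {- int n..<int n}" if "x \<in> X" for x using b[OF that] elim by auto
        then show ?case by auto
      qed
    qed
    then have lim1: "(\<lambda>n. \<Sum>r\<in>{- int n..<int n}. integral {of_int r..of_int r + 1} g) \<longlonglongrightarrow>
        integral {0..1} (\<lambda>x. \<phi> x * ee (of_int k * x))"
      by (rule filterlim_compose[OF hs[unfolded has_sum_def]])
    have sum_eq: "(\<Sum>r\<in>{- int n..<int n}. integral {of_int r..of_int r + 1} g) = integral {- real n..real n} g" for n
    proof (induction n)
      case (Suc n)
      have int: "g integrable_on {x..y}" for x y by (rule integrable_continuous_real[OF g_cont])
      have "{- int (Suc n)..<int (Suc n)} = insert (- int n - 1) (insert (int n) {- int n..<int n})" by auto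
      then have "(\<Sum>r\<in>{- int (Suc n)..<int (Suc n)}. integral {of_int r..of_int r + 1} g)
          = integral {- real n - 1..- real n} g + (integral {real n..real n + 1} g + integral {- real n..real n} g)"
        using Suc by (simp add: add.commute)
      also have "\<dots> = integral {- real n - 1..real n + 1} g"
        using Henstock_Kurzweil_Integration.integral_combine[OF _ _ int, of "- real n" "real n" "real n + 1"]
          Henstock_Kurzweil_Integration.integral_combine[OF _ _ int, of "- real n - 1" "- real n" "real n + 1"]
        by (simp add: add.commute)
      also have "\<dots> = integral {- real (Suc n)..real (Suc n)} g"
        by (rule arg_cong2[where f = "\<lambda>x y. integral {x..y} g"]) auto
      finally show ?case .
    qed simp
    have "(\<lambda>n. LINT x:{- real n..real n}|lborel. g x) \<longlonglongrightarrow> (LINT x:(\<Union>n. {- real n..real n})|lborel. g x)"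
      using g_int by (intro set_integral_cont_up)
        (auto simp: incseq_def set_integrable_def intro!: integrable_mult_indicator)
    also have "(\<Union>n. {- real n..real n}) = UNIV"
    proof -
      have "x \<in> (\<Union>n. {- real n..real n})" for x using real_arch_simple[of "\<bar>x\<bar>"] by (auto simp: abs_le_iff minus_le_iff)
      then show ?thesis by blast
    qed
    also have "(LINT x:UNIV|lborel. g x) = c (- k)" by (simp add: set_lebesgue_integral_def g_val)
    also have "(\<lambda>n. LINT x:{- real n..real n}|lborel. g x) = (\<lambda>n. integral {- real n..real n} g)"
      by (intro ext set_borel_integral_eq_integral(2)) 
         (auto simp: set_integrable_def intro!: integrable_mult_indicator g_int)
    finally have "integral {0..1} (\<lambda>x. \<phi> x * ee (of_int k * x)) = c (- k)"
      using lim1 unfolding sum_eq by (metis LIMSEQ_unique)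
    with 1 show "integral {0..1} (\<lambda>x. \<phi> x * ee (of_int k * x)) = integral {0..1} (\<lambda>x. \<psi> x * ee (of_int k * x))" by simp
  qed
  then have "\<phi> x = \<psi> x" by simp
  then show ?thesis unfolding \<phi>_def \<psi>_def f_def c_def .
qed

section \<open>Theta functions with purely imaginary modulus\<close>

lemma theta1_imag:
  "theta1 (of_real u) (\<i> * of_real b) =
     (\<Sum>\<^sub>\<infinity>n::int. of_real (exp (- pi * b * (of_int n + 1/2)\<^sup>2)) * ee ((of_int n + 1/2) * u))"
  unfolding theta1_def
proof (rule infsum_cong)
  fix n :: int
  have "nome_pow (\<i> * of_real b) ((of_int n + 1/2)\<^sup>2) = of_real (exp (- pi * b * (of_int n + 1/2)\<^sup>2))"
    by (simp add: nome_pow_def exp_of_real[symmetric] algebra_simps)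
  moreover have "e_char ((of_int n + 1/2) * of_real u) = ee ((of_int n + 1/2) * u)"
    by (simp flip: e_char_of_real)
  ultimately show "nome_pow (\<i> * of_real b) ((of_int n + 1/2)\<^sup>2) * e_char ((of_int n + 1/2) * of_real u)
      = of_real (exp (- pi * b * (of_int n + 1/2)\<^sup>2)) * ee ((of_int n + 1/2) * u)" by simp
qed

lemma theta3_imag:
  "theta3 (of_real x) (\<i> * of_real b) =
     (\<Sum>\<^sub>\<infinity>n::int. of_real (exp (- pi * b * (of_int n)\<^sup>2)) * ee (of_int n * x))"
  unfolding theta3_def
proof (rule infsum_cong)
  fix n :: int
  have "nome_pow (\<i> * of_real b) ((of_int n)\<^sup>2) = of_real (exp (- pi * b * (of_int n)\<^sup>2))"
    by (simp add: nome_pow_def exp_of_real[symmetric] algebra_simps)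
  moreover have "e_char (of_int n * of_real x) = ee (of_int n * x)"
    by (simp flip: e_char_of_real)
  ultimately show "nome_pow (\<i> * of_real b) ((of_int n)\<^sup>2) * e_char (of_int n * of_real x)
      = of_real (exp (- pi * b * (of_int n)\<^sup>2)) * ee (of_int n * x)" by simp
qed

lemma summable_on_theta1_coeffs:
  assumes "b > 0"
  shows "(\<lambda>n::int. exp (- pi * b * (of_int n + 1/2)\<^sup>2)) summable_on UNIV"
  using summable_on_int_gauss_shift[of "pi * b" "1/2"] assms by (simp add: add.commute)

lemma summable_on_theta3_coeffs:
  assumes "b > 0"
  shows "(\<lambda>n::int. exp (- pi * b * (of_int n)\<^sup>2)) summable_on UNIV"
  using summable_on_int_gauss_shift[of "pi * b" 0] assms by simp

lemma theta1_even: "theta1 (of_real (- u)) (\<i> * of_real b) = theta1 (of_real u) (\<i> * of_real b)"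
  unfolding theta1_imag
proof (rule infsum_reindex_bij_witness[where i = "\<lambda>n. - 1 - n" and j = "\<lambda>n. - 1 - n"])
  fix n :: int
  have e: "of_int (- 1 - n) + 1/2 = - (of_int n + 1/2 :: real)" by simp
  show "of_real (exp (- pi * b * (of_int (- 1 - n) + 1/2)\<^sup>2)) * ee ((of_int (- 1 - n) + 1/2) * u)
      = of_real (exp (- pi * b * (of_int n + 1/2)\<^sup>2)) * ee ((of_int n + 1/2) * (- u))"
    by (simp only: e power2_minus mult_minus_left mult_minus_right)
qed auto

lemma theta3_transformation:
  assumes "l > 0"
  shows "theta3 (of_real x) (\<i> * of_real (1 / l)) =
    of_real (sqrt l) * (\<Sum>\<^sub>\<infinity>r::int. of_real (exp (- pi * l * (x + of_int r)\<^sup>2)))"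
proof -
  have "(\<Sum>\<^sub>\<infinity>r::int. complex_of_real (exp (- pi * l * (x + of_int r)\<^sup>2)))
      = (\<Sum>\<^sub>\<infinity>m::int. of_real (exp (- pi * (1 / l) * (of_int m)\<^sup>2)) * ee (of_int m * x) * of_real (1 / sqrt l))"
    using poisson_gauss[OF assms, of x 0] by simp
  also have "\<dots> = theta3 (of_real x) (\<i> * of_real (1 / l)) * of_real (1 / sqrt l)"
    unfolding theta3_imag by (rule infsum_cmult_left')
  finally show ?thesis using assms by (simp add: field_simps)
qed

text \<open>Visible only after the transformation, which writes \<open>\<theta>\<^sub>3\<close> as a sum of Gaussians.\<close>

lemma theta3_nonneg:
  assumes "l > 0"
  shows "0 \<le> theta3 (of_real x) (\<i> * of_real (1 / l))"
proof -
  have "(\<lambda>r::int. complex_of_real (exp (- pi * l * (x + of_int r)\<^sup>2))) summable_on UNIV"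
    using summable_on_int_gauss_shift[of "pi * l" x] assms by (intro summable_on_of_real) simp
  then have "0 \<le> (\<Sum>\<^sub>\<infinity>r::int. complex_of_real (exp (- pi * l * (x + of_int r)\<^sup>2)))"
    by (rule infsum_nonneg_complex) (simp add: less_eq_complex_def)
  moreover have "0 \<le> complex_of_real (sqrt l)" using assms by (simp add: less_eq_complex_def)
  ultimately show ?thesis
    unfolding theta3_transformation[OF assms] by (rule mult_nonneg_nonneg[rotated])
qed

lemma theta1_transformation:
  assumes "b > 0"
  shows "theta1 (of_real u) (\<i> * of_real b) =
    of_real (1 / sqrt b) * (\<Sum>\<^sub>\<infinity>r::int. of_real (exp (- pi * (1 / b) * (u + of_int r)\<^sup>2)) * ee (- of_int r / 2))"
proof -
  have "(\<Sum>\<^sub>\<infinity>r::int. of_real (exp (- pi * (1 / b) * (u + of_int r)\<^sup>2)) * ee (- of_int r / 2)) * ee (- u / 2)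
     = (\<Sum>\<^sub>\<infinity>r::int. of_real (exp (- pi * (1 / b) * (u + of_int r)\<^sup>2)) * ee (- (u + of_int r) * (1/2)))"
  proof (subst infsum_cmult_left'[symmetric], rule infsum_cong)
    fix r :: int
    have "- (u + of_int r) * (1/2) = - of_int r / 2 + - u / 2" by (simp add: field_simps)
    then show "of_real (exp (- pi * (1 / b) * (u + of_int r)\<^sup>2)) * ee (- of_int r / 2) * ee (- u / 2)
        = of_real (exp (- pi * (1 / b) * (u + of_int r)\<^sup>2)) * ee (- (u + of_int r) * (1/2))"
      by (simp only: ee_add mult.assoc)
  qed
  also have "\<dots> = (\<Sum>\<^sub>\<infinity>m::int. of_real (exp (- pi * (of_int m + 1/2)\<^sup>2 / (1 / b)) / sqrt (1 / b)) * ee (of_int m * u))"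
    using poisson_gauss[of "1 / b" u "1/2"] assms by simp
  also have "\<dots> = (\<Sum>\<^sub>\<infinity>m::int. of_real (exp (- pi * b * (of_int m + 1/2)\<^sup>2)) * ee ((of_int m + 1/2) * u) *
      (of_real (sqrt b) * ee (- u / 2)))"
  proof (rule infsum_cong)
    fix m :: int
    have "ee ((of_int m + 1/2) * u) * ee (- u / 2) = ee (of_int m * u)"
      by (simp flip: ee_add add: algebra_simps)
    then show "of_real (exp (- pi * (of_int m + 1/2)\<^sup>2 / (1 / b)) / sqrt (1 / b)) * ee (of_int m * u)
      = of_real (exp (- pi * b * (of_int m + 1/2)\<^sup>2)) * ee ((of_int m + 1/2) * u) * (of_real (sqrt b) * ee (- u / 2))"
      using assms by (simp add: real_sqrt_divide mult_ac)
  qed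
  also have "\<dots> = theta1 (of_real u) (\<i> * of_real b) * of_real (sqrt b) * ee (- u / 2)"
    unfolding theta1_imag by (subst infsum_cmult_left') (simp add: mult_ac)
  finally show ?thesis using assms by (simp add: field_simps)
qed

section \<open>Positivity of \<open>\<theta>\<^sub>1\<close>\<close>

text \<open>The first term outweighs all others, since \<open>1/2 + 1/4 + \<dots> = 1\<close>.\<close>

lemma has_sum_nonneg_geometric:
  fixes h :: "nat \<Rightarrow> real"
  assumes "((\<lambda>k. complex_of_real (h k)) has_sum S) UNIV" "\<And>k. \<bar>h (Suc k)\<bar> \<le> h 0 * (1/2) ^ Suc k"
  shows "0 \<le> S"
proof -
  have "(h has_sum Re S) UNIV" using has_sum_Re[OF assms(1)] by simp
  then have h: "h sums Re S" by (rule has_sum_imp_sums)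
  have "((\<lambda>k::nat. 0::real) has_sum Im S) UNIV" using has_sum_Im[OF assms(1)] by simp
  then have Im: "Im S = 0" using has_sum_0_simp has_sum_unique by blast
  have geo: "(\<lambda>k. h 0 * (1/2) ^ Suc k) sums h 0"
    using sums_mult[OF power_half_series, of "h 0"] by simp
  have tail: "(\<lambda>k. h (Suc k)) sums (Re S - h 0)" using h by (simp add: sums_Suc_iff)
  have "- h 0 \<le> Re S - h 0"
    using sums_le[OF _ sums_minus[OF geo] tail] assms(2) by (meson abs_le_iff minus_le_iff)
  with Im show ?thesis by (simp add: less_eq_complex_def)
qed

text \<open>With the next lemma, this bounds the ratio of a term of the folded \<open>\<theta>\<^sub>1\<close> series to its first
  term uniformly up to the zeros of \<open>\<theta>\<^sub>1\<close> at \<open>u = \<plusminus> 1/2\<close>, where all terms vanish simultaneously.\<close>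

lemma abs_cos_odd_multiple_le: "\<bar>cos ((2 * real k + 1) * t)\<bar> \<le> (2 * real k + 1) * \<bar>cos t\<bar>"
proof (induction k)
  case (Suc k)
  have "cos ((2 * real (Suc k) + 1) * t) = cos ((2 * real k + 1) * t + 2 * t)" by (simp add: algebra_simps)
  also have "\<dots> = cos ((2 * real k + 1) * t) * cos (2 * t) - (sin ((2 * real k + 1) * t) * sin t) * (2 * cos t)"
    by (simp add: cos_add sin_double)
  also have "\<bar>\<dots>\<bar> \<le> \<bar>cos ((2 * real k + 1) * t)\<bar> * \<bar>cos (2 * t)\<bar>
      + (\<bar>sin ((2 * real k + 1) * t)\<bar> * \<bar>sin t\<bar>) * \<bar>2 * cos t\<bar>"
    unfolding abs_mult[symmetric] by (rule abs_triangle_ineq4)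
  also have "\<dots> \<le> \<bar>cos ((2 * real k + 1) * t)\<bar> * 1 + (1 * 1) * \<bar>2 * cos t\<bar>"
    by (intro add_mono mult_left_mono mult_right_mono mult_mono) auto
  finally show ?case using Suc by (simp add: algebra_simps)
qed simp

lemma sinh_odd_multiple_le:
  assumes "y \<ge> (0::real)"
  shows "sinh ((2 * real k + 1) * y) \<le> (2 * real k + 1) * exp (2 * real k * y) * sinh y"
proof (induction k)
  case (Suc k)
  have cosh_le: "cosh t \<le> exp t" if "t \<ge> 0" for t :: real
    using that by (simp add: cosh_field_def)
  have "sinh ((2 * real (Suc k) + 1) * y) = sinh ((2 * real k + 1) * y + 2 * y)" by (simp add: algebra_simps)
  also have "\<dots> = sinh ((2 * real k + 1) * y) * cosh (2 * y) + 2 * (cosh ((2 * real k + 1) * y) * cosh y) * sinh y"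
    by (simp add: sinh_add sinh_double)
  also have "\<dots> \<le> ((2 * real k + 1) * exp (2 * real k * y) * sinh y) * exp (2 * y)
      + 2 * (exp ((2 * real k + 1) * y) * exp y) * sinh y"
    using assms by (intro add_mono mult_mono Suc cosh_le mult_nonneg_nonneg) auto
  also have "\<dots> = (2 * real (Suc k) + 1) * exp (2 * real (Suc k) * y) * sinh y"
  proof -
    have "exp (2 * real k * y) * exp (2 * y) = exp (2 * real (Suc k) * y)"
      "exp ((2 * real k + 1) * y) * exp y = exp (2 * real (Suc k) * y)"
      by (simp_all flip: exp_add add: algebra_simps)
    then show ?thesis by (simp add: algebra_simps)
  qed
  finally show ?case .
qed simp

lemma odd_times_gauss_le: "(2 * real n + 1) * exp (- pi * (real n)\<^sup>2) \<le> (1/2) ^ n"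
proof -
  have 3: "2 * real n + 1 \<le> 3 ^ n"
    by (induction n) auto
  (* 2 n + 1 \<le> 3 ^ n and exp (- \<pi>) \<le> 1/6, hence the ratio 3/6. *)
  have "6 \<le> exp (3::real)"
  proof -
    have "2 \<le> exp (1::real)" using exp_ge_add_one_self[of 1] by simp
    then have "2 ^ 3 \<le> exp (1::real) ^ 3" by (intro power_mono) auto
    then show ?thesis by (simp flip: exp_of_nat_mult)
  qed
  also have "\<dots> \<le> exp pi" using pi_gt3 by simp
  finally have "exp (- pi) \<le> 1/6" by (simp add: exp_minus field_simps)
  then have "exp (- pi) ^ n \<le> (1/6) ^ n" by (intro power_mono) auto
  moreover have "exp (- pi * (real n)\<^sup>2) \<le> exp (- pi) ^ n"
    by (cases "n = 0") (auto simp flip: exp_of_nat_mult simp: power2_eq_square mult.commute)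
  ultimately have "(2 * real n + 1) * exp (- pi * (real n)\<^sup>2) \<le> 3 ^ n * (1/6) ^ n"
    using 3 by (intro mult_mono) auto
  also have "\<dots> = (1/2) ^ n" by (simp flip: power_mult_distrib)
  finally show ?thesis .
qed

text \<open>For a large modulus the Fourier series itself is dominated by its first term,
  a multiple of \<open>cos (\<pi> u)\<close>.\<close>

lemma theta1_nonneg_ge_1:
  assumes "b \<ge> 1" "\<bar>u\<bar> \<le> 1/2"
  shows "0 \<le> theta1 (of_real u) (\<i> * of_real b)"
proof -
  let ?t = "\<lambda>n::int. of_real (exp (- pi * b * (of_int n + 1/2)\<^sup>2)) * ee ((of_int n + 1/2) * u)"
  define h where "h = (\<lambda>k. 2 * exp (- pi * b * (real k + 1/2)\<^sup>2) * cos ((2 * real k + 1) * (pi * u)))"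
  have cos0: "0 \<le> cos (pi * u)"
    using assms by (intro cos_pi_nonneg)
  have "?t summable_on UNIV"
    by (rule summable_on_dominated[OF summable_on_theta1_coeffs[of b]]) (use assms in \<open>auto simp: norm_mult\<close>)
  moreover have "?t (int k) + ?t (- 1 - int k) = of_real (h k)" for k
  proof -
    have e: "of_int (- 1 - int k) + 1/2 = - (real k + 1/2)" by simp
    have c: "ee ((real k + 1/2) * u) + ee (- ((real k + 1/2) * u)) = of_real (2 * cos ((2 * real k + 1) * (pi * u)))"
      unfolding ee_plus_minus by (simp add: algebra_simps)
    have "?t (int k) + ?t (- 1 - int k) = of_real (exp (- pi * b * (real k + 1/2)\<^sup>2))
        * (ee ((real k + 1/2) * u) + ee (- ((real k + 1/2) * u)))"
      by (simp only: e of_int_of_nat_eq power2_minus mult_minus_left distrib_left)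
    also have "\<dots> = of_real (h k)"
      unfolding c h_def of_real_mult[symmetric] by (simp only: mult_ac)
    finally show ?thesis .
  qed
  ultimately have "((\<lambda>k::nat. complex_of_real (h k)) has_sum theta1 (of_real u) (\<i> * of_real b)) UNIV"
    using has_sum_int_fold[of ?t] by (simp only: theta1_imag)
  then show ?thesis
  proof (rule has_sum_nonneg_geometric)
    fix k :: nat
    define n where "n = Suc k"
    have "real n \<le> (real n)\<^sup>2" by (simp add: n_def power2_eq_square)
    have "(real n)\<^sup>2 * 1 \<le> ((real n)\<^sup>2 + real n) * b" using assms by (intro mult_mono) auto
    then have "exp (- pi * b * ((real n)\<^sup>2 + real n)) \<le> exp (- pi * (real n)\<^sup>2)"
      using mult_left_mono[of "(real n)\<^sup>2" "((real n)\<^sup>2 + real n) * b" pi] by (simp add: mult_ac)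
    then have *: "(2 * real n + 1) * exp (- pi * b * ((real n)\<^sup>2 + real n)) \<le> (1/2) ^ n"
      using odd_times_gauss_le[of n] by (smt (verit) mult_left_mono of_nat_0_le_iff)
    have "exp (- pi * b * (real n + 1/2)\<^sup>2) = exp (- pi * b * (1/2)\<^sup>2) * exp (- pi * b * ((real n)\<^sup>2 + real n))"
      by (simp flip: exp_add add: power2_eq_square algebra_simps)
    then have "\<bar>h n\<bar> = 2 * exp (- pi * b * (1/2)\<^sup>2) * exp (- pi * b * ((real n)\<^sup>2 + real n)) * \<bar>cos ((2 * real n + 1) * (pi * u))\<bar>"
      by (simp add: h_def abs_mult)
    also have "\<dots> \<le> 2 * exp (- pi * b * (1/2)\<^sup>2) * exp (- pi * b * ((real n)\<^sup>2 + real n)) * ((2 * real n + 1) * \<bar>cos (pi * u)\<bar>)"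
      by (intro mult_left_mono abs_cos_odd_multiple_le) auto
    also have "\<dots> = (2 * exp (- pi * b * (1/2)\<^sup>2) * cos (pi * u)) * ((2 * real n + 1) * exp (- pi * b * ((real n)\<^sup>2 + real n)))"
      using cos0 by simp
    also have "\<dots> \<le> (2 * exp (- pi * b * (1/2)\<^sup>2) * cos (pi * u)) * (1/2) ^ n"
      using cos0 by (intro mult_left_mono *) auto
    also have "\<dots> = h 0 * (1/2) ^ n" by (simp add: h_def)
    finally show "\<bar>h (Suc k)\<bar> \<le> h 0 * (1/2) ^ Suc k" by (simp only: n_def)
  qed
qed

text \<open>For a small modulus the transformed series \<open>\<Sum>\<^sub>r (- 1) ^ r exp (- \<pi> (u + r)\<^sup>2 / b)\<close> takes over.
  It is folded about its zero \<open>u = - 1/2\<close>, where \<open>r\<close> and \<open>1 - r\<close> cancel; the pairs are then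
  hyperbolic sines in \<open>u + 1/2\<close>, again dominated by the first.\<close>

lemma theta1_nonneg_le_1:
  assumes "0 < b" "b \<le> 1" "- 1/2 \<le> u" "u \<le> 0"
  shows "0 \<le> theta1 (of_real u) (\<i> * of_real b)"
proof -
  define \<kappa> where "\<kappa> = 1 / b"
  have \<kappa>: "\<kappa> \<ge> 1" using assms by (simp add: \<kappa>_def)
  (* The distance from the zero at u = - 1/2. *)
  define v where "v = u + 1/2"
  have v: "0 \<le> v" "v \<le> 1/2" using assms by (auto simp: v_def)
  define t where "t = (\<lambda>r::int. complex_of_real (exp (- pi * \<kappa> * (u + of_int r)\<^sup>2)) * ee (- of_int r / 2))"
  define h where "h = (\<lambda>k. (- 1) ^ k * (2 * exp (- pi * \<kappa> * (v\<^sup>2 + (real k + 1/2)\<^sup>2)) * sinh ((2 * real k + 1) * (pi * \<kappa> * v))))"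
  have "t summable_on UNIV"
    unfolding t_def
    by (rule summable_on_dominated[OF summable_on_int_gauss_shift[of "pi * \<kappa>" u]]) (use \<kappa> in \<open>auto simp: norm_mult\<close>)
  then have "(t has_sum infsum t UNIV) UNIV" by simp
  then have "((\<lambda>n. t (n + 1)) has_sum infsum t UNIV) UNIV" by (simp only: has_sum_int_shift)
  then have "((\<lambda>k::nat. t (int k + 1) + t (- 1 - int k + 1)) has_sum infsum t UNIV) UNIV"
    using has_sum_int_fold[of "\<lambda>n. t (n + 1)"] by (auto simp: has_sum_iff)
  moreover have "t (int k + 1) + t (- 1 - int k + 1) = of_real (h k)" for k
  proof -
    have e: "ee (real k / 2) = (- 1) ^ k" "ee (- (real k + 1) / 2) = - ((- 1) ^ k)"
    proof -
      show *: "ee (real k / 2) = (- 1) ^ k" using ee_power[of "1/2" k] by simp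
      have "- (real k + 1) / 2 = of_int (- int k - 1) + (real k / 2 + 1/2)" by (simp add: field_simps)
      then show "ee (- (real k + 1) / 2) = - ((- 1) ^ k)" by (simp only: ee_add ee_of_int * ee_half) simp
    qed
    define w where "w = real k + 1/2"
    have sinh_eq: "sinh ((2 * real k + 1) * (pi * \<kappa> * v)) = (exp (2 * pi * \<kappa> * v * w) - exp (- (2 * pi * \<kappa> * v * w))) / 2"
      unfolding sinh_field_def w_def by (simp add: algebra_simps)
    have "2 * exp (- pi * \<kappa> * (v\<^sup>2 + w\<^sup>2)) * sinh ((2 * real k + 1) * (pi * \<kappa> * v))
       = exp (- pi * \<kappa> * (v\<^sup>2 + w\<^sup>2)) * exp (2 * pi * \<kappa> * v * w) - exp (- pi * \<kappa> * (v\<^sup>2 + w\<^sup>2)) * exp (- (2 * pi * \<kappa> * v * w))"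
      unfolding sinh_eq by (simp add: right_diff_distrib)
    also have "\<dots> = exp (- pi * \<kappa> * (v - w)\<^sup>2) - exp (- pi * \<kappa> * (v + w)\<^sup>2)"
      by (simp flip: exp_add add: power2_eq_square algebra_simps)
    finally have "h k = (- 1) ^ k * (exp (- pi * \<kappa> * (v - w)\<^sup>2) - exp (- pi * \<kappa> * (v + w)\<^sup>2))"
      by (simp add: h_def w_def)
    moreover have "u + of_int (int k + 1) = v + w" "u + of_int (- 1 - int k + 1) = v - w"
      by (auto simp: v_def w_def)
    moreover have "- of_int (int k + 1) / 2 = - (real k + 1) / 2" "- of_int (- 1 - int k + 1) / 2 = real k / 2" by auto
    ultimately show ?thesis
      unfolding t_def by (simp only: e) (simp add: algebra_simps)
  qed
  ultimately have "((\<lambda>k. complex_of_real (h k)) has_sum infsum t UNIV) UNIV" by simp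
  then have "0 \<le> infsum t UNIV"
  proof (rule has_sum_nonneg_geometric)
    fix k :: nat
    define n where "n = Suc k"
    define y where "y = pi * \<kappa> * v"
    have y: "0 \<le> y" using v \<kappa> by (simp add: y_def)
    have sy: "0 \<le> sinh y" using y by simp
    have "exp (- pi * \<kappa> * ((real n)\<^sup>2 + real n)) * exp (2 * real n * y) \<le> exp (- pi * (real n)\<^sup>2)"
    proof -
      have "2 * v * (\<kappa> * real n) \<le> 1 * (\<kappa> * real n)"
        using v \<kappa> by (intro mult_right_mono) auto
      moreover have "1 * (real n)\<^sup>2 \<le> \<kappa> * (real n)\<^sup>2" using \<kappa> by (intro mult_right_mono) auto
      ultimately have "(real n)\<^sup>2 + 2 * v * (\<kappa> * real n) \<le> \<kappa> * ((real n)\<^sup>2 + real n)"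
        by (simp add: algebra_simps)
      from mult_left_mono[OF this, of pi] show ?thesis by (simp flip: exp_add add: y_def algebra_simps)
    qed
    then have "(2 * real n + 1) * (exp (- pi * \<kappa> * ((real n)\<^sup>2 + real n)) * exp (2 * real n * y)) \<le> (2 * real n + 1) * exp (- pi * (real n)\<^sup>2)"
      by (intro mult_left_mono) auto
    with odd_times_gauss_le[of n] have *: "(2 * real n + 1) * (exp (- pi * \<kappa> * ((real n)\<^sup>2 + real n)) * exp (2 * real n * y)) \<le> (1/2) ^ n"
      by linarith
    have E: "exp (- pi * \<kappa> * (v\<^sup>2 + (real n + 1/2)\<^sup>2)) = exp (- pi * \<kappa> * (v\<^sup>2 + (1/2)\<^sup>2)) * exp (- pi * \<kappa> * ((real n)\<^sup>2 + real n))"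
      by (simp flip: exp_add add: power2_eq_square algebra_simps)
    have "\<bar>h n\<bar> = 2 * (exp (- pi * \<kappa> * (v\<^sup>2 + (1/2)\<^sup>2)) * exp (- pi * \<kappa> * ((real n)\<^sup>2 + real n))) * sinh ((2 * real n + 1) * y)"
      unfolding h_def E[symmetric] using y by (simp add: abs_mult y_def)
    also have "\<dots> \<le> 2 * (exp (- pi * \<kappa> * (v\<^sup>2 + (1/2)\<^sup>2)) * exp (- pi * \<kappa> * ((real n)\<^sup>2 + real n))) * ((2 * real n + 1) * exp (2 * real n * y) * sinh y)"
      by (intro mult_left_mono sinh_odd_multiple_le y) auto
    also have "\<dots> = 2 * exp (- pi * \<kappa> * (v\<^sup>2 + (1/2)\<^sup>2)) * sinh y * ((2 * real n + 1) * (exp (- pi * \<kappa> * ((real n)\<^sup>2 + real n)) * exp (2 * real n * y)))"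
      by (simp add: mult_ac)
    also have "\<dots> \<le> 2 * exp (- pi * \<kappa> * (v\<^sup>2 + (1/2)\<^sup>2)) * sinh y * (1/2) ^ n"
      using sy by (intro mult_left_mono *) auto
    also have "\<dots> = h 0 * (1/2) ^ n" by (simp add: h_def y_def)
    finally show "\<bar>h (Suc k)\<bar> \<le> h 0 * (1/2) ^ Suc k" by (simp only: n_def)
  qed
  moreover have "theta1 (of_real u) (\<i> * of_real b) = of_real (1 / sqrt b) * infsum t UNIV"
    using theta1_transformation[OF assms(1)] by (simp add: t_def \<kappa>_def)
  ultimately show ?thesis using assms by (simp only:) (intro mult_nonneg_nonneg, auto simp: less_eq_complex_def)
qed

lemma theta1_nonneg:
  assumes "b > 0" "\<bar>u\<bar> \<le> 1/2"
  shows "0 \<le> theta1 (of_real u) (\<i> * of_real b)"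
proof (cases "b \<ge> 1")
  case False
  show ?thesis
  proof (cases "u \<le> 0")
    case True
    then show ?thesis using assms False by (intro theta1_nonneg_le_1) auto
  next
    case pos: False
    then have "0 \<le> theta1 (of_real (- u)) (\<i> * of_real b)"
      using assms False by (intro theta1_nonneg_le_1) auto
    then show ?thesis by (simp only: theta1_even)
  qed
qed (use assms theta1_nonneg_ge_1 in auto)

section \<open>Partial fractions of the cotangent\<close>

text \<open>The logarithmic derivative of the reflection formula of the Gamma function.\<close>

lemma Digamma_reflection:
  fixes z :: complex
  assumes "z \<notin> \<int>"
  shows "Digamma (1 - z) - Digamma z = of_real pi * cot (of_real pi * z)"
proof -
  have s: "sin (of_real pi * z) \<noteq> 0"
    using assms by (auto simp: sin_eq_0 elim!: Ints_cases)
  have z: "z \<notin> \<int>\<^sub>\<le>\<^sub>0" "1 - z \<notin> \<int>\<^sub>\<le>\<^sub>0"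
    using assms nonpos_Ints_Int Ints_diff[OF Ints_1, of "1 - z"] by auto
  define G where "G = Gamma z * Gamma (1 - z)"
  have G: "G = of_real pi / sin (of_real pi * z)" unfolding G_def by (rule Gamma_reflection_complex)
  have "((\<lambda>z. Gamma z * Gamma (1 - z)) has_field_derivative G * (Digamma z - Digamma (1 - z))) (at z)"
    unfolding G_def using z by (auto intro!: derivative_eq_intros simp: algebra_simps)
  moreover have "((\<lambda>z::complex. of_real pi / sin (of_real pi * z)) has_field_derivative
      - (G * (of_real pi * cot (of_real pi * z)))) (at z)"
    using s by (auto intro!: derivative_eq_intros simp: G cot_def power2_eq_square)
  ultimately have "G * (Digamma z - Digamma (1 - z)) = - (G * (of_real pi * cot (of_real pi * z)))"
    unfolding Gamma_reflection_complex by (rule DERIV_unique)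
  moreover have "G \<noteq> 0" using s by (simp add: G)
  ultimately have "Digamma z - Digamma (1 - z) = - (of_real pi * cot (of_real pi * z))"
    by (simp only: mult_minus_right[symmetric] mult_cancel_left) simp
  then have "- (Digamma z - Digamma (1 - z)) = of_real pi * cot (of_real pi * z)" by simp
  then show ?thesis by (simp only: minus_diff_eq)
qed

lemma cot_sums:
  fixes z :: complex
  assumes "z \<notin> \<int>"
  shows "(\<lambda>k. 1 / (z + of_int (int k)) + 1 / (z + of_int (- 1 - int k))) sums (of_real pi * cot (of_real pi * z))"
proof -
  have "z \<noteq> 0" "1 - z \<noteq> 0" using assms by auto
  then have "(\<lambda>n. inverse (of_nat (Suc n)) - inverse (1 - z + of_nat n)) sums (Digamma (1 - z) + euler_mascheroni)"
    "(\<lambda>n. inverse (of_nat (Suc n)) - inverse (z + of_nat n)) sums (Digamma z + euler_mascheroni)"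
    unfolding Digamma_def by (simp_all add: summable_Digamma summable_sums del: of_nat_Suc)
  from sums_diff[OF this]
  have "(\<lambda>n. inverse (z + of_nat n) - inverse (1 - z + of_nat n)) sums (Digamma (1 - z) - Digamma z)" by simp
  moreover have "inverse (z + of_nat n) - inverse (1 - z + of_nat n) = 1 / (z + of_int (int n)) + 1 / (z + of_int (- 1 - int n))" for n
  proof -
    have "z + of_int (- 1 - int n) = - (1 - z + of_nat n)" by simp
    then show ?thesis by (simp only: of_int_of_nat_eq divide_minus_right inverse_eq_divide) simp
  qed
  ultimately show ?thesis by (simp only: Digamma_reflection[OF assms])
qed

text \<open>A point off the integers keeps from \<open>- n\<close> a distance comparable to \<open>1 + \<bar>n\<bar>\<close>, which makes all sums
  of products of two simple fractions absolutely convergent.\<close>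

lemma norm_plus_int_ge:
  fixes z :: complex
  assumes "z \<notin> \<int>"
  obtains c where "c > 0" "\<And>n::int. c * (1 + \<bar>real_of_int n\<bar>) \<le> norm (z + of_int n)"
proof -
  have "open (- (\<int> :: complex set))" by (simp add: closed_Ints open_Compl)
  then obtain d where d: "d > 0" "ball z d \<subseteq> - \<int>" using assms openE by blast
  have far: "d \<le> norm (z + of_int n)" for n :: int
  proof (rule ccontr)
    assume "\<not> d \<le> norm (z + of_int n)"
    then have "of_int (- n) \<in> ball z d" by (simp add: dist_norm)
    moreover have "(of_int (- n) :: complex) \<in> \<int>" by (rule Ints_of_int)
    ultimately show False using d by blast
  qed
  (* 1 + \<bar>n\<bar> \<le> \<bar>z + n\<bar> + (1 + \<bar>z\<bar>), and the bracket is at most (1 + \<bar>z\<bar>) / d times \<bar>z + n\<bar>. *)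
  define K where "K = 1 + (1 + norm z) / d"
  have K: "K > 0" using d by (auto simp: K_def intro!: add_pos_nonneg)
  have "1 + \<bar>real_of_int n\<bar> \<le> K * norm (z + of_int n)" for n :: int
  proof -
    have "\<bar>real_of_int n\<bar> = norm ((z + of_int n) - z)" by simp
    also have "\<dots> \<le> norm (z + of_int n) + norm z" by (rule norm_triangle_ineq4)
    finally have "1 + \<bar>real_of_int n\<bar> \<le> norm (z + of_int n) + (1 + norm z)" by simp
    moreover have "(1 + norm z) / d * d \<le> (1 + norm z) / d * norm (z + of_int n)"
      using d far by (intro mult_left_mono) auto
    moreover have "(1 + norm z) / d * d = 1 + norm z" using d by simp
    moreover have "K * norm (z + of_int n) = norm (z + of_int n) + (1 + norm z) / d * norm (z + of_int n)"
      by (simp only: K_def distrib_right mult_1)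
    ultimately show ?thesis by linarith
  qed
  then show ?thesis using K by (intro that[of "1 / K"]) (auto simp: field_simps)
qed

lemma summable_on_inverse_product:
  fixes z w :: complex
  assumes "z \<notin> \<int>" "w \<notin> \<int>"
  shows "(\<lambda>n::int. 1 / ((z + of_int n) * (w + of_int n))) summable_on UNIV"
proof -
  obtain c d where c: "c > 0" "\<And>n::int. c * (1 + \<bar>real_of_int n\<bar>) \<le> norm (z + of_int n)"
    and d: "d > 0" "\<And>n::int. d * (1 + \<bar>real_of_int n\<bar>) \<le> norm (w + of_int n)"
    using norm_plus_int_ge assms by metis
  show ?thesis
  proof (rule summable_on_dominated[OF summable_on_cmult_right[OF summable_on_int_inverse_square, of "1 / (c * d)"]])
    fix n :: int
    have "(c * (1 + \<bar>real_of_int n\<bar>)) * (d * (1 + \<bar>real_of_int n\<bar>)) \<le> norm (z + of_int n) * norm (w + of_int n)"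
      using c d by (intro mult_mono) auto
    moreover have "0 < (c * (1 + \<bar>real_of_int n\<bar>)) * (d * (1 + \<bar>real_of_int n\<bar>))"
      using c d by (intro mult_pos_pos) auto
    ultimately have "1 / (norm (z + of_int n) * norm (w + of_int n)) \<le> 1 / ((c * (1 + \<bar>real_of_int n\<bar>)) * (d * (1 + \<bar>real_of_int n\<bar>)))"
      by (intro divide_left_mono) auto
    then show "norm (1 / ((z + of_int n) * (w + of_int n))) \<le> 1 / (c * d) * (1 / (1 + \<bar>real_of_int n\<bar>)\<^sup>2)"
      by (simp add: norm_divide norm_mult power2_eq_square mult_ac)
  qed
qed

text \<open>Differences are taken because a single cotangent series does not converge unconditionally.\<close>

lemma cot_diff_has_sum:
  fixes z w :: complex
  assumes "z \<notin> \<int>" "w \<notin> \<int>"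
  shows "((\<lambda>n::int. 1 / (z + of_int n) - 1 / (w + of_int n)) has_sum
           of_real pi * (cot (of_real pi * z) - cot (of_real pi * w))) UNIV"
proof (rule has_sum_int_pair)
  have nonzero: "v + of_int n \<noteq> 0" if "v \<notin> \<int>" for v :: complex and n :: int
  proof
    assume "v + of_int n = 0"
    then have "v = of_int (- n)" by (simp add: eq_neg_iff_add_eq_0)
    also have "\<dots> \<in> \<int>" by (rule Ints_of_int)
    finally show False using that by simp
  qed
  note nz = nonzero[OF assms(1)] nonzero[OF assms(2)]
  have "(\<lambda>n::int. (w - z) * (1 / ((z + of_int n) * (w + of_int n)))) summable_on UNIV"
    by (intro summable_on_cmult_right summable_on_inverse_product assms)
  moreover have "(w - z) * (1 / ((z + of_int n) * (w + of_int n))) = 1 / (z + of_int n) - 1 / (w + of_int n)" for n :: int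
    using nz[of n] by (simp add: field_simps)
  ultimately show "(\<lambda>n::int. 1 / (z + of_int n) - 1 / (w + of_int n)) summable_on UNIV" by simp
  show "(\<lambda>k. 1 / (z + of_int (int k)) - 1 / (w + of_int (int k)) +
      (1 / (z + of_int (- 1 - int k)) - 1 / (w + of_int (- 1 - int k)))) sums
      (of_real pi * (cot (of_real pi * z) - cot (of_real pi * w)))"
    using sums_diff[OF cot_sums[OF assms(1)] cot_sums[OF assms(2)]] by (simp only: add_diff_add right_diff_distrib)
qed

section \<open>The Poisson kernel\<close>

text \<open>Two geometric series, complex conjugate to each other up to the term \<open>j = 0\<close>.\<close>

lemma poisson_kernel_fourier:
  fixes y u :: real
  assumes "y > 0"
  defines "\<zeta> \<equiv> of_real (exp (- 2 * pi * y)) * ee u"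
  shows "((\<lambda>j::int. of_real (exp (- 2 * pi * y * \<bar>of_int j\<bar>)) * ee (of_int j * u)) has_sum
           of_real (Re ((1 + \<zeta>) / (1 - \<zeta>)))) UNIV"
proof -
  let ?f = "\<lambda>j::int. complex_of_real (exp (- 2 * pi * y * \<bar>of_int j\<bar>)) * ee (of_int j * u)"
  have norm: "norm \<zeta> < 1" using assms by (simp add: \<zeta>_def norm_mult)
  then have "\<zeta> \<noteq> 1" by auto
  have hs: "((\<lambda>n. \<zeta> ^ n) has_sum (1 / (1 - \<zeta>))) UNIV"
    using geometric_sums[OF norm] norm summable_geometric[of "norm \<zeta>"]
    by (intro norm_summable_imp_has_sum) (auto simp: norm_power)
  have pos: "?f (int n) = \<zeta> ^ n" for n
    by (simp add: \<zeta>_def power_mult_distrib ee_power mult_ac flip: exp_of_nat_mult of_real_power)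
  have neg: "?f (- 1 - int n) = cnj (\<zeta> * \<zeta> ^ n)" for n
  proof -
    have "- 1 - int n = - int (Suc n)" by simp
    then have "?f (- 1 - int n) = cnj (?f (int (Suc n)))"
      by (simp only: of_int_minus abs_minus_cancel mult_minus_left complex_cnj_mult complex_cnj_complex_of_real cnj_ee)
    also have "\<dots> = cnj (\<zeta> * \<zeta> ^ n)" unfolding pos by simp
    finally show ?thesis .
  qed
  have "((\<lambda>n. cnj (\<zeta> * \<zeta> ^ n)) has_sum cnj (\<zeta> * (1 / (1 - \<zeta>)))) UNIV"
    by (subst has_sum_cnj_iff) (rule has_sum_cmult_right[OF hs])
  with hs have "(?f has_sum (1 / (1 - \<zeta>) + cnj (\<zeta> * (1 / (1 - \<zeta>))))) UNIV"
    by (intro has_sum_int_split) (simp_all only: pos neg)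
  moreover have "1 / (1 - \<zeta>) + cnj (\<zeta> * (1 / (1 - \<zeta>))) = of_real (Re ((1 + \<zeta>) / (1 - \<zeta>)))"
  proof -
    have 1: "\<zeta> * (1 / (1 - \<zeta>)) = 1 / (1 - \<zeta>) - 1" using \<open>\<zeta> \<noteq> 1\<close> by (simp add: field_simps)
    have 2: "(1 + \<zeta>) / (1 - \<zeta>) = 2 * (1 / (1 - \<zeta>)) - 1" using \<open>\<zeta> \<noteq> 1\<close> by (simp add: field_simps)
    have "w + cnj (w - 1) = of_real (Re (2 * w - 1))" for w by (simp add: complex_eq_iff)
    then show ?thesis unfolding 1 2 .
  qed
  ultimately show ?thesis by (simp only:)
qed

text \<open>The Poisson kernel is the imaginary part of \<open>- cot (\<pi> (u + \<i> y))\<close>, so the partial fractions of the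
  cotangent write it as a periodised Cauchy kernel.\<close>

lemma poisson_kernel_partial_fractions:
  assumes "y > 0"
  shows "((\<lambda>n::int. y / ((u + of_int n)\<^sup>2 + y\<^sup>2)) has_sum
     (pi * Re (\<Sum>\<^sub>\<infinity>j::int. of_real (exp (- 2 * pi * y * \<bar>of_int j\<bar>)) * ee (of_int j * u)))) UNIV"
proof -
  define z where "z = Complex u y"
  have "Im z \<noteq> 0" using assms by (simp add: z_def)
  then have z: "z \<notin> \<int>" "cnj z \<notin> \<int>" by (auto simp: complex_is_Int_iff)
  have Im: "Im (1 / (z + of_int n)) = - (y / ((u + of_int n)\<^sup>2 + y\<^sup>2))" for n :: int
    by (simp add: z_def Im_divide)
  have "(\<lambda>n::int. 1 / ((z + of_int n) * (cnj z + of_int n))) summable_on UNIV"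
    by (rule summable_on_inverse_product[OF z])
  moreover have "1 / ((z + of_int n) * (cnj z + of_int n)) = of_real (1 / ((u + of_int n)\<^sup>2 + y\<^sup>2))" for n :: int
  proof -
    have "(z + of_int n) * (cnj z + of_int n) = of_real ((u + of_int n)\<^sup>2 + y\<^sup>2)"
      by (simp add: z_def complex_eq_iff power2_eq_square)
    then show ?thesis by simp
  qed
  ultimately have "(\<lambda>n::int. complex_of_real (1 / ((u + of_int n)\<^sup>2 + y\<^sup>2))) summable_on UNIV" by simp
  from summable_on_cmult_right[OF summable_on_Re[OF this], of y]
  have sm: "(\<lambda>n::int. y / ((u + of_int n)\<^sup>2 + y\<^sup>2)) summable_on UNIV" by simp
  have "(\<lambda>k. - Im (1 / (z + of_int (int k)) + 1 / (z + of_int (- 1 - int k)))) sums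
      (- Im (of_real pi * cot (of_real pi * z)))"
    by (intro sums_minus sums_Im cot_sums z)
  then have "(\<lambda>k. y / ((u + of_int (int k))\<^sup>2 + y\<^sup>2) + y / ((u + of_int (- 1 - int k))\<^sup>2 + y\<^sup>2)) sums
      (- Im (of_real pi * cot (of_real pi * z)))"
    by (simp only: plus_complex.sel Im minus_add_distrib minus_minus)
  from has_sum_int_pair[OF sm this]
  have hs: "((\<lambda>n::int. y / ((u + of_int n)\<^sup>2 + y\<^sup>2)) has_sum (- Im (of_real pi * cot (of_real pi * z)))) UNIV" .
  define \<zeta> where "\<zeta> = of_real (exp (- 2 * pi * y)) * ee u"
  have "norm \<zeta> < 1" using assms by (simp add: \<zeta>_def norm_mult)
  then have "\<zeta> \<noteq> 1" by auto
  define E where "E = exp (\<i> * (of_real pi * z))"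
  have "E\<^sup>2 = exp (2 * (\<i> * (of_real pi * z)))" unfolding E_def by (simp flip: exp_double)
  also have "2 * (\<i> * (of_real pi * z)) = of_real (- 2 * pi * y) + \<i> * of_real (2 * pi * u)"
    by (simp add: z_def complex_eq_iff)
  also have "exp \<dots> = \<zeta>"
    by (simp only: exp_add exp_of_real \<zeta>_def ee_def cis_conv_exp)
  finally have E: "E\<^sup>2 = \<zeta>" "E \<noteq> 0" by (simp_all add: E_def)
  have inv: "exp (- (\<i> * (of_real pi * z))) = inverse E" by (simp add: E_def exp_minus)
  have "cot (of_real pi * z) = \<i> * ((E + inverse E) / (E - inverse E))"
  proof -
    have "(a / 2) / (b / (2 * \<i>)) = \<i> * (a / b)" for a b :: complex by (simp add: field_simps)
    then show ?thesis unfolding cot_def sin_exp_eq cos_exp_eq inv E_def[symmetric] .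
  qed
  also have "(E + inverse E) / (E - inverse E) = (E\<^sup>2 + 1) / (E\<^sup>2 - 1)"
  proof -
    have *: "(E + inverse E) * E = E\<^sup>2 + 1" "(E - inverse E) * E = E\<^sup>2 - 1"
      using E by (simp_all add: power2_eq_square algebra_simps)
    show ?thesis unfolding *[symmetric] using E(2) by simp
  qed
  also have "\<dots> = - ((1 + \<zeta>) / (1 - \<zeta>))" unfolding E(1)
    using \<open>\<zeta> \<noteq> 1\<close> by (simp add: field_simps)
  finally have cot_eq: "cot (of_real pi * z) = \<i> * - ((1 + \<zeta>) / (1 - \<zeta>))" .
  have "- Im (of_real pi * (\<i> * - X)) = pi * Re X" for X by simp
  then have "- Im (of_real pi * cot (of_real pi * z)) = pi * Re ((1 + \<zeta>) / (1 - \<zeta>))"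
    unfolding cot_eq .
  with hs show ?thesis
    using infsumI[OF poisson_kernel_fourier[OF assms, of u]] by (simp add: \<zeta>_def)
qed

section \<open>A positive alternating kernel\<close>

text \<open>Since \<open>cos (\<beta> / 2) = 0\<close>, only the boundary terms in \<open>sin (\<beta> / 2)\<close> survive, and these carry the Cauchy
  kernel \<open>\<beta> / (\<beta>\<^sup>2 + \<kappa>\<^sup>2)\<close>.\<close>

lemma integral_cos_cosh:
  fixes \<beta> \<kappa> :: real
  assumes "cos (\<beta> / 2) = 0" "\<beta> \<noteq> 0"
  shows "integral {- 1/2..1/2} (\<lambda>u. cos (\<beta> * u) * cosh (\<kappa> * u))
       = 2 * cosh (\<kappa> / 2) * (\<beta> * sin (\<beta> / 2) / (\<beta>\<^sup>2 + \<kappa>\<^sup>2))"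
proof -
  define F where "F = (\<lambda>u. (\<beta> * sin (\<beta> * u) * cosh (\<kappa> * u) + \<kappa> * cos (\<beta> * u) * sinh (\<kappa> * u)) / (\<beta>\<^sup>2 + \<kappa>\<^sup>2))"
  have nz: "\<beta>\<^sup>2 + \<kappa>\<^sup>2 \<noteq> 0" using assms(2) by (metis sum_power2_eq_zero_iff)
  have "(F has_field_derivative cos (\<beta> * u) * cosh (\<kappa> * u)) (at u within {- 1/2..1/2})" for u
  proof -
    have "((\<lambda>u. \<beta> * sin (\<beta> * u) * cosh (\<kappa> * u) + \<kappa> * cos (\<beta> * u) * sinh (\<kappa> * u))
        has_field_derivative (\<beta>\<^sup>2 + \<kappa>\<^sup>2) * (cos (\<beta> * u) * cosh (\<kappa> * u))) (at u within {- 1/2..1/2})"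
      by (auto intro!: derivative_eq_intros simp: power2_eq_square algebra_simps)
    from DERIV_cdivide[OF this, of "\<beta>\<^sup>2 + \<kappa>\<^sup>2"]
    have "(F has_field_derivative (\<beta>\<^sup>2 + \<kappa>\<^sup>2) * (cos (\<beta> * u) * cosh (\<kappa> * u)) / (\<beta>\<^sup>2 + \<kappa>\<^sup>2)) (at u within {- 1/2..1/2})"
      unfolding F_def .
    then show ?thesis by (simp only: nonzero_mult_div_cancel_left[OF nz])
  qed
  then have "((\<lambda>u. cos (\<beta> * u) * cosh (\<kappa> * u)) has_integral (F (1/2) - F (- 1/2))) {- 1/2..1/2}"
    by (intro fundamental_theorem_of_calculus) (auto simp: has_real_derivative_iff_has_vector_derivative)
  then show ?thesis using assms(1) by (simp add: integral_unique F_def add_divide_distrib[symmetric])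
qed

text \<open>The positivity of \<open>\<theta>\<^sub>1\<close> in a form whose terms can be integrated against a real weight.\<close>

lemma theta1_cosine_series_nonneg:
  assumes "b > 0" "\<bar>u\<bar> \<le> 1/2"
  shows "0 \<le> (\<Sum>\<^sub>\<infinity>n::int. exp (- pi * b * (of_int n + 1/2)\<^sup>2) * cos ((2 * of_int n + 1) * pi * u))"
proof -
  let ?t = "\<lambda>n::int. complex_of_real (exp (- pi * b * (of_int n + 1/2)\<^sup>2)) * ee ((of_int n + 1/2) * u)"
  have "?t summable_on UNIV"
    by (rule summable_on_dominated[OF summable_on_theta1_coeffs[of b]]) (use assms in \<open>auto simp: norm_mult\<close>)
  then have "infsum (\<lambda>n. Re (?t n)) UNIV = Re (theta1 (of_real u) (\<i> * of_real b))"
    unfolding theta1_imag by (rule infsum_Re)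
  also have "(\<lambda>n. Re (?t n)) = (\<lambda>n. exp (- pi * b * (of_int n + 1/2)\<^sup>2) * cos ((2 * of_int n + 1) * pi * u))"
    by (simp add: ee_def fun_eq_iff algebra_simps)
  finally show ?thesis using theta1_nonneg[OF assms] by (simp add: less_eq_complex_def)
qed

text \<open>Up to a positive factor the series is \<open>\<integral> \<theta>\<^sub>1(u, \<i> b) cosh (\<kappa> u) du\<close> over \<open>\<bar>u\<bar> \<le> 1/2\<close> with
  \<open>\<kappa> = \<pi> \<xi> / \<eta>\<close>. The terms alternate and need not decrease, so positivity has to come from the
  theta function.\<close>

lemma alternating_cauchy_nonneg:
  assumes "b > 0" "\<eta> > 0"
  shows "0 \<le> (\<Sum>\<^sub>\<infinity>s::nat. (- 1) ^ s * exp (- pi * b * (real s + 1/2)\<^sup>2) *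
            ((2 * real s + 1) * \<eta> / (\<xi>\<^sup>2 + ((2 * real s + 1) * \<eta>)\<^sup>2)))" (is "0 \<le> infsum ?g UNIV")
proof -
  define \<kappa> where "\<kappa> = pi * \<xi> / \<eta>"
  define \<alpha> where "\<alpha> = (\<lambda>n::int. exp (- pi * b * (of_int n + 1/2)\<^sup>2))"
  define \<beta> where "\<beta> = (\<lambda>n::int. (2 * of_int n + 1) * pi)"
  define t where "t = (\<lambda>n::int. \<alpha> n * (2 * cosh (\<kappa> / 2) * (\<beta> n * cos (pi * of_int n) / ((\<beta> n)\<^sup>2 + \<kappa>\<^sup>2))))"
  have \<alpha>_sum: "\<alpha> summable_on UNIV" unfolding \<alpha>_def by (rule summable_on_theta1_coeffs[OF assms(1)])
  have cosh_le: "\<bar>cosh (\<kappa> * u)\<bar> \<le> cosh \<kappa>" if "u \<in> {- 1/2..1/2}" for u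
  proof -
    have "\<bar>\<kappa> * u\<bar> \<le> \<bar>\<kappa>\<bar>" using that by (auto simp: abs_mult intro!: mult_left_le)
    then have "cosh \<bar>\<kappa> * u\<bar> \<le> cosh \<bar>\<kappa>\<bar>" by (intro cosh_real_nonneg_le_iff[THEN iffD2]) auto
    then show ?thesis by simp
  qed
  have bound: "norm (\<alpha> n * cos (\<beta> n * u) * cosh (\<kappa> * u)) \<le> \<alpha> n * cosh \<kappa>" if "u \<in> {- 1/2..1/2}" for n u
  proof -
    have "\<alpha> n * \<bar>cos (\<beta> n * u)\<bar> * \<bar>cosh (\<kappa> * u)\<bar> \<le> \<alpha> n * 1 * cosh \<kappa>"
      using cosh_le[OF that] by (intro mult_mono) (auto simp: \<alpha>_def)
    then show ?thesis by (simp add: abs_mult \<alpha>_def)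
  qed
  have "((\<lambda>n. integral {- 1/2..1/2} (\<lambda>u. \<alpha> n * cos (\<beta> n * u) * cosh (\<kappa> * u))) has_sum
      integral {- 1/2..1/2} (\<lambda>u. \<Sum>\<^sub>\<infinity>n. \<alpha> n * cos (\<beta> n * u) * cosh (\<kappa> * u))) UNIV"
    by (rule has_sum_integral[OF _ bound summable_on_cmult_left[OF \<alpha>_sum]]) (auto intro!: continuous_intros)
  moreover have "integral {- 1/2..1/2} (\<lambda>u. \<alpha> n * cos (\<beta> n * u) * cosh (\<kappa> * u)) = t n" for n
  proof -
    have half: "\<beta> n / 2 = pi * of_int n + pi / 2" by (simp add: \<beta>_def algebra_simps)
    have sin0: "sin (pi * of_int n) = 0" using sin_npi_int[of n] by (simp add: mult.commute)
    have c: "cos (\<beta> n / 2) = 0" "sin (\<beta> n / 2) = cos (pi * of_int n)"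
      unfolding half by (simp_all add: cos_add sin_add sin0)
    have "2 * of_int n + 1 \<noteq> (0 :: real)"
    proof
      assume "2 * of_int n + 1 = (0 :: real)"
      then have "of_int (2 * n + 1) = (of_int 0 :: real)" by simp
      then have "2 * n + 1 = 0" by (simp only: of_int_eq_iff)
      then show False by presburger
    qed
    then have nz: "\<beta> n \<noteq> 0" by (simp add: \<beta>_def)
    show ?thesis
      using integral_cos_cosh[OF c(1) nz, of \<kappa>] by (simp add: mult.assoc t_def c(2))
  qed
  moreover have "0 \<le> integral {- 1/2..1/2} (\<lambda>u. \<Sum>\<^sub>\<infinity>n. \<alpha> n * cos (\<beta> n * u) * cosh (\<kappa> * u))"
  proof (rule integral_nonneg)
    fix u :: real assume "u \<in> {- 1/2..1/2}"
    then have "\<bar>u\<bar> \<le> 1/2" by auto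
    then have "0 \<le> (\<Sum>\<^sub>\<infinity>n. \<alpha> n * cos (\<beta> n * u)) * cosh (\<kappa> * u)"
      using theta1_cosine_series_nonneg[OF assms(1), of u] by (intro mult_nonneg_nonneg) (auto simp: \<alpha>_def \<beta>_def)
    then show "0 \<le> (\<Sum>\<^sub>\<infinity>n. \<alpha> n * cos (\<beta> n * u) * cosh (\<kappa> * u))"
      by (simp only: infsum_cmult_left')
  next
    have "continuous_on {- 1/2..1/2} (\<lambda>u. \<Sum>\<^sub>\<infinity>n. \<alpha> n * cos (\<beta> n * u) * cosh (\<kappa> * u))"
      by (rule continuous_on_infsum[OF _ bound summable_on_cmult_left[OF \<alpha>_sum]]) (auto intro!: continuous_intros)
    then show "(\<lambda>u. \<Sum>\<^sub>\<infinity>n. \<alpha> n * cos (\<beta> n * u) * cosh (\<kappa> * u)) integrable_on {- 1/2..1/2}"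
      by (rule integrable_continuous_real)
  qed
  ultimately obtain S where S: "(t has_sum S) UNIV" "0 \<le> S" by auto
  have sym: "t (- 1 - n) = t n" for n
  proof -
    have "\<beta> (- 1 - n) = - \<beta> n" by (simp add: \<beta>_def algebra_simps)
    moreover have "\<alpha> (- 1 - n) = \<alpha> n"
    proof -
      have "of_int (- 1 - n) + 1/2 = - (of_int n + 1/2 :: real)" by simp
      then show ?thesis unfolding \<alpha>_def by (simp only: power2_minus)
    qed
    moreover have "cos (pi * of_int (- 1 - n)) = - cos (pi * of_int n)"
    proof -
      have "pi * of_int (- 1 - n) = - (pi * of_int n + pi)" by (simp add: algebra_simps)
      then show ?thesis by (simp only: cos_minus cos_periodic_pi)
    qed
    ultimately show ?thesis by (simp add: t_def)
  qed
  (* The positive factor between the integral and the alternating series; the terms n and - 1 - n coincide. *)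
  define C where "C = 4 * cosh (\<kappa> / 2) * (\<eta> / pi)"
  have C: "C > 0" using assms by (simp add: C_def)
  have "((\<lambda>k::nat. t (int k) + t (- 1 - int k)) has_sum S) UNIV"
    using has_sum_int_fold[of t] S by (auto simp: has_sum_iff)
  moreover have "t (int k) + t (- 1 - int k) = C * ?g k" for k
  proof -
    define m where "m = 2 * real k + 1"
    have m: "m > 0" by (simp add: m_def)
    have "cos (pi * real k) = (- 1) ^ k" using cos_npi2[of k] by simp
    moreover have "\<beta> (int k) = m * pi" by (simp add: \<beta>_def m_def)
    moreover have "m * pi / ((m * pi)\<^sup>2 + \<kappa>\<^sup>2) = \<eta> / pi * (m * \<eta> / (\<xi>\<^sup>2 + (m * \<eta>)\<^sup>2))"
    proof -
      have "\<xi>\<^sup>2 + (m * \<eta>)\<^sup>2 > 0"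
        using m assms by (intro add_nonneg_pos zero_less_power mult_pos_pos zero_le_power2)
      moreover have "(m * pi)\<^sup>2 + \<kappa>\<^sup>2 = (pi / \<eta>)\<^sup>2 * (\<xi>\<^sup>2 + (m * \<eta>)\<^sup>2)"
        using assms by (simp add: \<kappa>_def power_mult_distrib power_divide field_simps)
      moreover have "m * pi / ((pi / \<eta>)\<^sup>2 * X) = \<eta> / pi * (m * \<eta> / X)" if "X > 0" for X
        using assms that by (simp add: field_simps power2_eq_square)
      ultimately show ?thesis by simp
    qed
    ultimately have "\<beta> (int k) / ((\<beta> (int k))\<^sup>2 + \<kappa>\<^sup>2) = \<eta> / pi * (m * \<eta> / (\<xi>\<^sup>2 + (m * \<eta>)\<^sup>2))" by simp
    moreover have "\<beta> (int k) * cos (pi * of_int (int k)) / ((\<beta> (int k))\<^sup>2 + \<kappa>\<^sup>2)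
        = (- 1) ^ k * (\<beta> (int k) / ((\<beta> (int k))\<^sup>2 + \<kappa>\<^sup>2))"
      using \<open>cos (pi * real k) = (- 1) ^ k\<close> by simp
    ultimately have "t (int k) = \<alpha> (int k) * (2 * cosh (\<kappa> / 2) * ((- 1) ^ k * (\<eta> / pi * (m * \<eta> / (\<xi>\<^sup>2 + (m * \<eta>)\<^sup>2)))))"
      by (simp only: t_def)
    then show ?thesis unfolding sym C_def by (simp add: \<alpha>_def m_def)
  qed
  ultimately have "((\<lambda>k. C * ?g k) has_sum S) UNIV" by (simp only:)
  then have "(\<Sum>\<^sub>\<infinity>k. C * ?g k) = S" by (rule infsumI)
  then have "C * infsum ?g UNIV = S" by (simp only: infsum_cmult_right')
  with S(2) have "0 \<le> C * infsum ?g UNIV" by simp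
  with C show ?thesis by (simp add: zero_le_mult_iff)
qed

text \<open>The Fourier coefficients of \<open>\<Sum>\<^sub>s (- 1) ^ s exp (- \<pi> b (s + 1/2)\<^sup>2) P\<^sub>s\<close>, where \<open>P\<^sub>s\<close> is the Poisson
  kernel of radius \<open>exp (- 2 \<pi> (2 s + 1) \<eta>)\<close>.\<close>

definition alt_coeff :: "real \<Rightarrow> real \<Rightarrow> int \<Rightarrow> real" where
  "alt_coeff b \<eta> j = (\<Sum>\<^sub>\<infinity>s::nat. (- 1) ^ s * exp (- pi * b * (real s + 1/2)\<^sup>2) *
      exp (- 2 * pi * ((2 * real s + 1) * \<eta>) * \<bar>of_int j\<bar>))"

lemma summable_on_half_gauss:
  assumes "b > 0"
  shows "(\<lambda>s::nat. (2 * real s + 1) * exp (- pi * b * (real s + 1/2)\<^sup>2)) summable_on UNIV"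
    and "(\<lambda>s::nat. exp (- pi * b * (real s + 1/2)\<^sup>2)) summable_on UNIV"
proof -
  have *: "(\<lambda>s::nat. 2 * ((1 + real s) ^ 1 * exp (- (pi * b) * (real s)\<^sup>2))) summable_on UNIV"
    using assms by (intro summable_on_cmult_right summable_on_nat_gauss) simp
  have le: "exp (- pi * b * (real s + 1/2)\<^sup>2) \<le> exp (- (pi * b) * (real s)\<^sup>2)" for s
    using assms by (auto intro!: mult_left_mono power_mono)
  show 1: "(\<lambda>s::nat. (2 * real s + 1) * exp (- pi * b * (real s + 1/2)\<^sup>2)) summable_on UNIV"
  proof (rule summable_on_dominated[OF *])
    fix s :: nat
    have "(2 * real s + 1) * exp (- pi * b * (real s + 1/2)\<^sup>2) \<le> (2 * (1 + real s)) * exp (- (pi * b) * (real s)\<^sup>2)"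
      by (intro mult_mono le) auto
    also have "\<dots> = 2 * ((1 + real s) ^ 1 * exp (- (pi * b) * (real s)\<^sup>2))" by simp
    finally show "norm ((2 * real s + 1) * exp (- pi * b * (real s + 1/2)\<^sup>2)) \<le> 2 * ((1 + real s) ^ 1 * exp (- (pi * b) * (real s)\<^sup>2))"
      by simp
  qed
  show "(\<lambda>s::nat. exp (- pi * b * (real s + 1/2)\<^sup>2)) summable_on UNIV"
    by (rule summable_on_dominated[OF 1]) simp
qed

lemma alt_coeff_summand_bound:
  assumes "\<eta> > 0"
  shows "\<bar>(- 1) ^ s * exp (- pi * b * (real s + 1/2)\<^sup>2) * exp (- 2 * pi * ((2 * real s + 1) * \<eta>) * \<bar>real_of_int j\<bar>)\<bar>
    \<le> exp (- pi * b * (real s + 1/2)\<^sup>2) * exp (- (2 * pi * \<eta>) * \<bar>real_of_int j\<bar>)"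
proof -
  have "1 * (2 * pi * \<eta> * \<bar>real_of_int j\<bar>) \<le> (2 * real s + 1) * (2 * pi * \<eta> * \<bar>real_of_int j\<bar>)"
    using assms by (intro mult_right_mono) auto
  then have "exp (- 2 * pi * ((2 * real s + 1) * \<eta>) * \<bar>real_of_int j\<bar>) \<le> exp (- (2 * pi * \<eta>) * \<bar>real_of_int j\<bar>)"
    by (simp add: algebra_simps)
  then show ?thesis by (simp add: abs_mult)
qed

lemma summable_on_alt_coeff:
  assumes "b > 0" "\<eta> > 0"
  shows "(\<lambda>j. \<bar>alt_coeff b \<eta> j\<bar>) summable_on UNIV"
proof -
  have "(\<lambda>j::int. (\<Sum>\<^sub>\<infinity>s::nat. exp (- pi * b * (real s + 1/2)\<^sup>2)) * exp (- (2 * pi * \<eta>) * \<bar>of_int j\<bar>)) summable_on UNIV"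
    using assms by (intro summable_on_cmult_right summable_on_int_exp_abs) auto
  then show ?thesis
  proof (rule summable_on_dominated)
    fix j :: int
    have "norm (alt_coeff b \<eta> j) \<le> (\<Sum>\<^sub>\<infinity>s::nat. exp (- pi * b * (real s + 1/2)\<^sup>2) * exp (- (2 * pi * \<eta>) * \<bar>of_int j\<bar>))"
      unfolding alt_coeff_def
      using alt_coeff_summand_bound[OF assms(2)] summable_on_half_gauss[OF assms(1)]
      by (intro norm_infsum_le[OF has_sum_infsum has_sum_infsum] summable_on_cmult_left
            summable_on_dominated[OF summable_on_cmult_left[OF summable_on_half_gauss(2)[OF assms(1)]]]) auto
    then show "norm \<bar>alt_coeff b \<eta> j\<bar> \<le> (\<Sum>\<^sub>\<infinity>s::nat. exp (- pi * b * (real s + 1/2)\<^sup>2)) * exp (- (2 * pi * \<eta>) * \<bar>of_int j\<bar>)"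
      by (simp only: infsum_cmult_left' real_norm_def abs_idempotent)
  qed
qed

text \<open>The series is an alternating combination of Poisson kernels at the heights \<open>(2 s + 1) \<eta>\<close>. With
  each kernel written as a periodised Cauchy kernel, exchanging the sums leaves the periodisation
  of the alternating Cauchy series, which is nonnegative.\<close>

lemma alt_coeff_series_nonneg:
  assumes "b > 0" "\<eta> > 0"
  shows "0 \<le> (\<Sum>\<^sub>\<infinity>j::int. of_real (alt_coeff b \<eta> j) * ee (of_int j * u))"
proof -
  define \<alpha> where "\<alpha> = (\<lambda>s::nat. exp (- pi * b * (real s + 1/2)\<^sup>2))"
  define y where "y = (\<lambda>s::nat. (2 * real s + 1) * \<eta>)"
  define g where "g = (\<lambda>s (n::int). (- 1) ^ s * \<alpha> s * (y s / ((u + of_int n)\<^sup>2 + (y s)\<^sup>2)))"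
  have y: "y s > 0" "y s \<ge> \<eta>" for s
  proof -
    have "1 * \<eta> \<le> y s" unfolding y_def using assms by (intro mult_right_mono) auto
    then show "y s \<ge> \<eta>" "y s > 0" using assms by auto
  qed
  have "(\<Sum>\<^sub>\<infinity>j::int. of_real (alt_coeff b \<eta> j) * ee (of_int j * u))
      = (\<Sum>\<^sub>\<infinity>j::int. \<Sum>\<^sub>\<infinity>s::nat. complex_of_real ((- 1) ^ s * \<alpha> s * exp (- 2 * pi * y s * \<bar>of_int j\<bar>)) * ee (of_int j * u))"
  proof (rule infsum_cong)
    fix j :: int
    have "(\<lambda>s. (- 1) ^ s * \<alpha> s * exp (- 2 * pi * y s * \<bar>of_int j\<bar>)) summable_on UNIV"
      using alt_coeff_summand_bound[OF assms(2)]
      by (intro summable_on_dominated[OF summable_on_cmult_left[OF summable_on_half_gauss(2)[OF assms(1)]]])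
         (auto simp: \<alpha>_def y_def)
    then have "((\<lambda>s. (- 1) ^ s * \<alpha> s * exp (- 2 * pi * y s * \<bar>of_int j\<bar>)) has_sum alt_coeff b \<eta> j) UNIV"
      unfolding alt_coeff_def \<alpha>_def y_def by (rule has_sum_infsum)
    from has_sum_cmult_left[OF has_sum_of_real[OF this], of "ee (of_int j * u)"]
    show "of_real (alt_coeff b \<eta> j) * ee (of_int j * u)
      = (\<Sum>\<^sub>\<infinity>s::nat. complex_of_real ((- 1) ^ s * \<alpha> s * exp (- 2 * pi * y s * \<bar>of_int j\<bar>)) * ee (of_int j * u))"
      by (rule infsumI[symmetric])
  qed
  also have "\<dots> = (\<Sum>\<^sub>\<infinity>s::nat. \<Sum>\<^sub>\<infinity>j::int. complex_of_real ((- 1) ^ s * \<alpha> s * exp (- 2 * pi * y s * \<bar>of_int j\<bar>)) * ee (of_int j * u))"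
  proof (rule infsum_swap_bound[OF summable_on_int_exp_abs summable_on_half_gauss(2)[OF assms(1)]])
    fix j :: int and s :: nat
    show "norm (complex_of_real ((- 1) ^ s * \<alpha> s * exp (- 2 * pi * y s * \<bar>of_int j\<bar>)) * ee (of_int j * u))
      \<le> exp (- (2 * pi * \<eta>) * \<bar>of_int j\<bar>) * exp (- pi * b * (real s + 1/2)\<^sup>2)"
      using alt_coeff_summand_bound[OF assms(2), of s b j]
      by (simp only: norm_mult norm_ee norm_of_real \<alpha>_def y_def mult.right_neutral mult.commute)
  qed (use assms in auto)
  also have "\<dots> = (\<Sum>\<^sub>\<infinity>s::nat. complex_of_real ((1 / pi) * (\<Sum>\<^sub>\<infinity>n. g s n)))"
  proof (rule infsum_cong)
    fix s :: nat
    let ?P = "\<Sum>\<^sub>\<infinity>j::int. complex_of_real (exp (- 2 * pi * y s * \<bar>of_int j\<bar>)) * ee (of_int j * u)"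
    have re: "?P = of_real (Re ?P)" using infsumI[OF poisson_kernel_fourier[OF y(1), of s u]] by simp
    have "(\<Sum>\<^sub>\<infinity>n. g s n) = (- 1) ^ s * \<alpha> s * (pi * Re ?P)"
      unfolding g_def infsum_cmult_right' infsumI[OF poisson_kernel_partial_fractions[OF y(1)]] ..
    then have "complex_of_real ((1 / pi) * (\<Sum>\<^sub>\<infinity>n. g s n)) = complex_of_real ((- 1) ^ s * \<alpha> s) * of_real (Re ?P)" by simp
    also have "\<dots> = complex_of_real ((- 1) ^ s * \<alpha> s) * ?P" by (simp only: re[symmetric])
    also have "\<dots> = (\<Sum>\<^sub>\<infinity>j::int. complex_of_real ((- 1) ^ s * \<alpha> s) * (complex_of_real (exp (- 2 * pi * y s * \<bar>of_int j\<bar>)) * ee (of_int j * u)))"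
      by (simp only: infsum_cmult_right')
    finally show "(\<Sum>\<^sub>\<infinity>j::int. complex_of_real ((- 1) ^ s * \<alpha> s * exp (- 2 * pi * y s * \<bar>of_int j\<bar>)) * ee (of_int j * u))
        = complex_of_real ((1 / pi) * (\<Sum>\<^sub>\<infinity>n. g s n))"
      by (simp only: of_real_mult mult.assoc)
  qed
  also have "\<dots> = complex_of_real (\<Sum>\<^sub>\<infinity>s::nat. (1 / pi) * (\<Sum>\<^sub>\<infinity>n. g s n))"
    by (simp only: infsum_of_real)
  also have "(\<Sum>\<^sub>\<infinity>s::nat. (1 / pi) * (\<Sum>\<^sub>\<infinity>n. g s n)) = (1 / pi) * (\<Sum>\<^sub>\<infinity>n. \<Sum>\<^sub>\<infinity>s. g s n)"
  proof -
    have "(\<Sum>\<^sub>\<infinity>s. \<Sum>\<^sub>\<infinity>n. g s n) = (\<Sum>\<^sub>\<infinity>n. \<Sum>\<^sub>\<infinity>s. g s n)"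
    proof (rule infsum_swap_bound[OF summable_on_half_gauss(1)[OF assms(1)]
          has_sum_imp_summable[OF poisson_kernel_partial_fractions[OF assms(2), of u]]])
      fix s :: nat and n :: int
      have "y s / ((u + of_int n)\<^sup>2 + (y s)\<^sup>2) \<le> y s / ((u + of_int n)\<^sup>2 + \<eta>\<^sup>2)"
        using y[of s] assms by (intro divide_left_mono add_left_mono power_mono mult_pos_pos add_nonneg_pos) auto
      then have "\<alpha> s * (y s / ((u + of_int n)\<^sup>2 + (y s)\<^sup>2)) \<le> \<alpha> s * (y s / ((u + of_int n)\<^sup>2 + \<eta>\<^sup>2))"
        by (intro mult_left_mono) (auto simp: \<alpha>_def)
      also have "\<dots> = (2 * real s + 1) * exp (- pi * b * (real s + 1/2)\<^sup>2) * (\<eta> / ((u + of_int n)\<^sup>2 + \<eta>\<^sup>2))"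
        by (simp add: \<alpha>_def y_def)
      finally show "norm (g s n) \<le> (2 * real s + 1) * exp (- pi * b * (real s + 1/2)\<^sup>2) * (\<eta> / ((u + of_int n)\<^sup>2 + \<eta>\<^sup>2))"
        using y[of s] by (simp add: g_def abs_mult \<alpha>_def)
    qed (use assms in auto)
    then show ?thesis by (simp only: infsum_cmult_right')
  qed
  finally have *: "(\<Sum>\<^sub>\<infinity>j::int. of_real (alt_coeff b \<eta> j) * ee (of_int j * u)) = complex_of_real ((1 / pi) * (\<Sum>\<^sub>\<infinity>n. \<Sum>\<^sub>\<infinity>s. g s n))" .
  have "0 \<le> (\<Sum>\<^sub>\<infinity>n. \<Sum>\<^sub>\<infinity>s. g s n)"
    unfolding g_def \<alpha>_def y_def by (intro infsum_nonneg alternating_cauchy_nonneg assms)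
  then show ?thesis unfolding * by (simp add: less_eq_complex_def)
qed

section \<open>Coefficientwise products of nonnegative Fourier series\<close>

lemma fourier_coefficient_of_series:
  fixes b :: "int \<Rightarrow> real"
  assumes "(\<lambda>j. \<bar>b j\<bar>) summable_on UNIV"
  shows "integral {0..1} (\<lambda>u. ee (of_int j * u) * (\<Sum>\<^sub>\<infinity>n::int. of_real (b n) * ee (of_int n * (x - u))))
     = of_real (b j) * ee (of_int j * x)"
proof -
  have "((\<lambda>n. integral {0..1} (\<lambda>u. ee (of_int j * u) * (of_real (b n) * ee (of_int n * (x - u))))) has_sum
      integral {0..1} (\<lambda>u. \<Sum>\<^sub>\<infinity>n::int. ee (of_int j * u) * (of_real (b n) * ee (of_int n * (x - u))))) UNIV"
    by (rule has_sum_integral[OF _ _ assms]) (auto intro!: continuous_intros simp: norm_mult)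
  also have "(\<lambda>n. integral {0..1} (\<lambda>u. ee (of_int j * u) * (of_real (b n) * ee (of_int n * (x - u)))))
      = (\<lambda>n. if n = j then of_real (b j) * ee (of_int j * x) else 0)"
  proof
    fix n :: int
    have "(\<lambda>u. ee (of_int j * u) * (complex_of_real (b n) * ee (of_int n * (x - u))))
        = (\<lambda>u. of_real (b n) * ee (of_int n * x) * ee (of_int (j - n) * u))"
    proof
      fix u
      have "ee (of_int j * u) * ee (of_int n * (x - u)) = ee (of_int n * x) * ee (of_int (j - n) * u)"
        by (simp flip: ee_add add: algebra_simps)
      then show "ee (of_int j * u) * (complex_of_real (b n) * ee (of_int n * (x - u)))
          = of_real (b n) * ee (of_int n * x) * ee (of_int (j - n) * u)" by (simp add: mult_ac)
    qed
    then show "integral {0..1} (\<lambda>u. ee (of_int j * u) * (complex_of_real (b n) * ee (of_int n * (x - u))))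
        = (if n = j then of_real (b j) * ee (of_int j * x) else 0)"
      by (simp only: integral_mult_right integral_ee) auto
  qed
  finally have "((\<lambda>n. if n = j then of_real (b j) * ee (of_int j * x) else 0) has_sum
      integral {0..1} (\<lambda>u. ee (of_int j * u) * (\<Sum>\<^sub>\<infinity>n::int. of_real (b n) * ee (of_int n * (x - u))))) UNIV"
    by (simp only: infsum_cmult_right')
  moreover have "((\<lambda>n. if n = j then of_real (b j) * ee (of_int j * x) else 0) has_sum of_real (b j) * ee (of_int j * x)) UNIV"
    by (rule has_sum_finite_neutralI[of "{j}"]) auto
  ultimately show ?thesis using has_sum_unique by blast
qed

text \<open>Multiplying Fourier coefficients convolves the functions, and a convolution of nonnegative
  functions is nonnegative.\<close>

lemma hadamard_product_nonneg:
  fixes a b :: "int \<Rightarrow> real"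
  assumes a: "(\<lambda>j. \<bar>a j\<bar>) summable_on UNIV" "\<And>x. 0 \<le> (\<Sum>\<^sub>\<infinity>j::int. of_real (a j) * ee (of_int j * x))"
    and b: "(\<lambda>j. \<bar>b j\<bar>) summable_on UNIV" "\<And>x. 0 \<le> (\<Sum>\<^sub>\<infinity>j::int. of_real (b j) * ee (of_int j * x))"
  shows "0 \<le> (\<Sum>\<^sub>\<infinity>j::int. of_real (a j * b j) * ee (of_int j * x))"
proof -
  define f where "f = (\<lambda>u. \<Sum>\<^sub>\<infinity>j::int. of_real (a j) * ee (of_int j * u))"
  define g where "g = (\<lambda>u. \<Sum>\<^sub>\<infinity>j::int. of_real (b j) * ee (of_int j * (x - u)))"
  define B where "B = (\<Sum>\<^sub>\<infinity>j. \<bar>b j\<bar>)"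
  have f_cont: "continuous_on S f" for S
    unfolding f_def by (rule continuous_on_infsum[OF _ _ a(1)]) (auto intro!: continuous_intros simp: norm_mult)
  have g_cont: "continuous_on S g" for S
    unfolding g_def by (rule continuous_on_infsum[OF _ _ b(1)]) (auto intro!: continuous_intros simp: norm_mult)
  have gB: "norm (g u) \<le> B" for u
    unfolding g_def B_def
    by (intro norm_infsum_le[OF has_sum_infsum has_sum_infsum] summable_on_dominated[OF b(1)] b(1))
       (auto simp: norm_mult)
  have "((\<lambda>j. integral {0..1} (\<lambda>u. of_real (a j) * (ee (of_int j * u) * g u))) has_sum
      integral {0..1} (\<lambda>u. \<Sum>\<^sub>\<infinity>j. of_real (a j) * (ee (of_int j * u) * g u))) UNIV"
    by (rule has_sum_integral[OF _ _ summable_on_cmult_left[OF a(1), of B]])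
       (auto intro!: continuous_intros g_cont simp: norm_mult mult_left_mono gB)
  also have "(\<lambda>j. integral {0..1} (\<lambda>u. of_real (a j) * (ee (of_int j * u) * g u)))
      = (\<lambda>j. of_real (a j * b j) * ee (of_int j * x))"
    by (simp add: integral_mult_right g_def fourier_coefficient_of_series[OF b(1)] mult.assoc)
  also have "(\<lambda>u. \<Sum>\<^sub>\<infinity>j. of_real (a j) * (ee (of_int j * u) * g u)) = (\<lambda>u. f u * g u)"
    unfolding f_def mult.assoc[symmetric] infsum_cmult_left' ..
  finally have "(\<Sum>\<^sub>\<infinity>j::int. of_real (a j * b j) * ee (of_int j * x)) = integral {0..1} (\<lambda>u. f u * g u)"
    by (rule infsumI)
  also have "0 \<le> \<dots>"
    using a(2) b(2) by (intro integral_nonneg_complex continuous_intros f_cont g_cont)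
      (auto simp: f_def g_def intro!: mult_nonneg_nonneg)
  finally show ?thesis .
qed

section \<open>The interpolating polynomial and the sign of the error\<close>

text \<open>The Fourier coefficients of \<open>\<theta>\<^sub>3(x, \<i> / l)\<close>, for real arguments so that they can be shifted by
  multiples of \<open>h\<close>.\<close>

definition gauss_coeff :: "real \<Rightarrow> real \<Rightarrow> real" where
  "gauss_coeff l t = exp (- pi * (1 / l) * t\<^sup>2)"

text \<open>At a zero of \<open>cos (2 \<pi> h x)\<close> the characters of frequency \<open>j\<close> and \<open>j + 2 h\<close> take opposite values, so
  there the Fourier series of \<open>\<theta>\<^sub>3\<close> folds to these alternating sums.\<close>

definition alias_coeff :: "real \<Rightarrow> nat \<Rightarrow> int \<Rightarrow> real" where
  "alias_coeff l h j = (\<Sum>\<^sub>\<infinity>r::int. (if even r then 1 else - 1) * gauss_coeff l (of_int j + 2 * real h * of_int r))"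

definition interp_poly :: "real \<Rightarrow> nat \<Rightarrow> real \<Rightarrow> complex" where
  "interp_poly l h x = (\<Sum>j = - (int h - 1)..int h - 1. of_real (alias_coeff l h j) * ee (of_int j * x))"

text \<open>The Fourier coefficients of the error of interpolation divided by \<open>2 cos (2 \<pi> h x)\<close>.\<close>

definition error_coeff :: "real \<Rightarrow> nat \<Rightarrow> int \<Rightarrow> real" where
  "error_coeff l h j = gauss_coeff l (of_int j) * alt_coeff (4 * (real h)\<^sup>2 / l) (real h / l) j"

lemma theta3_gauss_coeff:
  "theta3 (of_real x) (\<i> * of_real (1 / l)) = (\<Sum>\<^sub>\<infinity>n::int. of_real (gauss_coeff l (of_int n)) * ee (of_int n * x))"
  by (simp only: theta3_imag gauss_coeff_def)

lemma summable_on_gauss_coeff: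
  assumes "l > 0"
  shows "(\<lambda>n::int. gauss_coeff l (of_int n)) summable_on UNIV"
  using summable_on_theta3_coeffs[of "1 / l"] assms by (simp add: gauss_coeff_def)

lemma gauss_coeff_even: "gauss_coeff l (- t) = gauss_coeff l t"
  by (simp add: gauss_coeff_def)

lemma gauss_coeff_pos: "gauss_coeff l t > 0" by (simp add: gauss_coeff_def)

text \<open>The coefficients are those of \<open>\<theta>\<^sub>3\<close>, which is nonnegative, times those of the alternating
  kernel.\<close>

lemma error_series_nonneg:
  assumes "l > 0" "h > 0"
  shows "0 \<le> (\<Sum>\<^sub>\<infinity>j::int. of_real (error_coeff l h j) * ee (of_int j * x))"
  unfolding error_coeff_def
proof (rule hadamard_product_nonneg)
  show "(\<lambda>j::int. \<bar>gauss_coeff l (of_int j)\<bar>) summable_on UNIV"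
    using summable_on_gauss_coeff[OF assms(1)] by (simp add: gauss_coeff_def)
  show "0 \<le> (\<Sum>\<^sub>\<infinity>j::int. of_real (gauss_coeff l (of_int j)) * ee (of_int j * x))" for x
    using theta3_nonneg[OF assms(1)] by (simp only: theta3_gauss_coeff)
  have pos: "4 * (real h)\<^sup>2 / l > 0" "real h / l > 0" using assms by auto
  show "(\<lambda>j. \<bar>alt_coeff (4 * (real h)\<^sup>2 / l) (real h / l) j\<bar>) summable_on UNIV"
    by (rule summable_on_alt_coeff[OF pos])
  show "0 \<le> (\<Sum>\<^sub>\<infinity>j::int. of_real (alt_coeff (4 * (real h)\<^sup>2 / l) (real h / l) j) * ee (of_int j * x))" for x
    by (rule alt_coeff_series_nonneg[OF pos])
qed

lemma summable_on_error_coeff: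
  assumes "l > 0" "h > 0"
  shows "(\<lambda>j. \<bar>error_coeff l h j\<bar>) summable_on UNIV"
proof -
  have "4 * (real h)\<^sup>2 / l > 0" "real h / l > 0" using assms by auto
  from summable_on_alt_coeff[OF this] show ?thesis
  proof (rule summable_on_dominated)
    fix j :: int
    have "gauss_coeff l (of_int j) \<le> 1" using assms by (simp add: gauss_coeff_def)
    then show "norm \<bar>error_coeff l h j\<bar> \<le> \<bar>alt_coeff (4 * (real h)\<^sup>2 / l) (real h / l) j\<bar>"
      using gauss_coeff_pos[of l "of_int j"] by (simp add: error_coeff_def abs_mult mult_left_le_one_le)
  qed
qed

text \<open>Completing the square: the Gaussian factor at \<open>j\<close> and the exponential decay of the Poisson
  kernels combine to Gaussians at \<open>\<bar>j\<bar> + (2 s + 1) h\<close>. This is why \<open>b\<close> and \<open>\<eta>\<close> are chosen as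
  \<open>4 h\<^sup>2 / l\<close> and \<open>h / l\<close>.\<close>

lemma error_coeff_has_sum:
  assumes "l > 0" "h > 0"
  shows "((\<lambda>s::nat. (- 1) ^ s * gauss_coeff l (\<bar>of_int j\<bar> + (2 * real s + 1) * real h)) has_sum error_coeff l h j) UNIV"
proof -
  define b where "b = 4 * (real h)\<^sup>2 / l"
  define \<eta> where "\<eta> = real h / l"
  have pos: "b > 0" "\<eta> > 0" using assms by (auto simp: b_def \<eta>_def)
  let ?f = "\<lambda>s::nat. (- 1) ^ s * exp (- pi * b * (real s + 1/2)\<^sup>2) * exp (- 2 * pi * ((2 * real s + 1) * \<eta>) * \<bar>of_int j\<bar>)"
  have "?f summable_on UNIV"
    using alt_coeff_summand_bound[OF pos(2)]
    by (intro summable_on_dominated[OF summable_on_cmult_left[OF summable_on_half_gauss(2)[OF pos(1)]]]) auto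
  then have "(?f has_sum alt_coeff b \<eta> j) UNIV" unfolding alt_coeff_def by (rule has_sum_infsum)
  from has_sum_cmult_right[OF this, of "gauss_coeff l (of_int j)"]
  have "((\<lambda>s. gauss_coeff l (of_int j) * ?f s) has_sum error_coeff l h j) UNIV"
    by (simp only: error_coeff_def b_def \<eta>_def)
  moreover have "gauss_coeff l (of_int j) * ?f s = (- 1) ^ s * gauss_coeff l (\<bar>of_int j\<bar> + (2 * real s + 1) * real h)" for s
  proof -
    define m where "m = 2 * real s + 1"
    have b_eq: "b * (real s + 1/2)\<^sup>2 = (1 / l) * (m * real h)\<^sup>2"
      by (simp add: b_def m_def power2_eq_square algebra_simps add_divide_distrib)
    have "- pi * (1 / l) * (of_int j)\<^sup>2 + (- pi * b * (real s + 1/2)\<^sup>2 + - 2 * pi * (m * \<eta>) * \<bar>of_int j\<bar>)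
      = - pi * (1 / l) * \<bar>of_int j\<bar>\<^sup>2 + (- pi * (b * (real s + 1/2)\<^sup>2) + - 2 * pi * (m * \<eta>) * \<bar>of_int j\<bar>)"
      by simp
    also have "\<dots> = - pi * (1 / l) * (\<bar>of_int j\<bar> + m * real h)\<^sup>2"
      unfolding b_eq unfolding \<eta>_def power2_sum power_mult_distrib using assms(1) by (simp add: field_simps)
    finally have "- pi * (1 / l) * (of_int j)\<^sup>2 + (- pi * b * (real s + 1/2)\<^sup>2 + - 2 * pi * (m * \<eta>) * \<bar>of_int j\<bar>)
      = - pi * (1 / l) * (\<bar>of_int j\<bar> + m * real h)\<^sup>2" .
    then show ?thesis
      unfolding gauss_coeff_def m_def[symmetric] by (simp flip: exp_add add: mult_ac)
  qed
  ultimately show ?thesis by (simp only:)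
qed

lemma error_coeff_even: "error_coeff l h (- j) = error_coeff l h j"
  by (simp add: error_coeff_def alt_coeff_def gauss_coeff_even)

text \<open>The telescoping step behind the two recursions below.\<close>

lemma has_sum_alternating_pair:
  fixes g :: "nat \<Rightarrow> real"
  assumes "((\<lambda>s. (- 1) ^ s * g (Suc s)) has_sum B) UNIV"
  shows "((\<lambda>s. (- 1) ^ s * g s) has_sum (g 0 - B)) UNIV"
  using has_sum_nat_Suc[of "\<lambda>s. (- 1) ^ s * g s" "- B"] has_sum_uminusI[OF assms] by simp

text \<open>Multiplication by \<open>2 cos (2 \<pi> h x)\<close> adds the coefficients at \<open>j - h\<close> and \<open>j + h\<close>. Outside the
  range of the polynomial the two alternating series telescope to the coefficient of \<open>\<theta>\<^sub>3\<close>.\<close>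

lemma error_coeff_pair_large:
  assumes "l > 0" "h > 0" "\<bar>j\<bar> \<ge> int h"
  shows "error_coeff l h (j - int h) + error_coeff l h (j + int h) = gauss_coeff l (of_int j)"
proof -
  have main: "error_coeff l h (j - int h) + error_coeff l h (j + int h) = gauss_coeff l (of_int j)"
    if j: "j \<ge> int h" for j
  proof -
    define g where "g = (\<lambda>s::nat. gauss_coeff l (of_int j + 2 * real s * real h))"
    have "\<bar>real_of_int (j + int h)\<bar> + (2 * real s + 1) * real h = of_int j + 2 * real (Suc s) * real h" for s
      using j by (simp add: algebra_simps)
    then have 1: "((\<lambda>s. (- 1) ^ s * g (Suc s)) has_sum error_coeff l h (j + int h)) UNIV"
      using error_coeff_has_sum[OF assms(1,2), of "j + int h"] by (simp only: g_def)
    have "\<bar>real_of_int (j - int h)\<bar> + (2 * real s + 1) * real h = of_int j + 2 * real s * real h" for s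
      using j by (simp add: algebra_simps)
    then have 2: "((\<lambda>s. (- 1) ^ s * g s) has_sum error_coeff l h (j - int h)) UNIV"
      using error_coeff_has_sum[OF assms(1,2), of "j - int h"] by (simp only: g_def)
    from has_sum_unique[OF 2 has_sum_alternating_pair[OF 1]] show ?thesis by (simp add: g_def)
  qed
  show ?thesis
  proof (cases "j \<ge> 0")
    case True
    then show ?thesis using assms(3) by (intro main) auto
  next
    case False
    have "error_coeff l h (- j - int h) + error_coeff l h (- j + int h) = gauss_coeff l (of_int (- j))"
      using False assms(3) by (intro main) auto
    moreover have "error_coeff l h (- j - int h) = error_coeff l h (j + int h)"
      "error_coeff l h (- j + int h) = error_coeff l h (j - int h)"
      using error_coeff_even[of l h "j + int h"] error_coeff_even[of l h "j - int h"] by (simp_all add: algebra_simps)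
    ultimately show ?thesis by (simp add: gauss_coeff_even)
  qed
qed

text \<open>Inside the range \<open>\<bar>j - h\<bar> = h - j\<close> and \<open>\<bar>j + h\<bar> = h + j\<close>. Up to sign the two series are then the
  negative and the positive half of the two-sided series of \<open>alias_coeff\<close>, whose central term is
  the coefficient of \<open>\<theta>\<^sub>3\<close>.\<close>

lemma error_coeff_pair_small:
  assumes "l > 0" "h > 0" "\<bar>j\<bar> < int h"
  shows "error_coeff l h (j - int h) + error_coeff l h (j + int h) = gauss_coeff l (of_int j) - alias_coeff l h j"
proof -
  let ?t = "\<lambda>r::int. (if even r then 1 else - 1) * gauss_coeff l (of_int j + 2 * real h * of_int r)"
  define g where "g = (\<lambda>s::nat. gauss_coeff l (of_int j + 2 * real h * real s))"
  have "\<bar>real_of_int (j + int h)\<bar> + (2 * real s + 1) * real h = of_int j + 2 * real h * real (Suc s)" for s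
    using assms(3) by (simp add: algebra_simps)
  then have "((\<lambda>s. (- 1) ^ s * g (Suc s)) has_sum error_coeff l h (j + int h)) UNIV"
    using error_coeff_has_sum[OF assms(1,2), of "j + int h"] by (simp only: g_def)
  from has_sum_alternating_pair[OF this]
  have "((\<lambda>s. (- 1) ^ s * g s) has_sum (gauss_coeff l (of_int j) - error_coeff l h (j + int h))) UNIV" by (simp add: g_def)
  moreover have "(- 1) ^ s * g s = ?t (int s)" for s by (auto simp: g_def)
  ultimately have 1: "((\<lambda>s. ?t (int s)) has_sum (gauss_coeff l (of_int j) - error_coeff l h (j + int h))) UNIV"
    by (simp only:)
  have "((\<lambda>s::nat. - ((- 1) ^ s * gauss_coeff l (\<bar>of_int (j - int h)\<bar> + (2 * real s + 1) * real h))) has_sum - error_coeff l h (j - int h)) UNIV"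
    by (intro has_sum_uminusI error_coeff_has_sum assms)
  moreover have "- ((- 1) ^ s * gauss_coeff l (\<bar>of_int (j - int h)\<bar> + (2 * real s + 1) * real h)) = ?t (- 1 - int s)" for s
  proof -
    have "\<bar>real_of_int (j - int h)\<bar> + (2 * real s + 1) * real h = - (of_int j + 2 * real h * of_int (- 1 - int s))"
      using assms(3) by (simp add: algebra_simps)
    then have "gauss_coeff l (\<bar>of_int (j - int h)\<bar> + (2 * real s + 1) * real h) = gauss_coeff l (of_int j + 2 * real h * of_int (- 1 - int s))"
      by (simp only: gauss_coeff_even)
    then show ?thesis by (auto simp del: of_int_diff)
  qed
  ultimately have 2: "((\<lambda>s. ?t (- 1 - int s)) has_sum - error_coeff l h (j - int h)) UNIV" by (simp only:)
  show ?thesis using infsumI[OF has_sum_int_split[OF 1 2]] by (simp add: alias_coeff_def)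
qed

text \<open>Both sides have the same Fourier coefficients by the two recursions. The cosine makes the
  polynomial interpolate, and with \<open>error_series_nonneg\<close> it gives the error its sign.\<close>

lemma theta3_minus_interp_poly:
  assumes "l > 0" "h > 0"
  shows "theta3 (of_real x) (\<i> * of_real (1 / l)) - interp_poly l h x =
    of_real (2 * cos (2 * pi * real h * x)) * (\<Sum>\<^sub>\<infinity>j::int. of_real (error_coeff l h j) * ee (of_int j * x))"
proof -
  define E where "E = (\<lambda>j. complex_of_real (error_coeff l h j) * ee (of_int j * x))"
  define J where "J = {- (int h - 1)..int h - 1}"
  have "E summable_on UNIV"
    by (rule summable_on_dominated[OF summable_on_error_coeff[OF assms]]) (simp add: E_def norm_mult)
  then have E: "(E has_sum infsum E UNIV) UNIV" by simp
  have "((\<lambda>j. E (j + - int h)) has_sum infsum E UNIV) UNIV" "((\<lambda>j. E (j + int h)) has_sum infsum E UNIV) UNIV"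
    using E by (simp_all only: has_sum_int_shift)
  from has_sum_add[OF this[THEN has_sum_cmult_left]]
  have "((\<lambda>j. E (j + - int h) * ee (real h * x) + E (j + int h) * ee (- (real h * x))) has_sum
      infsum E UNIV * ee (real h * x) + infsum E UNIV * ee (- (real h * x))) UNIV" .
  moreover have "infsum E UNIV * ee (real h * x) + infsum E UNIV * ee (- (real h * x))
      = of_real (2 * cos (2 * pi * real h * x)) * infsum E UNIV"
    using ee_plus_minus[of "real h * x"] by (simp add: distrib_left[symmetric] mult_ac)
  moreover have "E (j + - int h) * ee (real h * x) + E (j + int h) * ee (- (real h * x))
      = of_real (gauss_coeff l (of_int j)) * ee (of_int j * x) - (if j \<in> J then of_real (alias_coeff l h j) * ee (of_int j * x) else 0)" for j
  proof -
    have "ee (of_int (j + - int h) * x) * ee (real h * x) = ee (of_int j * x)"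
      "ee (of_int (j + int h) * x) * ee (- (real h * x)) = ee (of_int j * x)"
      by (simp_all flip: ee_add add: algebra_simps)
    then have "E (j + - int h) * ee (real h * x) + E (j + int h) * ee (- (real h * x))
      = of_real (error_coeff l h (j - int h) + error_coeff l h (j + int h)) * ee (of_int j * x)"
      by (simp add: E_def mult.assoc distrib_right)
    also have "\<dots> = of_real (gauss_coeff l (of_int j)) * ee (of_int j * x) - (if j \<in> J then of_real (alias_coeff l h j) * ee (of_int j * x) else 0)"
    proof (cases "j \<in> J")
      case True
      then have "\<bar>j\<bar> < int h" by (auto simp: J_def)
      then show ?thesis using True by (simp only: error_coeff_pair_small[OF assms]) (simp add: left_diff_distrib)
    next
      case False
      then have "\<bar>j\<bar> \<ge> int h" by (auto simp: J_def)
      then show ?thesis using False by (simp only: error_coeff_pair_large[OF assms]) simp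
    qed
    finally show ?thesis .
  qed
  ultimately have 1: "((\<lambda>j. of_real (gauss_coeff l (of_int j)) * ee (of_int j * x) - (if j \<in> J then of_real (alias_coeff l h j) * ee (of_int j * x) else 0))
      has_sum of_real (2 * cos (2 * pi * real h * x)) * infsum E UNIV) UNIV" by (simp only:)
  have "(\<lambda>n::int. complex_of_real (gauss_coeff l (of_int n)) * ee (of_int n * x)) summable_on UNIV"
    by (rule summable_on_dominated[OF summable_on_gauss_coeff[OF assms(1)]])
       (simp add: norm_mult gauss_coeff_def)
  then have "((\<lambda>n::int. complex_of_real (gauss_coeff l (of_int n)) * ee (of_int n * x)) has_sum theta3 (of_real x) (\<i> * of_real (1 / l))) UNIV"
    unfolding theta3_gauss_coeff by (rule has_sum_infsum)
  moreover have "((\<lambda>j. if j \<in> J then complex_of_real (alias_coeff l h j) * ee (of_int j * x) else 0) has_sum interp_poly l h x) UNIV"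
    unfolding interp_poly_def J_def[symmetric]
    by (rule has_sum_finite_neutralI[of J]) (auto simp: J_def)
  ultimately have "((\<lambda>j. of_real (gauss_coeff l (of_int j)) * ee (of_int j * x) - (if j \<in> J then of_real (alias_coeff l h j) * ee (of_int j * x) else 0))
      has_sum theta3 (of_real x) (\<i> * of_real (1 / l)) - interp_poly l h x) UNIV"
    by (rule has_sum_diff)
  from has_sum_unique[OF this 1] show ?thesis by (simp only: E_def)
qed

section \<open>The interpolation series on the line\<close>

definition node_weight :: "real \<Rightarrow> int \<Rightarrow> real" where
  "node_weight \<mu> n = exp (- pi * \<mu> * (of_int n + 1/2)\<^sup>2)"

text \<open>The series in \<open>K_interp\<close> with the signs evaluated. It has poles at the half-integers.\<close>

definition K_series :: "real \<Rightarrow> complex \<Rightarrow> complex" where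
  "K_series \<mu> z = (\<Sum>\<^sub>\<infinity>n::int. of_real ((if even n then - 1 else 1) * node_weight \<mu> n) / (z - of_real (of_int n + 1/2)))"

lemma K_interp_eq: "K_interp \<mu> = remove_sings (\<lambda>z. cos (of_real pi * z) / of_real pi * K_series \<mu> z)"
proof -
  have "(- 1) powi (n + 1) * gauss \<mu> (of_int n + 1/2) / (z - of_int n - 1/2)
     = of_real ((if even n then - 1 else 1) * node_weight \<mu> n) / (z - of_real (of_int n + 1/2))" for n :: int and z
  proof -
    have "gauss \<mu> (of_int n + 1/2) = of_real (node_weight \<mu> n)"
      by (simp add: gauss_def node_weight_def exp_of_real[symmetric])
    moreover have "(- 1 :: complex) powi (n + 1) = (if even n then - 1 else 1)"
      by (simp add: power_int_minus_left)
    moreover have "z - of_int n - 1/2 = z - of_real (of_int n + 1/2)" by simp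
    ultimately show ?thesis by simp
  qed
  then show ?thesis unfolding K_interp_def K_series_def by (simp only:)
qed

lemma summable_on_node_weight: "\<mu> > 0 \<Longrightarrow> node_weight \<mu> summable_on UNIV"
  unfolding node_weight_def by (rule summable_on_theta1_coeffs)

lemma node_weight_pos: "node_weight \<mu> n > 0" by (simp add: node_weight_def)

lemma node_weight_reflect: "node_weight \<mu> (- 1 - n) = node_weight \<mu> n"
proof -
  have "of_int (- 1 - n) + 1/2 = - (of_int n + 1/2 :: real)" by simp
  then show ?thesis unfolding node_weight_def by (simp only: power2_minus)
qed

lemma K_series_term_bound:
  fixes z :: complex
  assumes "\<delta> > 0" "\<delta> \<le> norm (z - of_real (of_int n + 1/2))"
  shows "norm (of_real ((if even n then - 1 else 1) * node_weight \<mu> n) / (z - of_real (of_int n + 1/2))) \<le> node_weight \<mu> n * (1 / \<delta>)"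
proof -
  have "node_weight \<mu> n / norm (z - of_real (of_int n + 1/2)) \<le> node_weight \<mu> n / \<delta>"
    using assms node_weight_pos[of \<mu> n] by (intro divide_left_mono mult_pos_pos) auto
  then show ?thesis using node_weight_pos[of \<mu> n] by (simp add: norm_divide norm_mult abs_mult split: if_splits)
qed

lemma continuous_on_K_series:
  fixes U :: "complex set"
  assumes "\<mu> > 0" "\<delta> > 0" "\<And>n z. n \<in> A \<Longrightarrow> z \<in> U \<Longrightarrow> \<delta> \<le> norm (z - of_real (of_int n + 1/2))"
  shows "continuous_on U (\<lambda>z. \<Sum>\<^sub>\<infinity>n\<in>A. of_real ((if even n then - 1 else 1) * node_weight \<mu> n) / (z - of_real (of_int n + 1/2)))"
proof (rule continuous_on_infsum)
  show "(\<lambda>n. node_weight \<mu> n * (1 / \<delta>)) summable_on A"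
    using summable_on_subset_banach[OF summable_on_node_weight[OF assms(1)]] by (intro summable_on_cmult_left) auto
  show "continuous_on U (\<lambda>z. of_real ((if even n then - 1 else 1) * node_weight \<mu> n) / (z - of_real (of_int n + 1/2)))" if "n \<in> A" for n
    using assms(2) assms(3)[OF that] by (intro continuous_intros) force
  show "norm (of_real ((if even n then - 1 else 1) * node_weight \<mu> n) / (z - of_real (of_int n + 1/2))) \<le> node_weight \<mu> n * (1 / \<delta>)"
    if "n \<in> A" "z \<in> U" for n z
    by (rule K_series_term_bound[OF assms(2) assms(3)[OF that]])
qed

lemma half_integer_distance:
  assumes "z - 1/2 \<notin> (\<int> :: complex set)"
  obtains \<delta> where "\<delta> > 0" "\<And>n::int. \<delta> \<le> norm (z - of_real (of_int n + 1/2))"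
proof -
  obtain c where c: "c > 0" "\<And>n::int. c * (1 + \<bar>real_of_int n\<bar>) \<le> norm (z - 1/2 + of_int n)"
    using norm_plus_int_ge[OF assms] by blast
  have "c \<le> norm (z - of_real (of_int n + 1/2))" for n :: int
  proof -
    have "c * 1 \<le> c * (1 + \<bar>real_of_int (- n)\<bar>)" using c(1) by (intro mult_left_mono) auto
    also have "\<dots> \<le> norm (z - 1/2 + of_int (- n))" by (rule c(2))
    also have "z - 1/2 + of_int (- n) = z - of_real (of_int n + 1/2)" by simp
    finally show ?thesis by simp
  qed
  then show ?thesis using c(1) that by blast
qed

text \<open>Off the half-integers the series converges locally uniformly, so the singularity removal in
  \<open>K_interp\<close> changes nothing.\<close>

lemma K_interp_off_nodes:
  assumes "\<mu> > 0" "z - 1/2 \<notin> (\<int> :: complex set)"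
  shows "K_interp \<mu> z = cos (of_real pi * z) / of_real pi * K_series \<mu> z"
  unfolding K_interp_eq
proof (rule remove_sings_eqI)
  obtain \<delta> where \<delta>: "\<delta> > 0" "\<And>n::int. \<delta> \<le> norm (z - of_real (of_int n + 1/2))"
    using half_integer_distance[OF assms(2)] by blast
  have "continuous_on (ball z (\<delta> / 2)) (K_series \<mu>)"
    unfolding K_series_def
  proof (rule continuous_on_K_series[OF assms(1), of "\<delta> / 2"])
    fix n :: int and w assume "w \<in> ball z (\<delta> / 2)"
    then have "norm (z - w) < \<delta> / 2" by (simp add: dist_norm)
    moreover have "norm (z - of_real (of_int n + 1/2)) \<le> norm (z - w) + norm (w - of_real (of_int n + 1/2))"
      unfolding dist_norm[symmetric] by (rule dist_triangle)
    ultimately show "\<delta> / 2 \<le> norm (w - of_real (of_int n + 1/2))" using \<delta>(2)[of n] by linarith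
  qed (use \<delta> in auto)
  then have "isCont (K_series \<mu>) z" using \<delta> by (simp add: continuous_on_eq_continuous_at)
  then have "isCont (\<lambda>z. cos (of_real pi * z) / of_real pi * K_series \<mu> z) z"
    by (intro continuous_intros) auto
  then show "(\<lambda>z. cos (of_real pi * z) / of_real pi * K_series \<mu> z) \<midarrow>z\<rightarrow> cos (of_real pi * z) / of_real pi * K_series \<mu> z"
    by (rule isContD)
qed

lemma sin_cos_half_integer:
  "sin (pi * (of_int m + 1/2)) = (if even m then 1 else - 1)" "cos (pi * (of_int m + 1/2)) = 0"
proof -
  have "sin (pi * of_int m) = 0" using sin_npi_int[of m] by (simp add: mult.commute)
  moreover have "cos (pi * of_int m) = (if even m then 1 else - 1)" 
    using cos_npi_int[of m] by (simp add: mult.commute)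
  moreover have "pi * (of_int m + 1/2) = pi * of_int m + pi / 2" by (simp add: algebra_simps)
  ultimately show "sin (pi * (of_int m + 1/2)) = (if even m then 1 else - 1)" "cos (pi * (of_int m + 1/2)) = 0"
    by (simp_all add: sin_add cos_add)
qed

text \<open>The zero of the cosine cancels the pole of a single term and annihilates all others, so the
  function interpolates the Gaussian at the half-integers.\<close>

lemma K_interp_at_node:
  assumes "\<mu> > 0"
  shows "K_interp \<mu> (of_real (of_int m + 1/2)) = of_real (node_weight \<mu> m)"
  unfolding K_interp_eq
proof (rule remove_sings_eqI)
  define w where "w = complex_of_real (of_int m + 1/2)"
  define c where "c = (\<lambda>n::int. complex_of_real ((if even n then - 1 else 1) * node_weight \<mu> n))"
  define R where "R = (\<lambda>z. \<Sum>\<^sub>\<infinity>n\<in>UNIV - {m}. c n / (z - of_real (of_int n + 1/2)))"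
  have far: "1/2 \<le> norm (z - of_real (of_int n + 1/2))" if "n \<in> UNIV - {m}" "z \<in> ball w (1/2)" for n z
  proof -
    have "1 \<le> \<bar>real_of_int (m - n)\<bar>" using that(1) by (simp flip: of_int_abs)
    also have "\<bar>real_of_int (m - n)\<bar> = norm (w - of_real (of_int n + 1/2))"
      unfolding w_def of_real_diff[symmetric] norm_of_real by simp
    also have "\<dots> \<le> norm (w - z) + norm (z - of_real (of_int n + 1/2))"
      unfolding dist_norm[symmetric] by (rule dist_triangle)
    finally show ?thesis using that(2) by (simp add: dist_norm)
  qed
  have "continuous_on (ball w (1/2)) R"
    unfolding R_def c_def by (rule continuous_on_K_series[OF assms, of "1/2"]) (use far in auto)
  then have "isCont R w" by (simp add: continuous_on_eq_continuous_at)
  then have R: "R \<midarrow>w\<rightarrow> R w" by (rule isContD)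
  (* Only the m-th term is singular at w. *)
  have split: "K_series \<mu> z = c m / (z - w) + R z" if "z \<in> ball w (1/2)" for z
  proof -
    have "(\<lambda>n. node_weight \<mu> n * (1 / (1/2))) summable_on UNIV - {m}"
      using summable_on_subset_banach[OF summable_on_node_weight[OF assms]] by (intro summable_on_cmult_left) auto
    then have "(\<lambda>n. c n / (z - of_real (of_int n + 1/2))) summable_on UNIV - {m}"
      unfolding c_def by (rule summable_on_dominated) (rule K_series_term_bound, simp, rule far, use that in auto)
    then have "((\<lambda>n. c n / (z - of_real (of_int n + 1/2))) has_sum (c m / (z - w) + R z)) (insert m (UNIV - {m}))"
      unfolding R_def w_def by (intro has_sum_insert) (auto simp: has_sum_infsum)
    then show ?thesis by (simp add: K_series_def c_def has_sum_iff insert_Diff)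
  qed
  have pi_w: "of_real pi * w = of_real (pi * (of_int m + 1/2))" by (simp add: w_def)
  have cos0: "cos (of_real pi * w) = 0" and sin1: "sin (of_real pi * w) = of_real (if even m then 1 else - 1)"
    unfolding pi_w cos_of_real sin_of_real sin_cos_half_integer by simp_all
  have "((\<lambda>z. cos (of_real pi * z)) has_field_derivative - (sin (of_real pi * w) * of_real pi)) (at w)"
    by (auto intro!: derivative_eq_intros)
  then have "(\<lambda>z. cos (of_real pi * z) / (z - w)) \<midarrow>w\<rightarrow> - (sin (of_real pi * w) * of_real pi)"
    by (simp add: has_field_derivative_iff cos0)
  then have "(\<lambda>z. c m / of_real pi * (cos (of_real pi * z) / (z - w)) + cos (of_real pi * z) / of_real pi * R z)
      \<midarrow>w\<rightarrow> c m / of_real pi * (- (sin (of_real pi * w) * of_real pi)) + cos (of_real pi * w) / of_real pi * R w"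
    by (intro tendsto_intros R) auto
  also have "c m / of_real pi * (- (sin (of_real pi * w) * of_real pi)) + cos (of_real pi * w) / of_real pi * R w = of_real (node_weight \<mu> m)"
    by (simp add: cos0 sin1 c_def)
  finally have lim: "(\<lambda>z. c m / of_real pi * (cos (of_real pi * z) / (z - w)) + cos (of_real pi * z) / of_real pi * R z)
      \<midarrow>w\<rightarrow> of_real (node_weight \<mu> m)" .
  have "eventually (\<lambda>z. z \<in> ball w (1/2)) (at w)" by (intro eventually_at_in_open') auto
  then have "eventually (\<lambda>z. c m / of_real pi * (cos (of_real pi * z) / (z - w)) + cos (of_real pi * z) / of_real pi * R z
      = cos (of_real pi * z) / of_real pi * K_series \<mu> z) (at w)"
    by eventually_elim (simp add: split distrib_left)
  from Lim_transform_eventually[OF lim this]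
  show "(\<lambda>z. cos (of_real pi * z) / of_real pi * K_series \<mu> z) \<midarrow>complex_of_real (of_int m + 1/2)\<rightarrow> of_real (node_weight \<mu> m)"
    by (simp only: w_def)
qed

section \<open>A finite cotangent identity\<close>

text \<open>The left-hand side is a Dirichlet kernel of degree \<open>h\<close> with halved end terms, which is the
  periodic substitute for \<open>sin (\<pi> z) / (\<pi> z)\<close>.\<close>

lemma dirichlet_cot:
  assumes "h > 0" "sin (pi * y) \<noteq> 0"
  shows "(\<Sum>j = - (int h - 1)..int h - 1. ee (of_int j * y)) + of_real (cos (2 * pi * (real h * y)))
      = of_real (sin (2 * pi * (real h * y)) * cot (pi * y))"
proof -
  obtain k where h: "h = Suc k" using assms(1) by (cases h) auto
  show ?thesis
    unfolding h
  proof (induction k)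
    case 0
    have "cos (2 * pi * y) = 2 * (cos (pi * y))\<^sup>2 - 1" "sin (2 * pi * y) = 2 * sin (pi * y) * cos (pi * y)"
      using cos_double_cos[of "pi * y"] sin_double[of "pi * y"] by (simp_all add: mult_ac)
    then have "1 + cos (2 * pi * y) = sin (2 * pi * y) * cot (pi * y)"
      using assms(2) by (simp add: cot_def power2_eq_square)
    then have "complex_of_real (1 + cos (2 * pi * y)) = of_real (sin (2 * pi * y) * cot (pi * y))"
      by (simp only:)
    then show ?case by simp
  next
    case (Suc k)
    define A where "A = 2 * pi * (real (Suc k) * y)"
    define s where "s = sin (pi * y)"
    define c where "c = cos (pi * y)"
    have A2: "2 * pi * (real (Suc (Suc k)) * y) = A + 2 * (pi * y)" by (simp add: A_def algebra_simps)
    have sc: "s\<^sup>2 + c\<^sup>2 = 1" by (simp add: s_def c_def)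
    have "sin (A + 2 * (pi * y)) * c - sin A * c = (cos A + cos (A + 2 * (pi * y))) * s"
      unfolding sin_add cos_add sin_double cos_double s_def[symmetric] c_def[symmetric]
      using sc by algebra
    then have "sin (A + 2 * (pi * y)) * (c / s) = sin A * (c / s) + cos A + cos (A + 2 * (pi * y))"
      using assms(2) by (simp add: s_def[symmetric] field_simps)
    then have trig: "sin (A + 2 * (pi * y)) * cot (pi * y) = sin A * cot (pi * y) + cos A + cos (A + 2 * (pi * y))"
      by (simp add: cot_def s_def c_def)
    have set: "{- (int (Suc (Suc k)) - 1)..int (Suc (Suc k)) - 1} = insert (- int (Suc k)) (insert (int (Suc k)) {- (int (Suc k) - 1)..int (Suc k) - 1})"
      by auto
    have ends: "ee (of_int (- int (Suc k)) * y) + ee (of_int (int (Suc k)) * y) = of_real (2 * cos A)"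
      using ee_plus_minus[of "real (Suc k) * y"] by (simp only: A_def of_int_minus of_int_of_nat_eq mult_minus_left add.commute)
    have IH: "(\<Sum>j = - (int (Suc k) - 1)..int (Suc k) - 1. ee (of_int j * y)) = of_real (sin A * cot (pi * y)) - of_real (cos A)"
      using Suc unfolding A_def[symmetric] by (simp only: eq_diff_eq)
    have "(\<Sum>j = - (int (Suc (Suc k)) - 1)..int (Suc (Suc k)) - 1. ee (of_int j * y))
       = (ee (of_int (- int (Suc k)) * y) + ee (of_int (int (Suc k)) * y)) + (\<Sum>j = - (int (Suc k) - 1)..int (Suc k) - 1. ee (of_int j * y))"
      unfolding set by (subst sum.insert; simp)+
    also have "\<dots> = of_real (2 * cos A) + (of_real (sin A * cot (pi * y)) - of_real (cos A))"
      unfolding ends IH ..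
    finally show ?case unfolding A2 trig by simp
  qed
qed

text \<open>The end terms of degree \<open>h\<close> of the two Dirichlet kernels cancel because \<open>\<beta>\<close> is a zero of
  \<open>cos (2 \<pi> h x)\<close>. This lowers the degree of the periodised series below \<open>h\<close>.\<close>

lemma node_kernel:
  fixes m :: int
  assumes "h > 0" "2 * real h * \<beta> = of_int m + 1/2" "sin (pi * (x - \<beta>)) \<noteq> 0" "sin (pi * (x + \<beta>)) \<noteq> 0"
  shows "complex_of_real ((if even m then - 1 else 1) * cos (2 * pi * real h * x) * (cot (pi * (x - \<beta>)) - cot (pi * (x + \<beta>))))
     = (\<Sum>j = - (int h - 1)..int h - 1. of_real (2 * cos (2 * pi * (of_int j * \<beta>))) * ee (of_int j * x))"
proof -
  define C where "C = cos (2 * pi * real h * x)"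
  define \<sigma> where "\<sigma> = (if even m then 1 else - 1 :: real)"
  have node: "cos (2 * pi * (real h * \<beta>)) = 0" "sin (2 * pi * (real h * \<beta>)) = \<sigma>"
  proof -
    have "2 * pi * (real h * \<beta>) = pi * (of_int m + 1/2)" using assms(2) by (simp add: mult_ac)
    then show "cos (2 * pi * (real h * \<beta>)) = 0" "sin (2 * pi * (real h * \<beta>)) = \<sigma>"
      using sin_cos_half_integer[of m] by (simp_all only: \<sigma>_def)
  qed
  have a: "2 * pi * (real h * (x - \<beta>)) = 2 * pi * real h * x - 2 * pi * (real h * \<beta>)"
    "2 * pi * (real h * (x + \<beta>)) = 2 * pi * real h * x + 2 * pi * (real h * \<beta>)" by (simp_all add: algebra_simps)
  have sin_eq: "sin (2 * pi * (real h * (x - \<beta>))) = - \<sigma> * C" "sin (2 * pi * (real h * (x + \<beta>))) = \<sigma> * C"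
    and cos_eq: "cos (2 * pi * (real h * (x - \<beta>))) + cos (2 * pi * (real h * (x + \<beta>))) = 0"
    unfolding a sin_diff sin_add cos_diff cos_add node C_def by simp_all
  have "(if even m then - 1 else 1) * C * (cot (pi * (x - \<beta>)) - cot (pi * (x + \<beta>)))
      = (- \<sigma> * C) * cot (pi * (x - \<beta>)) + (\<sigma> * C) * cot (pi * (x + \<beta>))"
    by (simp add: \<sigma>_def algebra_simps)
  then have "complex_of_real ((if even m then - 1 else 1) * C * (cot (pi * (x - \<beta>)) - cot (pi * (x + \<beta>))))
      = of_real (sin (2 * pi * (real h * (x - \<beta>))) * cot (pi * (x - \<beta>))) + of_real (sin (2 * pi * (real h * (x + \<beta>))) * cot (pi * (x + \<beta>)))"
    unfolding sin_eq by (simp only: of_real_add)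
  also have "\<dots> = (\<Sum>j = - (int h - 1)..int h - 1. ee (of_int j * (x - \<beta>)) + ee (of_int j * (x + \<beta>)))
      + of_real (cos (2 * pi * (real h * (x - \<beta>))) + cos (2 * pi * (real h * (x + \<beta>))))"
    unfolding dirichlet_cot[OF assms(1,3), symmetric] dirichlet_cot[OF assms(1,4), symmetric]
    by (simp only: sum.distrib of_real_add) (simp only: add_ac)
  also have "\<dots> = (\<Sum>j = - (int h - 1)..int h - 1. of_real (2 * cos (2 * pi * (of_int j * \<beta>))) * ee (of_int j * x))"
    unfolding cos_eq of_real_0 add_0_right
  proof (rule sum.cong[OF refl])
    fix j :: int
    have "of_int j * (x - \<beta>) = - (of_int j * \<beta>) + of_int j * x" "of_int j * (x + \<beta>) = of_int j * \<beta> + of_int j * x"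
      by (simp_all add: algebra_simps)
    then show "ee (of_int j * (x - \<beta>)) + ee (of_int j * (x + \<beta>)) = of_real (2 * cos (2 * pi * (of_int j * \<beta>))) * ee (of_int j * x)"
      unfolding ee_plus_minus[symmetric] by (simp only: ee_add distrib_right) (simp only: add_ac)
  qed
  finally show ?thesis unfolding C_def .
qed

section \<open>Periodisation of the interpolation series\<close>

text \<open>Poisson summation turns the sum over frequencies congruent to \<open>j\<close> into a sum over the
  half-integers, with the Gaussian samples that occur in \<open>K_interp\<close>.\<close>

lemma alias_coeff_has_sum:
  assumes "l > 0" "h > 0"
  shows "((\<lambda>m. sqrt l / (2 * real h) * (node_weight (l / (2 * real h)\<^sup>2) m * cos (2 * pi * (of_int j * ((of_int m + 1/2) / (2 * real h))))))
     has_sum alias_coeff l h j) UNIV"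
proof -
  define M where "M = 2 * real h"
  define b where "b = M\<^sup>2 / l"
  have M: "M > 0" using assms by (simp add: M_def)
  have b: "b > 0" using M assms by (simp add: b_def)
  have \<mu>: "l / M\<^sup>2 = 1 / b" by (simp add: b_def)
  have sqrtb: "1 / sqrt b = sqrt l / M" using M by (simp add: b_def real_sqrt_divide)
  define y where "y = of_int j / M"
  let ?w = "\<lambda>m::int. sqrt l / M * node_weight (l / M\<^sup>2) m"
  have w: "exp (- pi * (of_int m + 1/2)\<^sup>2 / b) / sqrt b = ?w m" for m :: int
    unfolding \<mu> node_weight_def sqrtb[symmetric] by simp
  have sm: "(\<lambda>m. complex_of_real (?w m) * ee ((of_int m + 1/2) * y)) summable_on UNIV"
  proof (rule summable_on_dominated[OF summable_on_cmult_right[OF summable_on_node_weight]])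
    show "norm (complex_of_real (?w m) * ee ((of_int m + 1/2) * y)) \<le> sqrt l / M * node_weight (1 / b) m" for m
      using M assms(1) node_weight_pos[of "l / M\<^sup>2" m] by (simp add: norm_mult norm_divide \<mu> abs_mult)
  qed (use b in auto)
  have "complex_of_real (alias_coeff l h j) = (\<Sum>\<^sub>\<infinity>r::int. complex_of_real ((if even r then 1 else - 1) * gauss_coeff l (of_int j + 2 * real h * of_int r)))"
    unfolding alias_coeff_def by (rule infsum_of_real[symmetric])
  also have "\<dots> = (\<Sum>\<^sub>\<infinity>r::int. (of_real (exp (- pi * b * (y + of_int r)\<^sup>2)) * ee (- (y + of_int r) * (1/2))) * ee (y / 2))"
  proof (rule infsum_cong)
    fix r :: int
    have "of_int j + 2 * real h * of_int r = M * (y + of_int r)" using M by (simp add: y_def M_def field_simps)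
    then have "gauss_coeff l (of_int j + 2 * real h * of_int r) = exp (- pi * b * (y + of_int r)\<^sup>2)"
      by (simp add: gauss_coeff_def b_def power_mult_distrib)
    moreover have "ee (- (y + of_int r) * (1/2)) * ee (y / 2) = of_real (if even r then 1 else - 1)"
    proof -
      have "ee (- (y + of_int r) * (1/2)) * ee (y / 2) = ee (- of_int r / 2)"
        by (simp flip: ee_add add: field_simps)
      also have "\<dots> = of_real (if even r then 1 else - 1)"
      proof (cases "even r")
        case True
        then obtain k where "r = 2 * k" by (auto elim: evenE)
        then have "- real_of_int r / 2 = of_int (- k)" by simp
        then have "ee (- real_of_int r / 2) = 1" by (simp only: ee_of_int)
        then show ?thesis using True by simp
      next
        case False
        then obtain k where "r = 2 * k + 1" by (auto elim: oddE)
        then have "- real_of_int r / 2 = of_int (- k - 1) + 1/2" by (simp add: field_simps)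
        then have "ee (- real_of_int r / 2) = - 1" by (simp only: ee_add ee_of_int ee_half) simp
        then show ?thesis using False by simp
      qed
      finally show ?thesis .
    qed
    ultimately show "complex_of_real ((if even r then 1 else - 1) * gauss_coeff l (of_int j + 2 * real h * of_int r))
      = (of_real (exp (- pi * b * (y + of_int r)\<^sup>2)) * ee (- (y + of_int r) * (1/2))) * ee (y / 2)"
      by (simp only: of_real_mult mult.assoc) (simp only: mult.commute)
  qed
  also have "\<dots> = (\<Sum>\<^sub>\<infinity>m::int. of_real (exp (- pi * (of_int m + 1/2)\<^sup>2 / b) / sqrt b) * ee (of_int m * y)) * ee (y / 2)"
    unfolding infsum_cmult_left' poisson_gauss[OF b] ..
  also have "\<dots> = (\<Sum>\<^sub>\<infinity>m::int. complex_of_real (?w m) * ee ((of_int m + 1/2) * y))"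
    unfolding infsum_cmult_left'[symmetric] w mult.assoc ee_add[symmetric] by (simp add: algebra_simps)
  finally have "((\<lambda>m. complex_of_real (?w m) * ee ((of_int m + 1/2) * y)) has_sum complex_of_real (alias_coeff l h j)) UNIV"
    using has_sum_infsum[OF sm] by simp
  from has_sum_Re[OF this]
  have "((\<lambda>m. Re (complex_of_real (?w m) * ee ((of_int m + 1/2) * y))) has_sum alias_coeff l h j) UNIV" by simp
  moreover have "Re (complex_of_real (?w m) * ee ((of_int m + 1/2) * y)) = sqrt l / M * (node_weight (l / M\<^sup>2) m * cos (2 * pi * (of_int j * ((of_int m + 1/2) / M))))" for m
    by (simp add: ee_def y_def mult_ac)
  ultimately show ?thesis by (simp only: M_def)
qed

text \<open>The samples with signs are odd under reflection, so the series can be symmetrised; its terms then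
  decay like \<open>1 / z\<^sup>2\<close>, as the periodisation requires.\<close>

lemma K_series_symmetric:
  assumes "\<mu> > 0" "z - 1/2 \<notin> (\<int> :: complex set)"
  shows "2 * K_series \<mu> z = (\<Sum>\<^sub>\<infinity>m::int. of_real ((if even m then - 1 else 1) * node_weight \<mu> m) *
     (1 / (z - of_real (of_int m + 1/2)) - 1 / (z + of_real (of_int m + 1/2))))"
proof -
  define t where "t = (\<lambda>m::int. of_real ((if even m then - 1 else 1) * node_weight \<mu> m) / (z - of_real (of_int m + 1/2)))"
  obtain \<delta> where \<delta>: "\<delta> > 0" "\<And>n::int. \<delta> \<le> norm (z - of_real (of_int n + 1/2))"
    using half_integer_distance[OF assms(2)] by blast
  have "t summable_on UNIV"
    unfolding t_def
    by (rule summable_on_dominated[OF summable_on_cmult_left[OF summable_on_node_weight[OF assms(1)]]])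
       (rule K_series_term_bound[OF \<delta>])
  then have t: "(t has_sum K_series \<mu> z) UNIV" unfolding t_def K_series_def by (rule has_sum_infsum)
  then have "((\<lambda>m. t (- 1 - m)) has_sum K_series \<mu> z) UNIV" by (simp only: has_sum_int_reflect)
  from has_sum_add[OF t this]
  have "((\<lambda>m. t m + t (- 1 - m)) has_sum (2 * K_series \<mu> z)) UNIV" by simp
  moreover have "t m + t (- 1 - m) = of_real ((if even m then - 1 else 1) * node_weight \<mu> m) *
     (1 / (z - of_real (of_int m + 1/2)) - 1 / (z + of_real (of_int m + 1/2)))" for m
  proof -
    have "z - of_real (of_int (- 1 - m) + 1/2) = z + of_real (of_int m + 1/2)" by simp
    then have "t (- 1 - m) = - (of_real ((if even m then - 1 else 1) * node_weight \<mu> m) / (z + of_real (of_int m + 1/2)))"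
      unfolding t_def node_weight_reflect by simp
    then show ?thesis by (simp add: t_def right_diff_distrib)
  qed
  ultimately show ?thesis by (simp only:) (rule infsumI[symmetric])
qed

text \<open>The inequality \<open>1 + \<bar>a\<bar> \<le> (1 + \<bar>a - m\<bar>) (1 + \<bar>m\<bar>)\<close> separates the two indices of the double series
  below.\<close>

lemma int_shift_weight:
  fixes n m k :: int
  assumes "k \<ge> 1"
  shows "1 + \<bar>real_of_int n\<bar> \<le> (1 + \<bar>real_of_int (k * n - m)\<bar>) * (1 + \<bar>real_of_int m\<bar>)"
proof -
  have "\<bar>n\<bar> \<le> k * \<bar>n\<bar>" using assms by (intro mult_le_cancel_right1[THEN iffD2]) auto
  also have "\<dots> = \<bar>k * n\<bar>" using assms by (simp add: abs_mult)
  also have "\<dots> \<le> \<bar>k * n - m\<bar> + \<bar>m\<bar>" by linarith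
  finally have "1 + \<bar>n\<bar> \<le> (1 + \<bar>k * n - m\<bar>) * (1 + \<bar>m\<bar>)"
    by (simp add: algebra_simps) (metis abs_ge_zero add_increasing2 mult_nonneg_nonneg order_refl add.assoc)
  then have "real_of_int (1 + \<bar>n\<bar>) \<le> real_of_int ((1 + \<bar>k * n - m\<bar>) * (1 + \<bar>m\<bar>))" by (simp only: of_int_le_iff)
  then show ?thesis by simp
qed

lemma summable_on_node_weight_cube:
  assumes "\<mu> > 0"
  shows "(\<lambda>m. node_weight \<mu> m * (1 + \<bar>real_of_int m\<bar>) ^ 3) summable_on UNIV"
proof (rule summable_on_dominated)
  show "(\<lambda>m::int. exp (pi * \<mu> * (1/2)\<^sup>2) * ((1 + \<bar>real_of_int m\<bar>) ^ 3 * exp (- (pi * \<mu> / 2) * (of_int m)\<^sup>2))) summable_on UNIV"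
    using assms by (intro summable_on_cmult_right summable_on_int_gauss) simp
  fix m :: int
  have "node_weight \<mu> m \<le> exp (pi * \<mu> * (1/2)\<^sup>2) * exp (- (pi * \<mu> / 2) * (of_int m)\<^sup>2)"
    using gauss_shift_bound[of "pi * \<mu>" "1/2" "1/2" "of_int m"] assms by (simp add: node_weight_def add.commute)
  from mult_right_mono[OF this, of "(1 + \<bar>real_of_int m\<bar>) ^ 3"]
  show "norm (node_weight \<mu> m * (1 + \<bar>real_of_int m\<bar>) ^ 3) \<le> exp (pi * \<mu> * (1/2)\<^sup>2) * ((1 + \<bar>real_of_int m\<bar>) ^ 3 * exp (- (pi * \<mu> / 2) * (of_int m)\<^sup>2))"
    using node_weight_pos[of \<mu> m] by (simp add: abs_mult mult_ac)
qed

lemma of_real_in_Ints_iff: "complex_of_real x \<in> \<int> \<longleftrightarrow> x \<in> \<int>"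
  by (auto simp: complex_is_Int_iff elim: Ints_cases)

lemma sin_pi_nonzero: "x \<notin> \<int> \<Longrightarrow> sin (pi * x) \<noteq> 0"
  by (auto simp: sin_zero_iff_int2)

lemma shifted_node_not_Ints:
  fixes x :: real
  assumes "h > 0" "2 * real h * x - 1/2 \<notin> \<int>"
  shows "x - (of_int m + 1/2) / (2 * real h) \<notin> \<int>" "x + (of_int m + 1/2) / (2 * real h) \<notin> \<int>"
proof -
  have M: "2 * real h > 0" using assms(1) by simp
  show "x - (of_int m + 1/2) / (2 * real h) \<notin> \<int>"
  proof
    assume "x - (of_int m + 1/2) / (2 * real h) \<in> \<int>"
    then obtain k where "x - (of_int m + 1/2) / (2 * real h) = of_int k" by (auto elim: Ints_cases)
    then have "2 * real h * x - 1/2 = of_int (2 * int h * k + m)" using M by (simp add: field_simps)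
    then show False using assms(2) by (metis Ints_of_int)
  qed
  show "x + (of_int m + 1/2) / (2 * real h) \<notin> \<int>"
  proof
    assume "x + (of_int m + 1/2) / (2 * real h) \<in> \<int>"
    then obtain k where "x + (of_int m + 1/2) / (2 * real h) = of_int k" by (auto elim: Ints_cases)
    then have "2 * real h * x - 1/2 = of_int (2 * int h * k - m - 1)" using M by (simp add: field_simps)
    then show False using assms(2) by (metis Ints_of_int)
  qed
qed

text \<open>In the double series the sum over the periods is a difference of cotangents, and \<open>node_kernel\<close>
  turns each of these, multiplied by the cosine in front, into a polynomial of degree less
  than \<open>h\<close>.\<close>

lemma K_periodization_off_nodes:
  assumes l: "l > 0" and h: "h > 0" and x: "2 * real h * x - 1/2 \<notin> \<int>"
  shows "of_real (sqrt l) * (\<Sum>\<^sub>\<infinity>n::int. K_interp (l / (2 * real h)\<^sup>2) (of_real (2 * real h * (x + of_int n)))) = interp_poly l h x"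
proof -
  define M where "M = 2 * real h"
  define \<mu> where "\<mu> = l / M\<^sup>2"
  define C where "C = cos (2 * pi * real h * x)"
  define J where "J = {- (int h - 1)..int h - 1}"
  define \<beta> where "\<beta> = (\<lambda>m::int. (of_int m + 1/2) / M)"
  define D where "D = (\<lambda>m. cot (pi * (x - \<beta> m)) - cot (pi * (x + \<beta> m)))"
  have M: "M > 0" using h by (simp add: M_def)
  have \<mu>: "\<mu> > 0" using l M by (simp add: \<mu>_def)
  define v where "v = complex_of_real (M * x - 1/2)"
  have v: "v \<notin> \<int>" using x unfolding v_def of_real_in_Ints_iff M_def .
  obtain c where c: "c > 0" "\<And>n::int. c * (1 + \<bar>real_of_int n\<bar>) \<le> norm (v + of_int n)"
    using norm_plus_int_ge[OF v] by blast
  define z where "z = (\<lambda>n::int. complex_of_real (M * (x + of_int n)))"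
  define w where "w = (\<lambda>m::int. complex_of_real (of_int m + 1/2))"
  define g where "g = (\<lambda>m::int. (if even m then - 1 else 1) * node_weight \<mu> m)"
  define T where "T = (\<lambda>n m. complex_of_real (g m) * (1 / (z n - w m) - 1 / (z n + w m)))"
  have zmw: "z n - w m = v + of_int (2 * int h * n - m)" "z n + w m = v + of_int (2 * int h * n - (- 1 - m))" for n m
    by (simp_all add: z_def w_def v_def M_def algebra_simps)
  have z: "z n - 1/2 \<notin> \<int>" for n
  proof
    assume "z n - 1/2 \<in> \<int>"
    then have "z n - 1/2 - of_int (2 * int h * n) \<in> \<int>" by (rule Ints_diff[OF _ Ints_of_int])
    also have "z n - 1/2 - of_int (2 * int h * n) = v" by (simp add: z_def v_def M_def algebra_simps)
    finally show False using v by simp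
  qed
  have K: "K_interp \<mu> (z n) = of_real (C / (2 * pi)) * (\<Sum>\<^sub>\<infinity>m. T n m)" for n
  proof -
    have "complex_of_real pi * z n = of_real (2 * pi * (real h * x + of_int (int h * n)))"
      by (simp add: z_def M_def algebra_simps)
    moreover have "cos (2 * pi * (real h * x + of_int (int h * n))) = Re (ee (real h * x + of_int (int h * n)))"
      by (simp add: ee_def)
    moreover have "\<dots> = C" unfolding ee_add ee_of_int by (simp add: ee_def C_def mult_ac)
    ultimately have "cos (of_real pi * z n) = of_real C" by (simp only: cos_of_real)
    then have "K_interp \<mu> (z n) = of_real (C / (2 * pi)) * (2 * K_series \<mu> (z n))"
      by (simp add: K_interp_off_nodes[OF \<mu> z])
    also have "2 * K_series \<mu> (z n) = (\<Sum>\<^sub>\<infinity>m. T n m)"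
      unfolding K_series_symmetric[OF \<mu> z] T_def w_def g_def ..
    finally show ?thesis .
  qed
  (* Both denominators are at least a constant times (1 + \<bar>n\<bar>) / (1 + \<bar>m\<bar>), and \<bar>w m\<bar> \<le> 1 + \<bar>m\<bar>. *)
  have T_bound: "norm (T n m) \<le> (4 / c\<^sup>2 * (1 / (1 + \<bar>real_of_int n\<bar>)\<^sup>2)) * (node_weight \<mu> m * (1 + \<bar>real_of_int m\<bar>) ^ 3)" for n m
  proof -
    define a where "a = 1 + \<bar>real_of_int n\<bar>"
    define d where "d = 1 + \<bar>real_of_int m\<bar>"
    have ad: "a > 0" "d \<ge> 1" by (auto simp: a_def d_def)
    have lower: "c * (a / (1 + \<bar>real_of_int k\<bar>)) \<le> norm (v + of_int (2 * int h * n - k))" for k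
    proof -
      have "a \<le> (1 + \<bar>real_of_int (2 * int h * n - k)\<bar>) * (1 + \<bar>real_of_int k\<bar>)"
        unfolding a_def using h by (intro int_shift_weight) auto
      then have "a / (1 + \<bar>real_of_int k\<bar>) \<le> 1 + \<bar>real_of_int (2 * int h * n - k)\<bar>"
        by (simp add: divide_le_eq)
      from order_trans[OF mult_left_mono[OF this, of c] c(2)] show ?thesis using c(1) by simp
    qed
    have lower': "c * (a / d) \<le> norm (z n - w m)" unfolding zmw d_def by (rule lower)
    have "c * (a / (2 * d)) \<le> c * (a / (1 + \<bar>real_of_int (- 1 - m)\<bar>))"
      using c(1) ad(1) by (intro mult_left_mono divide_left_mono) (auto simp: d_def)
    also have "\<dots> \<le> norm (z n + w m)" unfolding zmw by (rule lower)
    finally have lower'': "c * (a / (2 * d)) \<le> norm (z n + w m)" .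
    have posl: "0 < c * (a / d)" "0 < c * (a / (2 * d))" using c ad by auto
    then have nz: "z n - w m \<noteq> 0" "z n + w m \<noteq> 0" using lower' lower'' by auto
    have "1 / (z n - w m) - 1 / (z n + w m) = 2 * w m / ((z n - w m) * (z n + w m))"
      using nz by (simp add: field_simps)
    then have "norm (T n m) = node_weight \<mu> m * (2 * norm (w m) / (norm (z n - w m) * norm (z n + w m)))"
      using node_weight_pos[of \<mu> m] by (simp add: T_def norm_mult norm_divide g_def abs_mult)
    also have "\<dots> \<le> node_weight \<mu> m * (2 * d / ((c * (a / d)) * (c * (a / (2 * d)))))"
    proof (rule mult_left_mono[OF frac_le])
      show "2 * norm (w m) \<le> 2 * d" unfolding w_def norm_of_real d_def
        using abs_triangle_ineq[of "of_int m" "1/2 :: real"] by simp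
      show "0 < c * (a / d) * (c * (a / (2 * d)))" by (rule mult_pos_pos[OF posl])
      show "c * (a / d) * (c * (a / (2 * d))) \<le> norm (z n - w m) * norm (z n + w m)"
        by (rule mult_mono[OF lower' lower'' norm_ge_zero less_imp_le[OF posl(2)]])
    qed (use ad node_weight_pos[of \<mu> m] in auto)
    also have "\<dots> = (4 / c\<^sup>2 * (1 / a\<^sup>2)) * (node_weight \<mu> m * d ^ 3)"
      using c ad by (simp add: field_simps power2_eq_square power3_eq_cube)
    finally show ?thesis by (simp only: a_def d_def)
  qed
  have "(\<Sum>\<^sub>\<infinity>n. \<Sum>\<^sub>\<infinity>m. T n m) = (\<Sum>\<^sub>\<infinity>m. \<Sum>\<^sub>\<infinity>n. T n m)"
    by (rule infsum_swap_bound[OF summable_on_cmult_right[OF summable_on_int_inverse_square]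
          summable_on_node_weight_cube[OF \<mu>] T_bound])
       (auto simp: node_weight_def)
  moreover have "(\<Sum>\<^sub>\<infinity>n. T n m) = of_real (g m * (pi / M * D m))" for m
  proof -
    have notint: "complex_of_real (x - \<beta> m) \<notin> \<int>" "complex_of_real (x + \<beta> m) \<notin> \<int>"
      unfolding of_real_in_Ints_iff \<beta>_def M_def by (rule shifted_node_not_Ints[OF h x])+
    have "T n m = of_real (g m * (1 / M)) * (1 / (complex_of_real (x - \<beta> m) + of_int n) - 1 / (complex_of_real (x + \<beta> m) + of_int n))" for n
    proof -
      have e: "z n - w m = of_real M * (complex_of_real (x - \<beta> m) + of_int n)"
        "z n + w m = of_real M * (complex_of_real (x + \<beta> m) + of_int n)"
        using M by (simp_all add: z_def w_def \<beta>_def field_simps)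
      have "1 / (of_real M * A) - 1 / (of_real M * B) = of_real (1 / M) * (1 / A - 1 / B)" for A B :: complex
        by (simp add: right_diff_distrib)
      then show ?thesis unfolding T_def e by simp
    qed
    then have "(\<Sum>\<^sub>\<infinity>n. T n m) = of_real (g m * (1 / M)) * (\<Sum>\<^sub>\<infinity>n::int. 1 / (complex_of_real (x - \<beta> m) + of_int n) - 1 / (complex_of_real (x + \<beta> m) + of_int n))"
      by (simp only: infsum_cmult_right')
    also have "\<dots> = of_real (g m * (1 / M)) * (of_real pi * (cot (of_real pi * complex_of_real (x - \<beta> m)) - cot (of_real pi * complex_of_real (x + \<beta> m))))"
      unfolding infsumI[OF cot_diff_has_sum[OF notint]] ..
    also have "\<dots> = of_real (g m * (1 / M) * (pi * (cot (pi * (x - \<beta> m)) - cot (pi * (x + \<beta> m)))))"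
      by (simp only: of_real_mult of_real_diff cot_of_real)
    finally show ?thesis by (simp add: D_def)
  qed
  ultimately have "(\<Sum>\<^sub>\<infinity>n. K_interp \<mu> (z n)) = of_real (C / (2 * pi)) * (\<Sum>\<^sub>\<infinity>m. of_real (g m * (pi / M * D m)))"
    unfolding K infsum_cmult_right' by (simp only:)
  then have "of_real (sqrt l) * (\<Sum>\<^sub>\<infinity>n. K_interp \<mu> (z n)) = (\<Sum>\<^sub>\<infinity>m. of_real (sqrt l) * (of_real (C / (2 * pi)) * of_real (g m * (pi / M * D m))))"
    by (simp only: infsum_cmult_right')
  also have "\<dots> = (\<Sum>\<^sub>\<infinity>m. \<Sum>j\<in>J. complex_of_real (sqrt l / M * (node_weight \<mu> m * cos (2 * pi * (of_int j * \<beta> m)))) * ee (of_int j * x))"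
  proof (rule infsum_cong)
    fix m :: int
    have "complex_of_real ((if even m then - 1 else 1) * C * D m) = (\<Sum>j\<in>J. of_real (2 * cos (2 * pi * (of_int j * \<beta> m))) * ee (of_int j * x))"
      unfolding C_def D_def J_def
    proof (rule node_kernel[OF h])
      show "2 * real h * \<beta> m = of_int m + 1/2" using M by (simp add: \<beta>_def M_def)
      show "sin (pi * (x - \<beta> m)) \<noteq> 0" "sin (pi * (x + \<beta> m)) \<noteq> 0"
        unfolding \<beta>_def M_def by (rule sin_pi_nonzero shifted_node_not_Ints[OF h x])+
    qed
    moreover have "sqrt l * (C / (2 * pi) * (g m * (pi / M * D m))) = sqrt l / (2 * M) * node_weight \<mu> m * ((if even m then - 1 else 1) * C * D m)"
      by (simp add: g_def)
    ultimately have "of_real (sqrt l) * (of_real (C / (2 * pi)) * complex_of_real (g m * (pi / M * D m)))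
      = of_real (sqrt l / (2 * M) * node_weight \<mu> m) * (\<Sum>j\<in>J. of_real (2 * cos (2 * pi * (of_int j * \<beta> m))) * ee (of_int j * x))"
      by (simp only: of_real_mult[symmetric]) (simp only: of_real_mult)
    also have "\<dots> = (\<Sum>j\<in>J. complex_of_real (sqrt l / M * (node_weight \<mu> m * cos (2 * pi * (of_int j * \<beta> m)))) * ee (of_int j * x))"
      unfolding sum_distrib_left by (rule sum.cong) simp_all
    finally show "of_real (sqrt l) * (of_real (C / (2 * pi)) * complex_of_real (g m * (pi / M * D m)))
      = (\<Sum>j\<in>J. complex_of_real (sqrt l / M * (node_weight \<mu> m * cos (2 * pi * (of_int j * \<beta> m)))) * ee (of_int j * x))" .
  qed
  also have "\<dots> = (\<Sum>j\<in>J. complex_of_real (alias_coeff l h j) * ee (of_int j * x))"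
  proof (rule infsumI, rule has_sum_sum)
    fix j :: int
    show "((\<lambda>m. complex_of_real (sqrt l / M * (node_weight \<mu> m * cos (2 * pi * (of_int j * \<beta> m)))) * ee (of_int j * x))
        has_sum complex_of_real (alias_coeff l h j) * ee (of_int j * x)) UNIV"
      unfolding \<mu>_def \<beta>_def M_def by (intro has_sum_cmult_left has_sum_of_real alias_coeff_has_sum[OF l h])
  qed (simp add: J_def)
  finally show ?thesis by (simp only: interp_poly_def J_def \<mu>_def M_def z_def)
qed

text \<open>At a node every translate interpolates the Gaussian, so the sum is \<open>\<theta>\<^sub>3\<close> by Poisson summation; and
  \<open>\<theta>\<^sub>3\<close> agrees there with the polynomial because the cosine vanishes.\<close>

lemma K_periodization_at_nodes:
  assumes l: "l > 0" and h: "h > 0" and x: "2 * real h * x - 1/2 \<in> \<int>"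
  shows "of_real (sqrt l) * (\<Sum>\<^sub>\<infinity>n::int. K_interp (l / (2 * real h)\<^sup>2) (of_real (2 * real h * (x + of_int n)))) = interp_poly l h x"
proof -
  define M where "M = 2 * real h"
  have M: "M > 0" using h by (simp add: M_def)
  obtain i where i: "M * x - 1/2 = of_int i" using x by (auto simp: M_def elim: Ints_cases)
  have pos: "l / M\<^sup>2 > 0" using l M by simp
  have K: "K_interp (l / M\<^sup>2) (of_real (M * (x + of_int n))) = of_real (exp (- pi * l * (x + of_int n)\<^sup>2))" for n :: int
  proof -
    have e: "M * (x + of_int n) = of_int (i + 2 * int h * n) + 1/2" using i by (simp add: M_def algebra_simps)
    have "K_interp (l / M\<^sup>2) (of_real (M * (x + of_int n))) = of_real (node_weight (l / M\<^sup>2) (i + 2 * int h * n))"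
      unfolding e by (rule K_interp_at_node[OF pos])
    also have "node_weight (l / M\<^sup>2) (i + 2 * int h * n) = exp (- pi * l * (x + of_int n)\<^sup>2)"
      unfolding node_weight_def e[symmetric] using M by (simp add: power_mult_distrib)
    finally show ?thesis .
  qed
  have "of_real (sqrt l) * (\<Sum>\<^sub>\<infinity>n::int. K_interp (l / M\<^sup>2) (of_real (M * (x + of_int n)))) = theta3 (of_real x) (\<i> * of_real (1 / l))"
    unfolding K theta3_transformation[OF l] ..
  also have "\<dots> = interp_poly l h x"
  proof -
    have "2 * pi * real h * x = pi * (of_int i + 1/2)"
    proof -
      have "2 * pi * real h * x = pi * (M * x)" by (simp add: M_def)
      also have "M * x = of_int i + 1/2" using i by simp
      finally show ?thesis .
    qed
    then have "cos (2 * pi * real h * x) = 0" by (simp only: sin_cos_half_integer)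
    then show ?thesis using theta3_minus_interp_poly[OF l h, of x] by simp
  qed
  finally show ?thesis by (simp only: M_def)
qed

lemma k_poly_eq_interp_poly:
  assumes "l > 0"
  shows "k_poly l N = interp_poly l (Suc N)"
proof
  fix x
  have "(2 * of_nat N + 2) * (of_real x + of_int n) = complex_of_real (2 * real (Suc N) * (x + of_int n))" for n :: int
    by (simp add: algebra_simps)
  moreover have "2 * real N + 2 = 2 * real (Suc N)" by simp
  ultimately have "k_poly l N x = of_real (sqrt l) * (\<Sum>\<^sub>\<infinity>n::int. K_interp (l / (2 * real (Suc N))\<^sup>2) (of_real (2 * real (Suc N) * (x + of_int n))))"
    unfolding k_poly_def by (simp only:)
  also have "\<dots> = interp_poly l (Suc N) x"
    using K_periodization_off_nodes[OF assms, of "Suc N" x] K_periodization_at_nodes[OF assms, of "Suc N" x] by blast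
  finally show "k_poly l N x = interp_poly l (Suc N) x" .
qed

section \<open>Integration against an alternating sign\<close>

text \<open>The zeros of \<open>cos (2 \<pi> h x)\<close>, numbered from the last negative one so that the cosine has the sign
  \<open>(- 1) ^ i\<close> to the right of \<open>node h i\<close>.\<close>

definition node :: "nat \<Rightarrow> nat \<Rightarrow> real" where
  "node h i = (2 * real i - 1) / (4 * real h)"

abbreviation piece :: "nat \<Rightarrow> nat \<Rightarrow> real set" where
  "piece h i \<equiv> {node h i..node h (Suc i)}"

text \<open>The integral of \<open>f\<close> against the sign of \<open>cos (2 \<pi> h x)\<close> over a period, cut at the sign changes so that
  all integrands are continuous.\<close>

definition alt_integral :: "nat \<Rightarrow> (real \<Rightarrow> complex) \<Rightarrow> complex" where
  "alt_integral h f = (\<Sum>i<2 * h. (- 1) ^ i * integral (piece h i) f)"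

lemma node_mono: "h > 0 \<Longrightarrow> node h i \<le> node h (Suc i)"
  by (simp add: node_def divide_right_mono)

lemma node_less: "h > 0 \<Longrightarrow> node h i < node h (Suc i)"
  by (simp add: node_def divide_strict_right_mono)

lemma node_full_turn: "h > 0 \<Longrightarrow> node h (2 * h) = node h 0 + 1"
  by (simp add: node_def field_simps)

lemma cos_at_node:
  assumes "h > 0"
  shows "cos (2 * pi * real h * node h i) = 0"
proof -
  have "2 * pi * real h * node h i = pi * (of_int (int i - 1) + 1/2)"
    using assms by (simp add: node_def field_simps)
  then show ?thesis by (simp only: sin_cos_half_integer)
qed

lemma cos_sign_between_nodes:
  assumes "h > 0" "x \<in> piece h i"
  shows "0 \<le> (- 1) ^ i * cos (2 * pi * real h * x)"
proof -
  define t where "t = 2 * real h * x - real i"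
  have "2 * real h * node h i \<le> 2 * real h * x" "2 * real h * x \<le> 2 * real h * node h (Suc i)"
    using assms by auto
  moreover have "2 * real h * node h i = real i - 1/2" "2 * real h * node h (Suc i) = real i + 1/2"
    using assms(1) by (simp_all add: node_def field_simps)
  ultimately have "\<bar>t\<bar> \<le> 1/2" unfolding t_def by linarith
  then have "0 \<le> cos (pi * t)" by (rule cos_pi_nonneg)
  moreover have "cos (2 * pi * real h * x) = (- 1) ^ i * cos (pi * t)"
  proof -
    have "2 * pi * real h * x = real i * pi + pi * t" by (simp add: t_def algebra_simps)
    then show ?thesis by (simp add: cos_add)
  qed
  ultimately show ?thesis by (simp flip: power_add mult.assoc add: mult_2[symmetric])
qed

lemma sum_integral_nodes:
  fixes f :: "real \<Rightarrow> 'a :: banach"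
  assumes "continuous_on UNIV f" "\<And>x. f (x + 1) = f x" "h > 0"
  shows "(\<Sum>i<2 * h. integral (piece h i) f) = integral {0..1} f"
proof -
  have int: "f integrable_on {x..y}" for x y
    by (rule integrable_continuous_real[OF continuous_on_subset[OF assms(1)]]) simp
  have "(\<Sum>i<n. integral (piece h i) f) = integral {node h 0..node h n} f" for n
  proof (induction n)
    case (Suc n)
    have "node h 0 \<le> node h n" unfolding node_def by (rule divide_right_mono) auto
    from Henstock_Kurzweil_Integration.integral_combine[OF this node_mono[OF assms(3), of n] int]
    show ?case using Suc by simp
  qed simp
  then show ?thesis using integral_periodic[OF assms(1,2), of "node h 0"] by (simp add: node_full_turn[OF assms(3)])
qed

lemma alt_integral_diff:
  assumes "continuous_on UNIV f" "continuous_on UNIV g"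
  shows "alt_integral h (\<lambda>x. f x - g x) = alt_integral h f - alt_integral h g"
proof -
  have "integral {a..b} (\<lambda>x. f x - g x) = integral {a..b} f - integral {a..b} g" for a b
    by (intro integral_diff integrable_continuous_real continuous_on_subset[OF assms(1)]
        continuous_on_subset[OF assms(2)]) auto
  then show ?thesis by (simp add: alt_integral_def right_diff_distrib sum_subtractf)
qed

lemma alt_integral_sum:
  assumes "finite J" "\<And>j. j \<in> J \<Longrightarrow> continuous_on UNIV (f j)"
  shows "alt_integral h (\<lambda>x. \<Sum>j\<in>J. c j * f j x) = (\<Sum>j\<in>J. c j * alt_integral h (f j))"
proof -
  have "integral {a..b} (\<lambda>x. \<Sum>j\<in>J. c j * f j x) = (\<Sum>j\<in>J. c j * integral {a..b} (f j))" for a b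
  proof -
    have "f j integrable_on {a..b}" if "j \<in> J" for j
      by (rule integrable_continuous_real[OF continuous_on_subset[OF assms(2)[OF that]]]) simp
    then show ?thesis using assms(1) by (simp add: integral_sum integrable_on_mult_right integral_mult_right)
  qed
  then have "alt_integral h (\<lambda>x. \<Sum>j\<in>J. c j * f j x) = (\<Sum>i<2 * h. \<Sum>j\<in>J. c j * ((- 1) ^ i * integral (piece h i) (f j)))"
    by (simp add: alt_integral_def sum_distrib_left mult_ac)
  also have "\<dots> = (\<Sum>j\<in>J. c j * alt_integral h (f j))"
    by (subst sum.swap) (simp add: alt_integral_def sum_distrib_left)
  finally show ?thesis .
qed

lemma norm_alt_integral_le:
  assumes "continuous_on UNIV f" "\<And>x. f (x + 1) = f x" "h > 0"
  shows "norm (alt_integral h f) \<le> integral {0..1} (\<lambda>x. norm (f x))"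
proof -
  have cont: "continuous_on S f" for S using continuous_on_subset[OF assms(1)] by simp
  have "norm (alt_integral h f) \<le> (\<Sum>i<2 * h. norm ((- 1) ^ i * integral (piece h i) f))"
    unfolding alt_integral_def by (rule norm_sum)
  also have "\<dots> \<le> (\<Sum>i<2 * h. integral (piece h i) (\<lambda>x. norm (f x)))"
  proof (rule sum_mono)
    fix i
    show "norm ((- 1) ^ i * integral (piece h i) f) \<le> integral (piece h i) (\<lambda>x. norm (f x))"
      unfolding norm_mult norm_power norm_minus_cancel norm_one power_one mult_1
      by (rule integral_norm_bound_integral) (auto intro!: integrable_continuous_real continuous_intros cont)
  qed
  also have "\<dots> = integral {0..1} (\<lambda>x. norm (f x))"
    using assms by (intro sum_integral_nodes continuous_intros) auto
  finally show ?thesis .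
qed

lemma alt_integral_eq_norm:
  assumes "continuous_on UNIV f" "\<And>x. f (x + 1) = f x" "h > 0"
    and sign: "\<And>i x. x \<in> piece h i \<Longrightarrow> 0 \<le> (- 1) ^ i * f x"
  shows "alt_integral h f = of_real (integral {0..1} (\<lambda>x. norm (f x)))"
proof -
  have cont: "continuous_on S f" for S using continuous_on_subset[OF assms(1)] by simp
  have "(- 1) ^ i * integral (piece h i) f = of_real (integral (piece h i) (\<lambda>x. norm (f x)))" for i
  proof -
    have "(- 1) ^ i * integral (piece h i) f = integral (piece h i) (\<lambda>x. (- 1) ^ i * f x)"
      by (simp add: integral_mult_right)
    also have "\<dots> = integral (piece h i) (\<lambda>x. of_real (norm (f x)))"
    proof (rule integral_cong)
      fix x assume "x \<in> piece h i"
      from sign[OF this] have "(- 1) ^ i * f x = of_real (norm ((- 1) ^ i * f x))"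
        by (simp add: less_eq_complex_def complex_eq_iff cmod_def)
      then show "(- 1) ^ i * f x = of_real (norm (f x))" by (simp add: norm_mult norm_power)
    qed
    also have "\<dots> = of_real (integral (piece h i) (\<lambda>x. norm (f x)))"
      using integral_linear[OF integrable_continuous_real bounded_linear_of_real, of "node h i" "node h (Suc i)" "\<lambda>x. norm (f x)"]
      by (auto simp: o_def intro!: continuous_intros cont)
    finally show ?thesis .
  qed
  then have "alt_integral h f = of_real (\<Sum>i<2 * h. integral (piece h i) (\<lambda>x. norm (f x)))"
    by (simp add: alt_integral_def)
  also have "(\<Sum>i<2 * h. integral (piece h i) (\<lambda>x. norm (f x))) = integral {0..1} (\<lambda>x. norm (f x))"
    using assms by (intro sum_integral_nodes continuous_intros) auto
  finally show ?thesis .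
qed

text \<open>Equality forces \<open>f\<close> to be real with sign \<open>(- 1) ^ i\<close> on the \<open>i\<close>-th piece. A node belongs to two
  pieces of opposite sign, so \<open>f\<close> vanishes there.\<close>

lemma alt_integral_extremal_zero:
  assumes "continuous_on UNIV f" "\<And>x. f (x + 1) = f x" "h > 0"
    and eq: "alt_integral h f = of_real (integral {0..1} (\<lambda>x. norm (f x)))" and "i < 2 * h"
  shows "f (node h i) = 0"
proof -
  have cont: "continuous_on S f" for S using continuous_on_subset[OF assms(1)] by simp
  define d where "d = (\<lambda>i x. norm (f x) - Re ((- 1) ^ i * f x))"
  have d_cont: "continuous_on S (d i)" for S i unfolding d_def by (intro continuous_intros cont)
  have d_nonneg: "0 \<le> d i x" for i x
    using complex_Re_le_cmod[of "(- 1) ^ i * f x"] by (simp add: d_def norm_mult norm_power)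
  have d_int: "integral {a..b} (d i) = integral {a..b} (\<lambda>x. norm (f x)) - Re ((- 1) ^ i * integral {a..b} f)" for a b i
  proof -
    have "integral {a..b} (\<lambda>x. Re ((- 1) ^ i * f x)) = Re (integral {a..b} (\<lambda>x. (- 1) ^ i * f x))"
    proof -
      have "(\<lambda>x. (- 1) ^ i * f x) integrable_on {a..b}"
        by (intro integrable_continuous_real continuous_intros cont)
      from integral_linear[OF this bounded_linear_Re] show ?thesis by (simp only: o_def)
    qed
    then show ?thesis
      unfolding d_def by (subst integral_diff) (auto intro!: integrable_continuous_real continuous_intros cont simp: integral_mult_right)
  qed
  have "(\<Sum>i<2 * h. integral (piece h i) (d i))
      = (\<Sum>i<2 * h. integral (piece h i) (\<lambda>x. norm (f x))) - Re (alt_integral h f)"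
    unfolding d_int by (simp add: sum_subtractf alt_integral_def)
  also have "(\<Sum>i<2 * h. integral (piece h i) (\<lambda>x. norm (f x))) = integral {0..1} (\<lambda>x. norm (f x))"
    using assms by (intro sum_integral_nodes continuous_intros) auto
  finally have "(\<Sum>i<2 * h. integral (piece h i) (d i)) = 0" by (simp add: eq)
  moreover have "0 \<le> integral (piece h i) (d i)" for i
    using d_nonneg by (intro integral_nonneg integrable_continuous_real d_cont)
  ultimately have zero: "integral (piece h i) (d i) = 0" if "i < 2 * h" for i
    using that sum_nonneg_eq_0_iff[of "{..<2 * h}" "\<lambda>i. integral (piece h i) (d i)"] by auto
  have d0: "d i x = 0" if "i < 2 * h" "x \<in> piece h i" for i x
    using integral_eq_0_iff[OF d_cont node_less[OF assms(3)], of i i] zero[OF that(1)] d_nonneg that(2) by auto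
  have both: "f x = 0" if "d j x = 0" "d k x = 0" "even j \<noteq> even k" for j k x
  proof -
    have "norm (f x) = (- 1) ^ j * Re (f x)" "norm (f x) = (- 1) ^ k * Re (f x)"
      using that(1,2) by (simp_all add: d_def uminus_power_if split: if_splits)
    then have "norm (f x) = 0" using that(3) by (auto simp: uminus_power_if split: if_splits)
    then show ?thesis by simp
  qed
  have left: "node h i \<in> piece h i" and right: "node h (Suc i) \<in> piece h i" for i
    using node_mono[OF assms(3)] by auto
  have di: "d i (node h i) = 0" by (rule d0[OF assms(5) left])
  show ?thesis
  proof (cases i)
    case (Suc j)
    have "d j (node h i) = 0" unfolding Suc by (rule d0[OF _ right]) (use assms(5) Suc in simp)
    from both[OF di this] show ?thesis using Suc by simp
  next
    case 0
    define j where "j = 2 * h - 1"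
    have j: "j < 2 * h" "Suc j = 2 * h" "odd j" using assms(3) by (auto simp: j_def)
    (* The first node is a translate of the right end of the last piece, whose index is odd. *)
    have "f (node h (Suc j)) = f (node h i)" unfolding j(2) node_full_turn[OF assms(3)] 0 by (rule assms(2))
    then have "d j (node h i) = 0" using d0[OF j(1) right] by (simp add: d_def)
    from both[OF di this] show ?thesis using j(3) 0 by simp
  qed
qed

section \<open>Trigonometric polynomials and the alternating integral\<close>

lemma sum_ee_powers:
  assumes "h > 0" "\<epsilon> ^ (2 * h) = 1"
  shows "(\<Sum>i<2 * h. ee (of_int n / (2 * real h)) ^ i * \<epsilon> ^ i) = (if ee (of_int n / (2 * real h)) * \<epsilon> = 1 then of_nat (2 * h) else 0)"
proof -
  define r where "r = ee (of_int n / (2 * real h)) * \<epsilon>"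
  have "ee (of_int n / (2 * real h)) ^ (2 * h) = ee (of_int n)"
    unfolding ee_power using assms(1) by (simp add: field_simps)
  then have "r ^ (2 * h) = 1" using assms(2) by (simp add: r_def power_mult_distrib)
  then show ?thesis
    using geometric_sum[of r "2 * h"] by (auto simp: power_mult_distrib[symmetric] r_def[symmetric])
qed

text \<open>Translation by \<open>1 / (2 h)\<close> flips the sign pattern and multiplies the character by
  \<open>e(n / (2 h))\<close>. Hence the integral vanishes unless this factor is \<open>- 1\<close>, that is, unless \<open>n\<close> is an odd
  multiple of \<open>h\<close>.\<close>

lemma alt_integral_ee:
  assumes "h > 0"
  shows "alt_integral h (\<lambda>x. ee (of_int n * x)) =
    (if \<exists>s. n = (2 * s + 1) * int h then 2 * of_nat h * integral {- 1 / (4 * real h)..1 / (4 * real h)} (\<lambda>x. ee (of_int n * x)) else 0)"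
proof -
  define J where "J = integral {node h 0..node h 1} (\<lambda>x. ee (of_int n * x))"
  have J: "integral (piece h i) (\<lambda>x. ee (of_int n * x)) = ee (of_int n / (2 * real h)) ^ i * J" for i
  proof -
    define c where "c = real i / (2 * real h)"
    have "node h 0 + c = node h i" "node h 1 + c = node h (Suc i)"
      using assms by (simp_all add: c_def node_def field_simps)
    then have "integral (piece h i) (\<lambda>x. ee (of_int n * x)) = integral {node h 0..node h 1} (\<lambda>x. ee (of_int n * (c + x)))"
      using integral_shift_Icc_real[of "node h 0" "node h 1" "\<lambda>x. ee (of_int n * x)" c] by (simp add: o_def)
    also have "\<dots> = ee (of_int n * c) * J"
      unfolding distrib_left ee_add J_def by (rule integral_mult_right)
    also have "ee (of_int n * c) = ee (of_int n / (2 * real h)) ^ i"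
      unfolding ee_power c_def by (simp add: mult.commute)
    finally show ?thesis .
  qed
  have "alt_integral h (\<lambda>x. ee (of_int n * x)) = (\<Sum>i<2 * h. ee (of_int n / (2 * real h)) ^ i * (- 1) ^ i) * J"
    unfolding alt_integral_def J sum_distrib_right by (simp add: mult_ac)
  also have "\<dots> = (if ee (of_int n / (2 * real h)) * (- 1) = 1 then of_nat (2 * h) else 0) * J"
    by (subst sum_ee_powers[OF assms]) auto
  also have "(ee (of_int n / (2 * real h)) * (- 1) = 1) = (\<exists>s. n = (2 * s + 1) * int h)"
  proof -
    have "ee (of_int n / (2 * real h)) * (- 1) = ee (of_int n / (2 * real h) - 1/2)"
      unfolding ee_diff by (simp add: ee_minus)
    also have "\<dots> = 1 \<longleftrightarrow> (\<exists>s::int. of_int n / (2 * real h) - 1/2 = of_int s)"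
      unfolding ee_eq_1_iff by (auto elim: Ints_cases)
    also have "\<dots> \<longleftrightarrow> (\<exists>s. n = (2 * s + 1) * int h)"
    proof (rule ex_cong1)
      fix s :: int
      have "of_int n / (2 * real h) - 1/2 = of_int s \<longleftrightarrow> real_of_int n = of_int ((2 * s + 1) * int h)"
        using assms by (auto simp: field_simps)
      then show "of_int n / (2 * real h) - 1/2 = of_int s \<longleftrightarrow> n = (2 * s + 1) * int h"
        by (simp only: of_int_eq_iff)
    qed
    finally show ?thesis .
  qed
  also have "J = integral {- 1 / (4 * real h)..1 / (4 * real h)} (\<lambda>x. ee (of_int n * x))"
    by (simp add: J_def node_def)
  finally show ?thesis by simp
qed

lemma alt_integral_low_degree:
  assumes "\<bar>n\<bar> < int h"
  shows "alt_integral h (\<lambda>x. ee (of_int n * x)) = 0"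
proof -
  have "n \<noteq> (2 * s + 1) * int h" for s
  proof
    assume "n = (2 * s + 1) * int h"
    then have "\<bar>n\<bar> = \<bar>2 * s + 1\<bar> * int h" by (simp add: abs_mult)
    moreover have "1 \<le> \<bar>2 * s + 1\<bar>" by presburger
    then have "1 * int h \<le> \<bar>2 * s + 1\<bar> * int h" by (intro mult_right_mono) auto
    ultimately show False using assms by simp
  qed
  moreover have "h > 0" using assms by (cases h) auto
  ultimately show ?thesis by (simp add: alt_integral_ee)
qed

text \<open>Discrete orthogonality: the \<open>2 (N + 1)\<close> nodes are equally spaced, and the frequencies differ by at
  most \<open>2 N\<close>.\<close>

lemma coefficients_zero_if_zero_at_nodes:
  assumes zero: "\<And>i. i < 2 * Suc N \<Longrightarrow> (\<Sum>n = - int N..int N. d n * ee (of_int n * node (Suc N) i)) = 0"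
    and j: "j \<in> {- int N..int N}"
  shows "d j = 0"
proof -
  define h where "h = Suc N"
  have h: "h > 0" by (simp add: h_def)
  have inner: "(\<Sum>i<2 * h. ee (of_int n * node h i) * ee (- (of_int j * node h i))) = (if n = j then of_nat (2 * h) else 0)"
    if n: "n \<in> {- int N..int N}" for n
  proof -
    have "ee (of_int n * node h i) * ee (- (of_int j * node h i)) = ee (- of_int (n - j) / (4 * real h)) * (ee (of_int (n - j) / (2 * real h)) ^ i * 1 ^ i)" for i
    proof -
      have node_eq: "node h i = real i / (2 * real h) - 1 / (4 * real h)"
        using h by (simp add: node_def diff_divide_distrib)
      have "k * node h i = - k / (4 * real h) + real i * (k / (2 * real h))" for k
        unfolding node_eq by (simp add: right_diff_distrib)
      moreover have "of_int n * node h i + - (of_int j * node h i) = of_int (n - j) * node h i" by (simp add: algebra_simps)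
      ultimately have "of_int n * node h i + - (of_int j * node h i) = - of_int (n - j) / (4 * real h) + real i * (of_int (n - j) / (2 * real h))"
        by (simp only:)
      then show ?thesis unfolding ee_power power_one mult_1_right ee_add[symmetric] by (simp only:)
    qed
    then have "(\<Sum>i<2 * h. ee (of_int n * node h i) * ee (- (of_int j * node h i)))
        = ee (- of_int (n - j) / (4 * real h)) * (if ee (of_int (n - j) / (2 * real h)) * 1 = 1 then of_nat (2 * h) else 0)"
      by (simp only: sum_distrib_left[symmetric] sum_ee_powers[OF h power_one])
    also have "\<dots> = (if n = j then of_nat (2 * h) else 0)"
    proof (cases "n = j")
      case False
      have "ee (of_int (n - j) / (2 * real h)) \<noteq> 1"
      proof
        assume "ee (of_int (n - j) / (2 * real h)) = 1"
        then obtain k where "of_int (n - j) / (2 * real h) = of_int k" unfolding ee_eq_1_iff by (auto elim: Ints_cases)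
        then have "real_of_int (n - j) = of_int (k * (2 * int h))" using h by (simp add: field_simps)
        then have "n - j = k * (2 * int h)" by (simp only: of_int_eq_iff)
        then have "2 * int h dvd n - j" by simp
        moreover have "\<bar>n - j\<bar> < 2 * int h" using n j by (auto simp: h_def)
        ultimately show False using False by (meson dvd_imp_le_int eq_iff_diff_eq_0 not_le abs_ge_self order.trans)
      qed
      then show ?thesis using False by simp
    qed simp
    finally show ?thesis .
  qed
  have "0 = (\<Sum>i<2 * h. (\<Sum>n = - int N..int N. d n * ee (of_int n * node h i)) * ee (- (of_int j * node h i)))"
    using zero by (simp add: h_def)
  also have "\<dots> = (\<Sum>n = - int N..int N. d n * (\<Sum>i<2 * h. ee (of_int n * node h i) * ee (- (of_int j * node h i))))"
    unfolding sum_distrib_right sum_distrib_left by (subst sum.swap) (simp only: mult.assoc)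
  also have "\<dots> = (\<Sum>n = - int N..int N. d n * (if n = j then of_nat (2 * h) else 0))"
    by (intro sum.cong refl) (simp only: inner)
  also have "\<dots> = d j * of_nat (2 * h)" using j by (simp add: if_distrib cong: if_cong)
  finally show ?thesis using h by simp
qed

section \<open>The extremal value\<close>

lemma theta3_continuous:
  assumes "l > 0"
  shows "continuous_on S (\<lambda>x. theta3 (of_real x) (\<i> * of_real (1 / l)))"
  unfolding theta3_gauss_coeff
  by (rule continuous_on_infsum[OF _ _ summable_on_gauss_coeff[OF assms]])
     (auto intro!: continuous_intros simp: norm_mult gauss_coeff_def)

text \<open>Only the frequencies \<open>(2 s + 1) h\<close> survive. Their Gaussian coefficients are those of \<open>\<theta>\<^sub>1\<close>, and the
  substitution \<open>u = 2 h x\<close> maps the central piece \<open>\<bar>x\<bar> \<le> 1 / (4 h)\<close> onto \<open>\<bar>u\<bar> \<le> 1/2\<close>.\<close>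

lemma alt_integral_theta3:
  assumes l: "l > 0" and h: "h > 0"
  shows "alt_integral h (\<lambda>x. theta3 (of_real x) (\<i> * of_real (1 / l)))
     = integral {- 1/2..1/2} (\<lambda>u. theta1 (of_real u) (\<i> * of_real ((2 * real h)\<^sup>2 / l)))"
proof -
  define q where "q = (\<lambda>n::int. complex_of_real (gauss_coeff l (of_int n)))"
  have "((\<lambda>n. integral {a..b} (\<lambda>x. q n * ee (of_int n * x))) has_sum
      integral {a..b} (\<lambda>x. theta3 (of_real x) (\<i> * of_real (1 / l)))) UNIV" for a b
    unfolding theta3_gauss_coeff q_def
    by (rule has_sum_integral[OF _ _ summable_on_gauss_coeff[OF l]])
       (auto intro!: continuous_intros simp: norm_mult gauss_coeff_def)
  then have "((\<lambda>n. \<Sum>i<2 * h. (- 1) ^ i * integral (piece h i) (\<lambda>x. q n * ee (of_int n * x))) has_sum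
      alt_integral h (\<lambda>x. theta3 (of_real x) (\<i> * of_real (1 / l)))) UNIV"
    unfolding alt_integral_def by (intro has_sum_sum has_sum_cmult_right) auto
  moreover have "(\<Sum>i<2 * h. (- 1) ^ i * integral (piece h i) (\<lambda>x. q n * ee (of_int n * x)))
      = q n * alt_integral h (\<lambda>x. ee (of_int n * x))" for n
    by (simp add: alt_integral_def sum_distrib_left integral_mult_right mult_ac)
  ultimately have "((\<lambda>n. q n * alt_integral h (\<lambda>x. ee (of_int n * x))) has_sum
      alt_integral h (\<lambda>x. theta3 (of_real x) (\<i> * of_real (1 / l)))) UNIV" by (simp only:)
  then have "((\<lambda>n. q n * alt_integral h (\<lambda>x. ee (of_int n * x))) has_sum
      alt_integral h (\<lambda>x. theta3 (of_real x) (\<i> * of_real (1 / l)))) (range (\<lambda>s. (2 * s + 1) * int h))"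
  proof (rule has_sum_cong_neutral[THEN iffD1, rotated -1])
    fix n assume "n \<in> UNIV - range (\<lambda>s. (2 * s + 1) * int h)"
    then have "\<not> (\<exists>s. n = (2 * s + 1) * int h)" by auto
    then show "q n * alt_integral h (\<lambda>x. ee (of_int n * x)) = 0" by (simp only: alt_integral_ee[OF h] if_False mult_zero_right)
  qed auto
  moreover have "inj (\<lambda>s. (2 * s + 1) * int h)" using h by (auto intro!: injI)
  ultimately have hs: "((\<lambda>s. q ((2 * s + 1) * int h) * alt_integral h (\<lambda>x. ee (of_int ((2 * s + 1) * int h) * x))) has_sum
      alt_integral h (\<lambda>x. theta3 (of_real x) (\<i> * of_real (1 / l)))) UNIV"
    by (simp add: has_sum_reindex o_def)
  define b where "b = (2 * real h)\<^sup>2 / l"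
  have b: "b > 0" using l h by (simp add: b_def)
  have "((\<lambda>s::int. integral {- 1/2..1/2} (\<lambda>u. of_real (exp (- pi * b * (of_int s + 1/2)\<^sup>2)) * ee ((of_int s + 1/2) * u))) has_sum
      integral {- 1/2..1/2} (\<lambda>u. theta1 (of_real u) (\<i> * of_real b))) UNIV"
    unfolding theta1_imag
    by (rule has_sum_integral[OF _ _ summable_on_theta1_coeffs[OF b]])
       (auto intro!: continuous_intros simp: norm_mult)
  moreover have "integral {- 1/2..1/2} (\<lambda>u. of_real (exp (- pi * b * (of_int s + 1/2)\<^sup>2)) * ee ((of_int s + 1/2) * u))
      = q ((2 * s + 1) * int h) * alt_integral h (\<lambda>x. ee (of_int ((2 * s + 1) * int h) * x))" for s :: int
  proof -
    define c where "c = real_of_int s + 1/2"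
    have c: "c \<noteq> 0"
    proof
      assume "c = 0"
      then have "real_of_int (2 * s + 1) = of_int 0" by (simp add: c_def)
      then have "2 * s + 1 = 0" by (simp only: of_int_eq_iff)
      then show False by presburger
    qed
    have n: "real_of_int ((2 * s + 1) * int h) = 2 * real h * c" by (simp add: c_def algebra_simps)
    have 1: "integral {- 1/2..1/2} (\<lambda>u. ee (c * u)) = (ee (c / 2) - ee (- (c / 2))) / (2 * pi * c * \<i>)"
      using integral_unique[OF has_integral_ee[OF c, of "- 1/2" "1/2"]] by simp
    have "2 * real h * c * (1 / (4 * real h)) = c / 2" "2 * real h * c * (- 1 / (4 * real h)) = - (c / 2)"
      using h by (simp_all add: field_simps)
    then have 2: "integral {- 1 / (4 * real h)..1 / (4 * real h)} (\<lambda>x. ee (2 * real h * c * x))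
        = (ee (c / 2) - ee (- (c / 2))) / (2 * pi * (2 * real h * c) * \<i>)"
      using integral_unique[OF has_integral_ee[of "2 * real h * c" "- 1 / (4 * real h)" "1 / (4 * real h)"]] c h by (simp add: divide_right_mono)
    have "alt_integral h (\<lambda>x. ee (of_int ((2 * s + 1) * int h) * x)) = 2 * of_nat h * integral {- 1 / (4 * real h)..1 / (4 * real h)} (\<lambda>x. ee (2 * real h * c * x))"
      using alt_integral_ee[OF h, of "(2 * s + 1) * int h"] unfolding n by auto
    also have "\<dots> = integral {- 1/2..1/2} (\<lambda>u. ee (c * u))" 
    proof -
      have "2 * of_nat h * (W / (2 * pi * (2 * real h * c) * \<i>)) = W / (2 * pi * c * \<i>)" for W
        using h c by (simp add: field_simps)
      then show ?thesis unfolding 1 2 .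
    qed
    finally have 3: "alt_integral h (\<lambda>x. ee (of_int ((2 * s + 1) * int h) * x)) = integral {- 1/2..1/2} (\<lambda>u. ee (c * u))" .
    have "q ((2 * s + 1) * int h) = of_real (exp (- pi * b * c\<^sup>2))"
      unfolding q_def gauss_coeff_def n b_def by (simp add: power_mult_distrib)
    then show ?thesis unfolding 3 c_def[symmetric] by (simp add: integral_mult_right)
  qed
  ultimately show ?thesis using has_sum_unique[OF hs] by (simp only: b_def)
qed

lemma interp_poly_expansion: "interp_poly l (Suc N) x = (\<Sum>n = - int N..int N. of_real (alias_coeff l (Suc N) n) * ee (of_int n * x))"
  by (simp add: interp_poly_def)

lemma alt_integral_trig_poly:
  assumes "\<And>x. p x = (\<Sum>n = - int N..int N. c n * ee (of_int n * x))"
  shows "alt_integral (Suc N) p = 0"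
proof -
  have "alt_integral (Suc N) p = alt_integral (Suc N) (\<lambda>x. \<Sum>n = - int N..int N. c n * ee (of_int n * x))"
    by (rule arg_cong[where f = "alt_integral (Suc N)"]) (use assms in auto)
  also have "\<dots> = (\<Sum>n = - int N..int N. c n * alt_integral (Suc N) (\<lambda>x. ee (of_int n * x)))"
    by (rule alt_integral_sum) (auto intro!: continuous_intros)
  also have "\<dots> = 0"
  proof (intro sum.neutral ballI)
    fix n assume "n \<in> {- int N..int N}"
    then have "\<bar>n\<bar> < int (Suc N)" by auto
    then show "c n * alt_integral (Suc N) (\<lambda>x. ee (of_int n * x)) = 0"
      by (simp only: alt_integral_low_degree mult_zero_right)
  qed
  finally show ?thesis .
qed

theorem theorem5:
  fixes l :: real and N :: nat and p :: "real \<Rightarrow> complex"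
  assumes "l > 0" and "trig_poly N p"
  shows "integral {-1/2..1/2} (\<lambda>u::real. theta1 (of_real u) (\<i> * of_real ((2 * real N + 2)\<^sup>2 / l)))
           \<le> complex_of_real (integral {0..1} (\<lambda>x::real. norm (theta3 (of_real x) (\<i> * of_real (1 / l)) - p x)))
       \<and> (integral {-1/2..1/2} (\<lambda>u::real. theta1 (of_real u) (\<i> * of_real ((2 * real N + 2)\<^sup>2 / l)))
           = complex_of_real (integral {0..1} (\<lambda>x::real. norm (theta3 (of_real x) (\<i> * of_real (1 / l)) - p x)))
         \<longleftrightarrow> p = k_poly l N)"
proof -
  define h where "h = Suc N"
  have h: "h > 0" by (simp add: h_def)
  define \<Theta> where "\<Theta> = (\<lambda>x. theta3 (of_real x) (\<i> * of_real (1 / l)))"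
  define P where "P = interp_poly l h"
  define L where "L = integral {-1/2..1/2} (\<lambda>u::real. theta1 (of_real u) (\<i> * of_real ((2 * real N + 2)\<^sup>2 / l)))"
  have \<Theta>_cont: "continuous_on S \<Theta>" for S unfolding \<Theta>_def by (rule theta3_continuous[OF assms(1)])
  have \<Theta>_per: "\<Theta> (x + 1) = \<Theta> x" for x
    unfolding \<Theta>_def theta3_gauss_coeff ee_mult_int_shift ..
  have L: "alt_integral h \<Theta> = L"
  proof -
    have "2 * real N + 2 = 2 * real h" by (simp add: h_def)
    then show ?thesis unfolding L_def \<Theta>_def by (simp only: alt_integral_theta3[OF assms(1) h])
  qed
  obtain c where c: "\<And>x. p x = (\<Sum>n = - int N..int N. c n * ee (of_int n * x))"
  proof -
    obtain c where "\<forall>x. p x = (\<Sum>n = - int N..int N. c n * e_char (of_int n * of_real x))"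
      using assms(2) unfolding trig_poly_def by blast
    moreover have "e_char (of_int n * of_real x) = ee (of_int n * x)" for n :: int and x
      by (simp flip: e_char_of_real)
    ultimately show ?thesis by (intro that[of c]) simp
  qed
  have poly_cont: "continuous_on S r" and poly_per: "r (x + 1) = r x"
    and poly_alt: "alt_integral h (\<lambda>x. \<Theta> x - r x) = L"
    if r: "\<And>x. r x = (\<Sum>n = - int N..int N. a n * ee (of_int n * x))" for r a S x
  proof -
    have r_eq: "r = (\<lambda>x. \<Sum>n = - int N..int N. a n * ee (of_int n * x))" using r by blast
    have cont: "continuous_on S r" for S unfolding r_eq by (intro continuous_intros)
    then show "continuous_on S r" .
    show "r (x + 1) = r x" unfolding r_eq ee_mult_int_shift ..
    have "alt_integral h r = 0" unfolding h_def by (rule alt_integral_trig_poly[OF r])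
    then show "alt_integral h (\<lambda>x. \<Theta> x - r x) = L" using alt_integral_diff[OF \<Theta>_cont cont] by (simp add: L)
  qed
  have P: "P x = (\<Sum>n = - int N..int N. of_real (alias_coeff l h n) * ee (of_int n * x))" for x
    unfolding P_def h_def by (rule interp_poly_expansion)
  have sign: "0 \<le> (- 1) ^ i * (\<Theta> x - P x)" if "x \<in> piece h i" for i x
  proof -
    let ?F = "\<Sum>\<^sub>\<infinity>j::int. complex_of_real (error_coeff l h j) * ee (of_int j * x)"
    have "(- 1) ^ i * (\<Theta> x - P x) = of_real (2 * ((- 1) ^ i * cos (2 * pi * real h * x))) * ?F"
      unfolding \<Theta>_def P_def theta3_minus_interp_poly[OF assms(1) h] by simp
    also have "0 \<le> \<dots>"
      using cos_sign_between_nodes[OF h that] error_series_nonneg[OF assms(1) h, of x]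
      by (intro mult_nonneg_nonneg) (simp_all add: less_eq_complex_def)
    finally show ?thesis .
  qed
  (* The error of P has the sign of the cosine, so P attains the bound. *)
  have extremal: "L = of_real (integral {0..1} (\<lambda>x. norm (\<Theta> x - P x)))"
    unfolding poly_alt[OF P, symmetric]
    by (rule alt_integral_eq_norm[OF _ _ h sign])
       (auto intro!: continuous_intros \<Theta>_cont poly_cont[OF P] simp: \<Theta>_per poly_per[OF P])
  have p_cont: "continuous_on UNIV (\<lambda>x. \<Theta> x - p x)" by (intro continuous_intros \<Theta>_cont poly_cont[OF c])
  have p_per: "\<Theta> (x + 1) - p (x + 1) = \<Theta> x - p x" for x by (simp add: \<Theta>_per poly_per[OF c])
  have "norm L \<le> integral {0..1} (\<lambda>x. norm (\<Theta> x - p x))"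
    unfolding poly_alt[OF c, symmetric] by (rule norm_alt_integral_le[OF p_cont p_per h])
  then have le: "L \<le> complex_of_real (integral {0..1} (\<lambda>x. norm (\<Theta> x - p x)))"
    using complex_Re_le_cmod[of L] unfolding less_eq_complex_def by (simp add: extremal)
  (* Equality forces p to interpolate theta3 at the 2 h nodes, as P does. *)
  have "p = P" if eq: "L = complex_of_real (integral {0..1} (\<lambda>x. norm (\<Theta> x - p x)))"
  proof -
    have "(\<Sum>n = - int N..int N. (c n - of_real (alias_coeff l h n)) * ee (of_int n * node h i)) = 0" if "i < 2 * h" for i
    proof -
      have "\<Theta> (node h i) - p (node h i) = 0"
        by (rule alt_integral_extremal_zero[OF p_cont p_per h _ that]) (simp only: poly_alt[OF c] eq)
      moreover have "\<Theta> (node h i) - P (node h i) = 0"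
        unfolding \<Theta>_def P_def theta3_minus_interp_poly[OF assms(1) h] cos_at_node[OF h] by simp
      ultimately have "p (node h i) - P (node h i) = 0" by simp
      then show ?thesis unfolding c P by (simp add: left_diff_distrib sum_subtractf)
    qed
    then have "c n - of_real (alias_coeff l h n) = 0" if "n \<in> {- int N..int N}" for n
      using coefficients_zero_if_zero_at_nodes[OF _ that, of "\<lambda>n. c n - of_real (alias_coeff l h n)"] by (simp only: h_def)
    then show "p = P" unfolding fun_eq_iff c P by (intro allI sum.cong) auto
  qed
  moreover have "k_poly l N = P" unfolding P_def h_def by (rule k_poly_eq_interp_poly[OF assms(1)])
  ultimately show ?thesis using le extremal unfolding L_def[symmetric] \<Theta>_def by auto
qed

end
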